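(* Let $p\ge 1$ be an integer, let $\beta\in(1/3,1]$, and let $\{X_t\}_{t=-\infty}^{\infty}$ be an $\operatorname{AR}(p)$ process $X_t=\phi_1X_{t-1}+\cdots+\phi_pX_{t-p}+Z_t$, where $\{Z_t\}$ are i.i.d. with $\mathrm{E}Z_t=0$, $\mathrm{E}Z_t^2=\sigma^2$, probability density function $f$ and cumulative distribution function $F$. Assume: (i) $F\in C^{(1,\beta)}(\mathbb{R})$ and there is a constant $C_f>0$ with $0<f(z)\le C_f$ for all $z\in\mathbb{R}$. (ii) $\{X_t\}$ is strictly stationary and causal, that is, $\inf_{|z|\le1}|1-\phi_1z-\cdots-\phi_pz^p|>0$ (infimum over complex $z$). (iii) The kernel $K$ is a symmetric probability density supported on $[-1,1]$ with $K\in C^{(2)}(\mathbb{R})$. (iv) The bandwidth $h=h_n>0$ satisfies $n^{-3/8}\ll h_n\ll n^{-1/\{2(1+\beta)\}}$ as $n\to\infty$. (v) $\mathrm{E}|Z_t|^{6+3\eta}<\infty$ for some $\eta\in(6/5,+\infty)$. (vi) There exists $\gamma>0$ such that $M_n=\max(|X_1|,\dots,|X_n|)$ satisfies $M_n=O_p(n^\gamma)$. Then, as $n\to\infty$, $$\sup_{z\in\mathbb{R}}\bigl|\hat F(z)-\tilde F(z)\bigr|=o_p\bigl(n^{-1/2}\bigr),$$ where $\tilde F$ is the kernel distribution estimator based on the errors $Z_1,\dots,Z_n$ and $\hat F$ is the kernel distribution estimator based on the Yule--Walker residuals $\hat Z_1,\dots,\hat Z_n$. In particular, the same conclusion holds if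 (i)--(iv) hold and, in place of (v) and (vi), the $Z_t$ satisfy the exponential tail condition (E) stated in the context.
   Context: $C^{(\nu,\beta)}(\mathbb{R})$ is the set of functions $\phi:\mathbb{R}\to\mathbb{R}$ whose $\nu$-th derivative satisfies $\sup_{x\neq y}|\phi^{(\nu)}(x)-\phi^{(\nu)}(y)|/|x-y|^{\beta}<\infty$. For positive sequences, $a_n\ll b_n$ means $a_n/b_n\to0$. The observations are $\{X_t\}_{t=1-p}^n$. The Yule--Walker estimator of $(\phi_1,\dots,\phi_p)^T$ is $\hat{\boldsymbol\phi}=(\hat\phi_1,\dots,\hat\phi_p)^T=\hat{\boldsymbol\Gamma}_p^{-1}\hat{\boldsymbol\gamma}_p$, where $\hat{\boldsymbol\Gamma}_p=\{\hat\gamma(i-j)\}_{i,j=1}^p$, $\hat{\boldsymbol\gamma}_p=(\hat\gamma(1),\dots,\hat\gamma(p))^T$ and $\hat\gamma(l)=n^{-1}\sum_{i=1-p}^{n-|l|}X_iX_{i+|l|}$ for $l=0,\pm1,\dots,\pm p$. The residuals are $\hat Z_t=X_t-\hat\phi_1X_{t-1}-\cdots-\hat\phi_pX_{t-p}$, $1\le t\le n$. With $K_h(u)=h^{-1}K(u/h)$, the estimators are $$\tilde F(z)=n^{-1}\sum_{t=1}^n\int_{-\infty}^zK_h(u-Z_t)\,du,\qquad \hat F(z)=n^{-1}\sum_{t=1}^n\int_{-\infty}^zK_h(u-\hat Z_t)\,du,\qquad z\in\mathbb{R}.$$ Exponential tail condition (E): let $Z$ have the same distribution as the $Z_t$. There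 exist constants $\sigma_z>0$ and $\lambda>0$ such that one of the following holds. (1) $0<\lambda\le1$ and, for some constants $C_z>0$, $c_z\in\mathbb{R}$, $P(|\sigma_zZ|>z)\sim C_zz^{c_z}\exp(-z^\lambda)$ as $z\to+\infty$. (2) $\lambda>1$ and, for some constants $C_{z,+},C_{z,-}>0$, $c_{z,+},c_{z,-}\in\mathbb{R}$, $\sigma_z^{-1}f(\sigma_z^{-1}z)\sim C_{z,+}z^{c_{z,+}}\exp(-z^\lambda)$ as $z\to+\infty$ and $\sigma_z^{-1}f(\sigma_z^{-1}z)\sim C_{z,-}(-z)^{c_{z,-}}\exp(-(-z)^\lambda)$ as $z\to-\infty$; moreover, for $D(z)=\sigma_z^{-1}f(\sigma_z^{-1}z)\exp(|z|^\lambda)$ and its derivative $D'(z)$, one has $D(z)\sim C_{z,+}z^{c_{z,+}}$ as $z\to+\infty$, $D(z)\sim C_{z,-}(-z)^{c_{z,-}}$ as $z\to-\infty$, and $\limsup_{|z|\to\infty}|zD'(z)/D(z)|<\infty$. *)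

theory Defs
  imports "HOL-Probability.Probability" "Jordan_Normal_Form.Gauss_Jordan_Elimination"
begin

definition holder_class :: "nat \<Rightarrow> real \<Rightarrow> (real \<Rightarrow> real) set" where
  "holder_class \<nu> \<beta> = {g. (\<forall>k<\<nu>. \<forall>x. (deriv ^^ k) g differentiable at x) \<and>
     bdd_above {\<bar>(deriv ^^ \<nu>) g x - (deriv ^^ \<nu>) g y\<bar> / \<bar>x - y\<bar> powr \<beta> | x y. x \<noteq> y}}"

definition cont_diff_class :: "nat \<Rightarrow> (real \<Rightarrow> real) set" where
  "cont_diff_class \<nu> = {g. (\<forall>k<\<nu>. \<forall>x. (deriv ^^ k) g differentiable at x) \<and>
     continuous_on UNIV ((deriv ^^ \<nu>) g)}"

definition seq_much_less :: "(nat \<Rightarrow> real) \<Rightarrow> (nat \<Rightarrow> real) \<Rightarrow> bool" where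
  "seq_much_less a b \<longleftrightarrow> (\<lambda>n. a n / b n) \<longlonglongrightarrow> 0"

text \<open>Measurability is part of both stochastic order notions, because \<^const>\<open>measure\<close> returns
  the default value 0 on a non-measurable set.\<close>

definition big_o_prob ::
    "'a measure \<Rightarrow> (nat \<Rightarrow> 'a \<Rightarrow> real) \<Rightarrow> (nat \<Rightarrow> real) \<Rightarrow> bool" where
  "big_o_prob M Y a \<longleftrightarrow> (\<forall>n. Y n \<in> borel_measurable M) \<and>
     (\<forall>\<epsilon>>0. \<exists>C>0. \<forall>\<^sub>F n in sequentially.
        measure M {\<omega> \<in> space M. \<bar>Y n \<omega>\<bar> > C * a n} \<le> \<epsilon>)"

definition small_o_prob ::
    "'a measure \<Rightarrow> (nat \<Rightarrow> 'a \<Rightarrow> real) \<Rightarrow> (nat \<Rightarrow> real) \<Rightarrow> bool" where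
  "small_o_prob M Y a \<longleftrightarrow> (\<forall>n. Y n \<in> borel_measurable M) \<and>
     (\<forall>\<epsilon>>0. (\<lambda>n. measure M {\<omega> \<in> space M. \<bar>Y n \<omega>\<bar> > \<epsilon> * a n}) \<longlonglongrightarrow> 0)"

definition strictly_stationary :: "'a measure \<Rightarrow> (int \<Rightarrow> 'a \<Rightarrow> real) \<Rightarrow> bool" where
  "strictly_stationary M X \<longleftrightarrow> (\<forall>t. X t \<in> borel_measurable M) \<and>
     (\<forall>J s. finite J \<longrightarrow>
        distr M (Pi\<^sub>M J (\<lambda>_. borel)) (\<lambda>\<omega>. \<lambda>t\<in>J. X (t + s) \<omega>) =
        distr M (Pi\<^sub>M J (\<lambda>_. borel)) (\<lambda>\<omega>. \<lambda>t\<in>J. X t \<omega>))"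

definition ar_causal :: "nat \<Rightarrow> (nat \<Rightarrow> real) \<Rightarrow> bool" where
  "ar_causal p \<phi> \<longleftrightarrow>
     (INF z\<in>{z :: complex. norm z \<le> 1}. norm (1 - (\<Sum>i=1..p. of_real (\<phi> i) * z ^ i))) > 0"

definition ar_process ::
    "'a measure \<Rightarrow> nat \<Rightarrow> (nat \<Rightarrow> real) \<Rightarrow> (int \<Rightarrow> 'a \<Rightarrow> real) \<Rightarrow> (int \<Rightarrow> 'a \<Rightarrow> real) \<Rightarrow> bool" where
  "ar_process M p \<phi> X Z \<longleftrightarrow> (\<forall>t. X t \<in> borel_measurable M) \<and>
     (\<forall>t. AE \<omega> in M. X t \<omega> = (\<Sum>i=1..p. \<phi> i * X (t - int i) \<omega>) + Z t \<omega>)"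

definition iid_noise ::
    "'a measure \<Rightarrow> (int \<Rightarrow> 'a \<Rightarrow> real) \<Rightarrow> real \<Rightarrow> (real \<Rightarrow> real) \<Rightarrow> (real \<Rightarrow> real) \<Rightarrow> bool" where
  "iid_noise M Z \<sigma> f F \<longleftrightarrow>
     prob_space.indep_vars M (\<lambda>_. borel) Z UNIV \<and>
     (\<forall>t. distributed M lborel (Z t) (\<lambda>z. ennreal (f z))) \<and>
     (\<forall>t. cdf (distr M borel (Z t)) = F) \<and>
     (\<forall>t. has_bochner_integral M (Z t) 0) \<and>
     (\<forall>t. has_bochner_integral M (\<lambda>\<omega>. (Z t \<omega>)\<^sup>2) (\<sigma>\<^sup>2))"

definition symmetric_kernel :: "(real \<Rightarrow> real) \<Rightarrow> bool" where
  "symmetric_kernel K \<longleftrightarrow>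
     (\<forall>u. K u \<ge> 0) \<and> has_bochner_integral lborel K 1 \<and>
     (\<forall>u. K (- u) = K u) \<and> (\<forall>u. \<bar>u\<bar> > 1 \<longrightarrow> K u = 0)"

definition scaled_kernel :: "(real \<Rightarrow> real) \<Rightarrow> real \<Rightarrow> real \<Rightarrow> real" where
  "scaled_kernel K h u = K (u / h) / h"

definition kernel_cdf ::
    "(real \<Rightarrow> real) \<Rightarrow> real \<Rightarrow> nat \<Rightarrow> (int \<Rightarrow> real) \<Rightarrow> real \<Rightarrow> real" where
  "kernel_cdf K h n e z = (\<Sum>t=1..int n. LBINT u:{..z}. scaled_kernel K h (u - e t)) / real n"

text \<open>In the following, \<open>x\<close> is one sample path; only the observations \<open>x (1 - p), \<dots>, x n\<close> are
  used. Matrices and vectors are indexed from 0, so the coefficient of lag \<open>i\<close> is entry \<open>i - 1\<close>.\<close>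

definition sample_acov :: "nat \<Rightarrow> nat \<Rightarrow> (int \<Rightarrow> real) \<Rightarrow> int \<Rightarrow> real" where
  "sample_acov p n x l = (\<Sum>i=1 - int p..int n - \<bar>l\<bar>. x i * x (i + \<bar>l\<bar>)) / real n"

definition sample_acov_mat :: "nat \<Rightarrow> nat \<Rightarrow> (int \<Rightarrow> real) \<Rightarrow> real Matrix.mat" where
  "sample_acov_mat p n x = Matrix.mat p p (\<lambda>(i, j). sample_acov p n x (int i - int j))"

definition sample_acov_vec :: "nat \<Rightarrow> nat \<Rightarrow> (int \<Rightarrow> real) \<Rightarrow> real Matrix.vec" where
  "sample_acov_vec p n x = Matrix.vec p (\<lambda>i. sample_acov p n x (int i + 1))"

text \<open>A singular sample autocovariance matrix, for which the estimator is set to 0 by convention,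
  only occurs if \<open>n = 0\<close> or if all observations vanish.\<close>

definition yule_walker :: "nat \<Rightarrow> nat \<Rightarrow> (int \<Rightarrow> real) \<Rightarrow> real Matrix.vec" where
  "yule_walker p n x = (case mat_inverse (sample_acov_mat p n x) of
       Some B \<Rightarrow> B *\<^sub>v sample_acov_vec p n x
     | None \<Rightarrow> 0\<^sub>v p)"

definition yw_residual :: "nat \<Rightarrow> nat \<Rightarrow> (int \<Rightarrow> real) \<Rightarrow> int \<Rightarrow> real" where
  "yw_residual p n x t =
     x t - (\<Sum>i=1..p. vec_index (yule_walker p n x) (i - 1) * x (t - int i))"

definition abs_max :: "(int \<Rightarrow> real) \<Rightarrow> nat \<Rightarrow> real" where
  "abs_max x n = Max ((\<lambda>t. \<bar>x t\<bar>) ` {1..int n})"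

definition exp_tail_small ::
    "'a measure \<Rightarrow> ('a \<Rightarrow> real) \<Rightarrow> real \<Rightarrow> real \<Rightarrow> bool" where
  "exp_tail_small M Z \<sigma>z l \<longleftrightarrow> 0 < l \<and> l \<le> 1 \<and>
     (\<exists>C c. C > 0 \<and>
        (\<lambda>z. measure M {\<omega> \<in> space M. \<bar>\<sigma>z * Z \<omega>\<bar> > z}) \<sim>[at_top]
        (\<lambda>z. C * z powr c * exp (- (z powr l))))"

text \<open>The derivative of \<open>D\<close> is only required to exist for all sufficiently large \<open>\<bar>z\<bar>\<close>, which is
  where the condition on it is imposed.\<close>

definition exp_tail_large :: "(real \<Rightarrow> real) \<Rightarrow> real \<Rightarrow> real \<Rightarrow> bool" where
  "exp_tail_large f \<sigma>z l \<longleftrightarrow> 1 < l \<and>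
     (let g = (\<lambda>z. f (z / \<sigma>z) / \<sigma>z);
          D = (\<lambda>z. g z * exp (\<bar>z\<bar> powr l))
      in \<exists>Cp Cm cp cm. Cp > 0 \<and> Cm > 0 \<and>
           g \<sim>[at_top] (\<lambda>z. Cp * z powr cp * exp (- (z powr l))) \<and>
           g \<sim>[at_bot] (\<lambda>z. Cm * (- z) powr cm * exp (- ((- z) powr l))) \<and>
           D \<sim>[at_top] (\<lambda>z. Cp * z powr cp) \<and>
           D \<sim>[at_bot] (\<lambda>z. Cm * (- z) powr cm) \<and>
           (\<forall>\<^sub>F z in at_infinity. D differentiable at z) \<and>
           Limsup at_infinity (\<lambda>z. ereal \<bar>z * deriv D z / D z\<bar>) < \<infinity>)"

definition exp_tail :: "'a measure \<Rightarrow> ('a \<Rightarrow> real) \<Rightarrow> (real \<Rightarrow> real) \<Rightarrow> bool" where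
  "exp_tail M Z f \<longleftrightarrow> (\<exists>\<sigma>z l. \<sigma>z > 0 \<and> l > 0 \<and> (exp_tail_small M Z \<sigma>z l \<or> exp_tail_large f \<sigma>z l))"

end

theory Submission
  imports Defs "HOL-Complex_Analysis.Complex_Analysis" "Jordan_Normal_Form.Determinant"
begin

text \<open>Let \<open>G\<close> be the distribution function of \<open>K\<close>. The residuals are
  \<open>Z t + (\<Sum>i. (\<phi> i - \<phi>' i) * X (t - i))\<close>, where \<open>\<phi>'\<close> is the Yule-Walker estimator, and
  \<open>sqrt n * (\<phi> - \<phi>')\<close> is bounded in probability. So it suffices to bound, uniformly in \<open>z\<close> and in \<open>\<theta>\<close>
  from a compact set, the average of \<open>G ((z - Z t - \<theta> \<bullet> Y t / sqrt n) / h) - G ((z - Z t) / h)\<close>,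
  where \<open>Y t\<close> consists of the past \<open>p\<close> observations. By monotonicity of \<open>G\<close> it is enough to treat
  finitely many \<open>\<theta>\<close>, at the price of an additional shift by \<open>\<epsilon> * norm (Y t) / sqrt n\<close>, and the \<open>z\<close> in
  the infinite grid of mesh \<open>\<epsilon> / sqrt n\<close>. The conditional mean given the past is handled by the
  Hoelder condition on the density and by the law of large numbers for \<open>X\<close>. The rest is a sum
  of martingale differences. For a shift \<open>a = O(1 / sqrt n)\<close>, each increment of \<open>G\<close> is at most
  \<open>C * a / h\<close>, and the increments at all grid points sum up to at most \<open>a * sqrt n / \<epsilon> + 1\<close>. Hence the
  variances, normalised by \<open>n\<close> and summed over the whole grid, are \<open>O(1 / (h * sqrt n))\<close>, and
  Chebyshev's inequality with the union bound suffices.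

  For the rate of the Yule-Walker estimator, the sample covariance matrix is bounded below
  without a law of large numbers for products of the observations: expressing \<open>Y (t + 1)\<close> by \<open>Y t\<close> and
  \<open>Z t\<close> adds, up to vanishing cross terms, a multiple of the average of \<open>(Z t)\<^sup>2\<close> to one
  coordinate, and after \<open>p\<close> steps all coordinates have been reached.\<close>

section \<open>Coefficients of the causal expansion\<close>

text \<open>Martingale differences need regressors that are functions of strictly earlier
  innovations, while \<open>X\<close> is only assumed to be stationary and to satisfy the recursion
  almost surely. It is therefore replaced by the causal series in the \<open>Z\<close>, which is
  measurable with respect to the past and has a second moment; causality makes the two agree almost
  surely. The estimated coefficients depend on the whole sample, so the residual shift is not a
  function of the past; rounding it to one of finitely many deterministic vectors restores this. In
  the conditional mean, the drift is a common slope times the average shift, and it vanishes because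
  the averages of lagged observations do. The slack that pays for rounding and for the mesh does not
  vanish with \<open>n\<close>, so it is fixed as a small fraction of the target error, once the
  stochastic bounds that multiply it are known. The fluctuation bound has order 1 / (h sqrt n),
  which tends to 0 because h is much larger than n to the power -3/8.\<close>

primrec ar_rem :: "nat \<Rightarrow> (nat \<Rightarrow> real) \<Rightarrow> nat \<Rightarrow> nat \<Rightarrow> real" where
  "ar_rem p \<phi> 0 l = (if l = 0 then 1 else 0)"
| "ar_rem p \<phi> (Suc m) l = ar_rem p \<phi> m (Suc l) + ar_rem p \<phi> m 0 * (if l < p then \<phi> (Suc l) else 0)"

text \<open>The power series coefficients of the reciprocal of the characteristic polynomial.
  \<open>ar_rem p \<phi> m l\<close> is the coefficient of \<open>x (t - m - l)\<close> after
  \<open>m\<close> substitutions of the recursion; each substitution of the latest remaining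
  observation releases one innovation, with the coefficient which that observation had.\<close>

definition ma_coeff :: "nat \<Rightarrow> (nat \<Rightarrow> real) \<Rightarrow> nat \<Rightarrow> real" where
  "ma_coeff p \<phi> m = ar_rem p \<phi> m 0"

lemma ar_rem_eq_0: "p \<ge> 1 \<Longrightarrow> l \<ge> p \<Longrightarrow> ar_rem p \<phi> m l = 0"
  by (induction m arbitrary: l) auto

lemma ar_expansion:
  assumes p: "p \<ge> 1"
    and x: "\<And>s. x s = (\<Sum>i=1..p. \<phi> i * x (s - int i)) + z s"
  shows "x t = (\<Sum>j<m. ma_coeff p \<phi> j * z (t - int j)) + (\<Sum>l<p. ar_rem p \<phi> m l * x (t - int m - int l))"
proof (induction m)
  case 0
  have "(\<Sum>l<p. ar_rem p \<phi> 0 l * x (t - int 0 - int l)) = (\<Sum>l\<in>{0}. ar_rem p \<phi> 0 l * x (t - int 0 - int l))"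
    using p by (intro sum.mono_neutral_right) auto
  then show ?case by simp
next
  case (Suc m)
  let ?r = "ar_rem p \<phi>"
  have s1: "(\<Sum>l<p. ?r m l * x (t - int m - int l))
      = (\<Sum>l<Suc p. ?r m l * x (t - int m - int l))"
    using ar_rem_eq_0[OF p, of p \<phi> m] by simp
  also have "\<dots> = ?r m 0 * x (t - int m) + (\<Sum>l<p. ?r m (Suc l) * x (t - int (Suc m) - int l))"
    by (subst sum.lessThan_Suc_shift) (simp add: algebra_simps)
  also have "x (t - int m) = (\<Sum>i=1..p. \<phi> i * x (t - int m - int i)) + z (t - int m)"
    by (rule x)
  also have "(\<Sum>i=1..p. \<phi> i * x (t - int m - int i)) = (\<Sum>l<p. \<phi> (Suc l) * x (t - int (Suc m) - int l))"
    by (rule sum.reindex_bij_witness[of _ Suc "\<lambda>i. i - 1"]) (auto simp: algebra_simps)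
  also have "?r m 0 * ((\<Sum>l<p. \<phi> (Suc l) * x (t - int (Suc m) - int l)) + z (t - int m))
       + (\<Sum>l<p. ?r m (Suc l) * x (t - int (Suc m) - int l))
     = ma_coeff p \<phi> m * z (t - int m) + (\<Sum>l<p. ?r (Suc m) l * x (t - int (Suc m) - int l))"
    by (simp add: algebra_simps sum.distrib sum_distrib_left ma_coeff_def)
  finally show ?case using Suc.IH by simp
qed

text \<open>Unrolling the recursion for \<open>ar_rem\<close> along increasing \<open>l\<close>
  until step 0 is reached. At \<open>l = 0\<close> this is the recursion for the power series
  coefficients of a reciprocal, which is how it is used.\<close>

lemma ar_rem_conv:
  "ar_rem p \<phi> m l = (\<Sum>k<m. (if l + k < p then \<phi> (Suc (l + k)) else 0) * ma_coeff p \<phi> (m - 1 - k))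
     + (if l + m = 0 then 1 else 0)"
proof (induction m arbitrary: l)
  case 0 then show ?case by simp
next
  case (Suc m)
  have "ar_rem p \<phi> (Suc m) l = ar_rem p \<phi> m (Suc l) + ma_coeff p \<phi> m * (if l < p then \<phi> (Suc l) else 0)"
    by (simp add: ma_coeff_def)
  also have "ar_rem p \<phi> m (Suc l) = (\<Sum>k<m. (if l + Suc k < p then \<phi> (Suc (l + Suc k)) else 0) * ma_coeff p \<phi> (m - 1 - k))"
    by (subst Suc.IH) (simp cong del: if_weak_cong)
  finally show ?case
    by (subst sum.lessThan_Suc_shift) (simp del: ar_rem.simps)
qed

text \<open>The characteristic polynomial has finitely many zeros, none in the closed unit disc, so
  it is zero-free on a disc of radius \<open>r > 1\<close>. The power series of its reciprocal has
  radius of convergence at least \<open>r\<close> and converges absolutely at 1. The second claim is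
  that 1 is not a zero.\<close>

lemma ma_coeff_summable:
  assumes "ar_causal p \<phi>"
  shows "summable (\<lambda>m. \<bar>ma_coeff p \<phi> m\<bar>)" and "(\<Sum>i=1..p. \<phi> i) \<noteq> 1"
proof -
  define Q :: "complex poly" where "Q = 1 - (\<Sum>i=1..p. Polynomial.monom (of_real (\<phi> i)) i)"
  have polyQ: "poly Q z = 1 - (\<Sum>i=1..p. of_real (\<phi> i) * z ^ i)" for z
    by (simp add: Q_def poly_sum poly_monom)
  have nz: "poly Q z \<noteq> 0" if "norm z \<le> 1" for z
  proof
    assume "poly Q z = 0"
    then have "norm (1 - (\<Sum>i=1..p. of_real (\<phi> i) * z ^ i)) = 0" by (simp add: polyQ)
    moreover have "(INF z\<in>{z :: complex. norm z \<le> 1}. norm (1 - (\<Sum>i=1..p. of_real (\<phi> i) * z ^ i)))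
      \<le> norm (1 - (\<Sum>i=1..p. of_real (\<phi> i) * z ^ i))"
      by (rule cINF_lower) (use that in \<open>auto intro!: bdd_belowI[of _ 0]\<close>)
    ultimately show False using assms unfolding ar_causal_def by linarith
  qed
  show "(\<Sum>i=1..p. \<phi> i) \<noteq> 1"
  proof
    assume "(\<Sum>i=1..p. \<phi> i) = 1"
    then have "(\<Sum>i=1..p. complex_of_real (\<phi> i)) = 1" by (metis of_real_1 of_real_sum)
    then show False using nz[of 1] polyQ[of 1] by simp
  qed
  have "Q \<noteq> 0" using nz[of 0] by auto
  then have fin: "finite {z. poly Q z = 0}" by (rule poly_roots_finite)
  \<comment> \<open>The extra element 2 keeps the minimum defined when there are no zeros; any
    number above 1 would do.\<close>
  define r where "r = Min (insert 2 (norm ` {z. poly Q z = 0}))"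
  have r1: "r > 1" unfolding r_def using fin nz by (subst Min_gr_iff) (auto simp: not_le[symmetric])
  define P where "P = fps_of_poly Q"
  define S where "S = Abs_fps (\<lambda>m. complex_of_real (ma_coeff p \<phi> m))"
  have P0: "fps_nth P 0 = 1"
    by (auto simp: P_def Q_def coeff_sum)
  have PS: "fps_nth P (Suc k) = - of_real (if k < p then \<phi> (Suc k) else 0)" for k
  proof -
    have "(\<Sum>i=1..p. Polynomial.coeff (Polynomial.monom (complex_of_real (\<phi> i)) i) (Suc k))
       = (\<Sum>i=1..p. if i = Suc k then complex_of_real (\<phi> i) else 0)"
      by (rule sum.cong) auto
    also have "\<dots> = of_real (if k < p then \<phi> (Suc k) else 0)"
      by (subst sum.delta) auto
    finally show ?thesis by (simp add: P_def Q_def coeff_sum)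
  qed
  \<comment> \<open>Coefficientwise, this is \<open>ar_rem_conv\<close> at
    \<open>l = 0\<close>.\<close>
  have "P * S = 1"
  proof (rule fps_ext)
    fix m
    have "fps_nth (P * S) m = (\<Sum>i=0..m. fps_nth P i * of_real (ma_coeff p \<phi> (m - i)))"
      by (simp add: fps_mult_nth S_def)
    also have "{0..m} = {..<Suc m}" by auto
    also have "(\<Sum>i<Suc m. fps_nth P i * of_real (ma_coeff p \<phi> (m - i)))
       = of_real (ma_coeff p \<phi> m - (\<Sum>k<m. (if k < p then \<phi> (Suc k) else 0) * ma_coeff p \<phi> (m - 1 - k)))"
      by (subst sum.lessThan_Suc_shift) (simp add: P0 PS sum_negf)
    also have "\<dots> = (if m = 0 then 1 else 0)"
      using ar_rem_conv[of p \<phi> m 0] unfolding ma_coeff_def[symmetric] add_0 by simp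
    finally show "fps_nth (P * S) m = fps_nth 1 m" by simp
  qed
  then have inv: "inverse P = S" by (rule fps_inverse_unique)
  have "fps_conv_radius (inverse P) \<ge> min (ereal r) (fps_conv_radius P)"
  proof (rule fps_conv_radius_inverse)
    fix z :: complex assume "ereal (norm z) < ereal r"
    then have z: "norm z < r" by simp
    show "eval_fps P z \<noteq> 0"
    proof
      assume "eval_fps P z = 0"
      then have "poly Q z = 0" by (simp add: P_def)
      then have "r \<le> norm z" unfolding r_def using fin by (intro Min_le) auto
      then show False using z by simp
    qed
  qed
  then have "fps_conv_radius S \<ge> ereal r" unfolding inv by (simp add: P_def)
  then have "ereal (norm (1::complex)) < fps_conv_radius S"
    using r1 by (metis ereal_less_eq(3) less_ereal.simps(1) norm_one order_less_le_trans)
  from norm_summable_fps[OF this] show "summable (\<lambda>m. \<bar>ma_coeff p \<phi> m\<bar>)"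
    by (simp add: S_def)
qed

text \<open>Downward induction on \<open>l\<close>: the coefficient is 0 for
  \<open>l \<ge> p\<close>, and at \<open>l\<close> the recursion adds to the value at
  \<open>Suc l\<close> a multiple of \<open>ma_coeff\<close>, which tends to 0 by
  summability.\<close>

lemma ar_rem_tendsto_0:
  assumes "ar_causal p \<phi>" "p \<ge> 1"
  shows "(\<lambda>m. ar_rem p \<phi> m l) \<longlonglongrightarrow> 0"
proof -
  have psi: "(\<lambda>m. ar_rem p \<phi> m 0) \<longlonglongrightarrow> 0"
    using summable_LIMSEQ_zero[OF ma_coeff_summable(1)[OF assms(1)]]
    unfolding ma_coeff_def by (simp add: tendsto_rabs_zero_iff)
  show ?thesis
  proof (induction "p - l" arbitrary: l)
    case 0
    then show ?case using ar_rem_eq_0[OF assms(2), of l] by simp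
  next
    case (Suc k)
    then have "(\<lambda>m. ar_rem p \<phi> m (Suc l)) \<longlonglongrightarrow> 0" by auto
    from tendsto_add[OF this tendsto_mult_right[OF psi, of "if l < p then \<phi> (Suc l) else 0"]]
    have "(\<lambda>m. ar_rem p \<phi> (Suc m) l) \<longlonglongrightarrow> 0" by simp
    then show ?case by (rule LIMSEQ_imp_Suc)
  qed
qed

section \<open>The Yule-Walker equations along a sample path\<close>

definition norm1 :: "nat \<Rightarrow> (nat \<Rightarrow> real) \<Rightarrow> real" where
  "norm1 p v = (\<Sum>i=1..p. \<bar>v i\<bar>)"

definition regress :: "nat \<Rightarrow> (nat \<Rightarrow> real) \<Rightarrow> (int \<Rightarrow> real) \<Rightarrow> int \<Rightarrow> real" where
  "regress p v x t = (\<Sum>i=1..p. v i * x (t - int i))"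

definition companion :: "nat \<Rightarrow> (nat \<Rightarrow> real) \<Rightarrow> (nat \<Rightarrow> real) \<Rightarrow> nat \<Rightarrow> real" where
  "companion p \<phi> v i = v 1 * \<phi> i + (if i < p then v (Suc i) else 0)"

lemma norm1_nonneg: "0 \<le> norm1 p v"
  by (simp add: norm1_def sum_nonneg)

lemma abs_le_norm1: "i \<in> {1..p} \<Longrightarrow> \<bar>v i\<bar> \<le> norm1 p v"
  unfolding norm1_def by (rule member_le_sum) auto

lemma abs_sum_le_norm1:
  assumes "\<And>i. i \<in> {1..p} \<Longrightarrow> \<bar>y i\<bar> \<le> b"
  shows "\<bar>\<Sum>i=1..p. v i * y i\<bar> \<le> norm1 p v * b"
proof -
  have "\<bar>\<Sum>i=1..p. v i * y i\<bar> \<le> (\<Sum>i=1..p. \<bar>v i * y i\<bar>)" by (rule sum_abs)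
  also have "\<dots> \<le> (\<Sum>i=1..p. \<bar>v i\<bar> * b)"
    using assms by (intro sum_mono) (auto simp: abs_mult intro!: mult_left_mono)
  finally show ?thesis by (simp add: norm1_def sum_distrib_right)
qed

lemma sum_Suc_le:
  fixes g :: "nat \<Rightarrow> real"
  assumes "\<And>i. 0 \<le> g i"
  shows "(\<Sum>i=1..p. if i < p then g (Suc i) else 0) \<le> (\<Sum>i=1..p. g i)"
proof -
  have "(\<Sum>i=1..p. if i < p then g (Suc i) else 0) = (\<Sum>i=1..<p. g (Suc i))"
    by (rule sum.mono_neutral_cong_right) auto
  also have "\<dots> = (\<Sum>i=2..p. g i)"
    by (rule sum.reindex_bij_witness[of _ "\<lambda>i. i - 1" Suc]) auto
  also have "\<dots> \<le> (\<Sum>i=1..p. g i)"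
    using assms by (intro sum_mono2) auto
  finally show ?thesis .
qed

lemma norm1_companion:
  assumes "p \<ge> 1"
  shows "norm1 p (companion p \<phi> v) \<le> (norm1 p \<phi> + 1) * norm1 p v"
proof -
  have "norm1 p (companion p \<phi> v) \<le> (\<Sum>i=1..p. \<bar>v 1\<bar> * \<bar>\<phi> i\<bar> + (if i < p then \<bar>v (Suc i)\<bar> else 0))"
    unfolding norm1_def companion_def by (intro sum_mono) (auto simp: abs_mult[symmetric])
  also have "\<dots> = \<bar>v 1\<bar> * norm1 p \<phi> + (\<Sum>i=1..p. if i < p then \<bar>v (Suc i)\<bar> else 0)"
    by (simp add: sum.distrib norm1_def sum_distrib_left)
  also have "\<dots> \<le> norm1 p v * norm1 p \<phi> + norm1 p v"
    using abs_le_norm1[of 1 p v] assms sum_Suc_le[of "\<lambda>i. \<bar>v i\<bar>" p]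
    by (intro add_mono mult_right_mono) (auto simp: norm1_nonneg norm1_def[of p v])
  finally show ?thesis by (simp add: algebra_simps)
qed

lemma regress_shift:
  assumes p: "p \<ge> 1" and x: "\<And>s. x s = regress p \<phi> x s + z s"
  shows "regress p v x (t + 1) = v 1 * z t + regress p (companion p \<phi> v) x t"
proof -
  have "regress p v x (t + 1) = (\<Sum>i\<in>insert 1 {2..p}. v i * x (t + 1 - int i))"
    unfolding regress_def using p by (intro sum.cong) auto
  also have "\<dots> = v 1 * x t + (\<Sum>i=2..p. v i * x (t + 1 - int i))"
    by simp
  also have "(\<Sum>i=2..p. v i * x (t + 1 - int i)) = (\<Sum>i=1..<p. v (Suc i) * x (t - int i))"
    by (rule sum.reindex_bij_witness[of _ Suc "\<lambda>i. i - 1"]) (auto simp: algebra_simps of_nat_diff)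
  also have "\<dots> = (\<Sum>i=1..p. (if i < p then v (Suc i) else 0) * x (t - int i))"
    by (rule sum.mono_neutral_cong_left) auto
  also have "v 1 * x t = v 1 * z t + (\<Sum>i=1..p. v 1 * \<phi> i * x (t - int i))"
    by (subst x) (simp add: regress_def algebra_simps sum_distrib_left)
  finally show ?thesis
    unfolding regress_def[of p "companion p \<phi> v"] companion_def
    by (simp add: sum.distrib distrib_right)
qed

definition energy :: "nat \<Rightarrow> nat \<Rightarrow> (int \<Rightarrow> real) \<Rightarrow> (nat \<Rightarrow> real) \<Rightarrow> real" where
  "energy p n x v = (\<Sum>t=1..int n. (regress p v x t)\<^sup>2) / real n"

lemma energy_nonneg: "0 \<le> energy p n x v"
  by (simp add: energy_def sum_nonneg)

text \<open>Shifting time by one turns the linear form with coefficients \<open>v\<close> into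
  \<open>v 1 * z t\<close> plus the form with coefficients \<open>companion p \<phi> v\<close>.
  Expanding the square releases the innovation energy; the cross terms and the one summand lost by
  the shift are of order \<open>\<eta>\<close>.\<close>

lemma energy_companion:
  assumes p: "p \<ge> 1" and n: "n \<ge> 1" and x: "\<And>s. x s = regress p \<phi> x s + z s"
    and hz: "c * real n \<le> (\<Sum>t=1..int n - 1. (z t)\<^sup>2)"
    and hN: "\<And>i. i \<in> {1..p} \<Longrightarrow> \<bar>\<Sum>t=1..int n - 1. z t * x (t - int i)\<bar> \<le> \<eta> * real n"
    and hx: "\<And>i. i \<in> {1..p} \<Longrightarrow> (x (int n - int i))\<^sup>2 \<le> \<eta> * real n"
  shows "c * (v 1)\<^sup>2 + energy p n x (companion p \<phi> v)
     \<le> energy p n x v + \<eta> * (norm1 p v + norm1 p (companion p \<phi> v))\<^sup>2"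
proof -
  define w where "w = companion p \<phi> v"
  let ?I = "{1..int n - 1}"
  have e0: "0 \<le> \<eta> * real n" using hx[of 1] p by (auto intro: order_trans[OF zero_le_power2])
  have "(\<Sum>t\<in>?I. (v 1 * z t + regress p w x t)\<^sup>2) = (\<Sum>t=2..int n. (regress p v x t)\<^sup>2)"
    unfolding w_def
    by (rule sum.reindex_bij_witness[of _ "\<lambda>t. t - 1" "\<lambda>t. t + 1"])
      (auto simp: regress_shift[OF p x, simplified])
  also have "\<dots> \<le> (\<Sum>t=1..int n. (regress p v x t)\<^sup>2)" by (rule sum_mono2) auto
  also have "\<dots> = real n * energy p n x v" using n by (simp add: energy_def)
  finally have 1: "(\<Sum>t\<in>?I. (v 1 * z t + regress p w x t)\<^sup>2) \<le> real n * energy p n x v" .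
  have 2: "(\<Sum>t\<in>?I. (v 1 * z t + regress p w x t)\<^sup>2)
     = (v 1)\<^sup>2 * (\<Sum>t\<in>?I. (z t)\<^sup>2) + 2 * (v 1 * (\<Sum>t\<in>?I. z t * regress p w x t)) + (\<Sum>t\<in>?I. (regress p w x t)\<^sup>2)"
    by (simp add: power2_sum sum.distrib sum_distrib_left power_mult_distrib algebra_simps)
  have "(\<Sum>t\<in>?I. z t * regress p w x t) = (\<Sum>i=1..p. w i * (\<Sum>t\<in>?I. z t * x (t - int i)))"
    unfolding regress_def sum_distrib_left by (subst sum.swap) (simp add: algebra_simps)
  then have "\<bar>\<Sum>t\<in>?I. z t * regress p w x t\<bar> \<le> norm1 p w * (\<eta> * real n)"
    using hN by (simp only:) (rule abs_sum_le_norm1, auto)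
  then have "\<bar>v 1 * (\<Sum>t\<in>?I. z t * regress p w x t)\<bar> \<le> norm1 p v * (norm1 p w * (\<eta> * real n))"
    unfolding abs_mult using abs_le_norm1[of 1 p v] p
    by (intro mult_mono) (auto simp: norm1_nonneg)
  then have 3: "- (norm1 p v * (norm1 p w * (\<eta> * real n))) \<le> v 1 * (\<Sum>t\<in>?I. z t * regress p w x t)"
    by linarith
  \<comment> \<open>The shifted sum stops at \<open>n - 1\<close>, whereas \<open>energy\<close>
    includes time \<open>n\<close>.\<close>
  have "{1..int n} = insert (int n) ?I" using n by auto
  then have 4: "(\<Sum>t\<in>?I. (regress p w x t)\<^sup>2) = real n * energy p n x w - (regress p w x (int n))\<^sup>2"
    using n by (simp add: energy_def)
  have "\<bar>regress p w x (int n)\<bar> \<le> norm1 p w * sqrt (\<eta> * real n)"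
    unfolding regress_def
    by (rule abs_sum_le_norm1) (use hx in \<open>auto intro: real_le_rsqrt[of "\<bar>_\<bar>", simplified]\<close>)
  then have "(regress p w x (int n))\<^sup>2 \<le> (norm1 p w * sqrt (\<eta> * real n))\<^sup>2"
    by (metis abs_ge_zero power2_abs power_mono)
  then have 5: "(regress p w x (int n))\<^sup>2 \<le> (norm1 p w)\<^sup>2 * (\<eta> * real n)"
    using e0 by (simp add: power_mult_distrib)
  have 6: "(v 1)\<^sup>2 * (c * real n) \<le> (v 1)\<^sup>2 * (\<Sum>t\<in>?I. (z t)\<^sup>2)"
    by (rule mult_left_mono[OF hz]) simp
  have 7: "0 \<le> (norm1 p v)\<^sup>2 * (\<eta> * real n)" using e0 by simp
  have "real n * (c * (v 1)\<^sup>2 + energy p n x w) \<le> real n * (energy p n x v + \<eta> * (norm1 p v + norm1 p w)\<^sup>2)"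
    using 1 2 3 4 5 6 7 by (simp add: algebra_simps power2_sum)
  then show ?thesis using n unfolding w_def[symmetric] by simp
qed

text \<open>\<open>companion\<close> is the transposed companion matrix of the recursion; the first coordinates of
  the iterates of \<open>v\<close> under it determine \<open>v\<close>.\<close>

lemma companion_observable:
  assumes "p \<ge> 1" and U: "\<And>k. k < p \<Longrightarrow> \<bar>((companion p \<phi> ^^ k) v) 1\<bar> \<le> U"
  shows "norm1 p v \<le> real p * (1 + real p * norm1 p \<phi>) * U"
proof -
  have U0: "0 \<le> U" using U[of 0] assms(1) by (auto intro: order_trans[OF abs_ge_zero])
  \<comment> \<open>One application moves the next coordinate down and adds a multiple of the
    current first coordinate, so after \<open>k\<close> steps position \<open>i\<close> holds
    \<open>v (i + k)\<close> up to \<open>k\<close> errors of size at most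
    \<open>U * norm1 p \<phi>\<close>. At \<open>i = 1\<close> this recovers
    \<open>v (k + 1)\<close>.\<close>
  have *: "\<bar>(companion p \<phi> ^^ k) v i - v (i + k)\<bar> \<le> real k * U * norm1 p \<phi>" if "1 \<le> i" "i + k \<le> p" for i k
    using that
  proof (induction k arbitrary: i)
    case 0 then show ?case by simp
  next
    case (Suc k)
    let ?w = "(companion p \<phi> ^^ k) v"
    have "\<bar>?w 1 * \<phi> i\<bar> \<le> U * norm1 p \<phi>"
      unfolding abs_mult using Suc.prems U[of k] abs_le_norm1[of i p \<phi>] U0 by (intro mult_mono) auto
    moreover have "\<bar>?w (Suc i) - v (Suc i + k)\<bar> \<le> real k * U * norm1 p \<phi>"
      using Suc.prems by (intro Suc.IH) auto
    moreover have "(companion p \<phi> ^^ Suc k) v i = ?w 1 * \<phi> i + ?w (Suc i)"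
      using Suc.prems by (simp add: companion_def[of p \<phi> ?w])
    ultimately show ?case by (simp add: algebra_simps del: funpow.simps)
  qed
  have "norm1 p v \<le> (\<Sum>i=1..p. (1 + real p * norm1 p \<phi>) * U)"
    unfolding norm1_def[of p v]
  proof (rule sum_mono)
    fix i assume i: "i \<in> {1..p}"
    then have "i - 1 < p" by auto
    then have "\<bar>v i\<bar> \<le> U + real (i - 1) * U * norm1 p \<phi>"
      using *[of 1 "i - 1"] U[of "i - 1"] i by auto
    also have "real (i - 1) * U * norm1 p \<phi> \<le> real p * U * norm1 p \<phi>"
      using i U0 norm1_nonneg by (intro mult_right_mono) auto
    finally show "\<bar>v i\<bar> \<le> (1 + real p * norm1 p \<phi>) * U" by (simp add: algebra_simps)
  qed
  then show ?thesis by simp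
qed

text \<open>Applying \<open>energy_companion\<close> to \<open>p\<close> successive iterates
  telescopes: the squared first coordinates are bounded by the energy plus an error of order
  \<open>\<eta>\<close> times the squared norm, and observability bounds the norm by these
  coordinates. A small \<open>\<eta>\<close> lets the left side absorb the error. The constants
  depend neither on the path nor on \<open>n\<close>.\<close>

lemma energy_coercive:
  assumes p: "p \<ge> 1" and c: "c > 0"
  obtains \<kappa> \<eta> where "\<kappa> > 0" "\<eta> > 0"
    "\<And>x z n v. \<lbrakk>n \<ge> 1; \<And>s. x s = regress p \<phi> x s + z s; c * real n \<le> (\<Sum>t=1..int n - 1. (z t)\<^sup>2);
      \<And>i. i \<in> {1..p} \<Longrightarrow> \<bar>\<Sum>t=1..int n - 1. z t * x (t - int i)\<bar> \<le> \<eta> * real n;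
      \<And>i. i \<in> {1..p} \<Longrightarrow> (x (int n - int i))\<^sup>2 \<le> \<eta> * real n\<rbrakk>
      \<Longrightarrow> \<kappa> * (norm1 p v)\<^sup>2 \<le> energy p n x v"
proof -
  \<comment> \<open>\<open>L\<close> majorises the growth factor of \<open>companion\<close> and
    also the sum of two successive norms; \<open>A\<close> is the factor in
    \<open>companion_observable\<close>; \<open>\<eta>\<close> is chosen so that the error to be
    absorbed has factor exactly \<open>c / 2\<close>.\<close>
  define L where "L = norm1 p \<phi> + 2"
  define D where "D = real p * L ^ (2 * p)"
  define A where "A = real p * (1 + real p * norm1 p \<phi>)"
  define \<eta> where "\<eta> = c / (2 * A\<^sup>2 * D)"
  have L: "L \<ge> 1" "L > 0" using norm1_nonneg[of p \<phi>] by (auto simp: L_def)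
  have D: "D > 0" using p L by (simp add: D_def)
  have A: "A > 0" using p norm1_nonneg[of p \<phi>] by (auto simp: A_def intro!: mult_pos_pos add_pos_nonneg)
  have \<eta>: "\<eta> > 0" using c A D by (simp add: \<eta>_def)
  show ?thesis
  proof (rule that[of "c / (2 * A\<^sup>2)" \<eta>])
    show "0 < c / (2 * A\<^sup>2)" using c A by simp
    show "\<eta> > 0" by fact
    fix x z n v
    assume n: "n \<ge> 1" and x: "\<And>s. x s = regress p \<phi> x s + z s"
      and hz: "c * real n \<le> (\<Sum>t=1..int n - 1. (z t)\<^sup>2)"
      and hN: "\<And>i. i \<in> {1..p} \<Longrightarrow> \<bar>\<Sum>t=1..int n - 1. z t * x (t - int i)\<bar> \<le> \<eta> * real n"
      and hx: "\<And>i. i \<in> {1..p} \<Longrightarrow> (x (int n - int i))\<^sup>2 \<le> \<eta> * real n"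
    define w where "w k = (companion p \<phi> ^^ k) v" for k
    let ?N = "norm1 p v"
    have N0: "0 \<le> ?N" by (rule norm1_nonneg)
    have nw: "norm1 p (w k) \<le> L ^ k * ?N" for k
    proof (induction k)
      case 0 then show ?case by (simp add: w_def)
    next
      case (Suc k)
      have "norm1 p (w (Suc k)) \<le> (norm1 p \<phi> + 1) * norm1 p (w k)"
        unfolding w_def by (simp add: norm1_companion[OF p])
      also have "\<dots> \<le> L * (L ^ k * ?N)"
        using Suc L norm1_nonneg[of p "w k"] by (intro mult_mono) (auto simp: L_def)
      finally show ?case by simp
    qed
    have step: "c * (w k 1)\<^sup>2 + energy p n x (w (Suc k)) \<le> energy p n x (w k) + L ^ (2 * Suc k) * (\<eta> * ?N\<^sup>2)" for k
    proof -
      have "c * (w k 1)\<^sup>2 + energy p n x (w (Suc k))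
        \<le> energy p n x (w k) + \<eta> * (norm1 p (w k) + norm1 p (w (Suc k)))\<^sup>2"
        using energy_companion[OF p n x hz hN hx, of "w k"] by (simp add: w_def)
      moreover have "norm1 p (w k) + norm1 p (w (Suc k)) \<le> L * norm1 p (w k)"
        using norm1_companion[OF p, of \<phi> "w k"] by (simp add: w_def L_def algebra_simps)
      then have "norm1 p (w k) + norm1 p (w (Suc k)) \<le> L * (L ^ k * ?N)"
        using nw[of k] L by (meson mult_left_mono order_trans less_imp_le)
      then have "(norm1 p (w k) + norm1 p (w (Suc k)))\<^sup>2 \<le> (L * (L ^ k * ?N))\<^sup>2"
        by (intro power_mono add_nonneg_nonneg norm1_nonneg)
      then have "\<eta> * (norm1 p (w k) + norm1 p (w (Suc k)))\<^sup>2 \<le> \<eta> * (L * (L ^ k * ?N))\<^sup>2"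
        using \<eta> by (intro mult_left_mono) auto
      moreover have "L ^ (2 * Suc k) = L\<^sup>2 * (L ^ k)\<^sup>2"
        by (metis power_mult power_mult_distrib mult.commute power_Suc)
      then have "\<eta> * (L * (L ^ k * ?N))\<^sup>2 = L ^ (2 * Suc k) * (\<eta> * ?N\<^sup>2)"
        by (simp add: power_mult_distrib)
      ultimately show ?thesis by linarith
    qed
    have eN: "0 \<le> \<eta> * ?N\<^sup>2" using \<eta> by simp
    have en: "energy p n x (w k) \<le> energy p n x v + real k * L ^ (2 * p) * (\<eta> * ?N\<^sup>2)" if "k \<le> p" for k
      using that
    proof (induction k)
      case 0 then show ?case by (simp add: w_def)
    next
      case (Suc k)
      have "0 \<le> c * (w k 1)\<^sup>2" using c by simp
      then have "energy p n x (w (Suc k)) \<le> energy p n x (w k) + L ^ (2 * Suc k) * (\<eta> * ?N\<^sup>2)"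
        using step[of k] by linarith
      moreover have "L ^ (2 * Suc k) * (\<eta> * ?N\<^sup>2) \<le> L ^ (2 * p) * (\<eta> * ?N\<^sup>2)"
        using Suc.prems L eN by (intro mult_right_mono power_increasing) auto
      ultimately show ?case using Suc by (simp add: algebra_simps)
    qed
    \<comment> \<open>A common bound for all \<open>(w k 1)\<^sup>2\<close> with
      \<open>k < p\<close>, from the telescoped inequality divided by \<open>c\<close>.\<close>
    define s where "s = (energy p n x v + D * (\<eta> * ?N\<^sup>2)) / c"
    have "(w k 1)\<^sup>2 \<le> s" if "k < p" for k
    proof -
      have "c * (w k 1)\<^sup>2 \<le> energy p n x (w k) + L ^ (2 * Suc k) * (\<eta> * ?N\<^sup>2)"
        using step[of k] energy_nonneg[of p n x "w (Suc k)"] by linarith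
      also have "L ^ (2 * Suc k) * (\<eta> * ?N\<^sup>2) \<le> L ^ (2 * p) * (\<eta> * ?N\<^sup>2)"
        using that L eN by (intro mult_right_mono power_increasing) auto
      also have "energy p n x (w k) + L ^ (2 * p) * (\<eta> * ?N\<^sup>2) \<le> energy p n x v + real (Suc k) * L ^ (2 * p) * (\<eta> * ?N\<^sup>2)"
        using en[of k] that by (simp add: algebra_simps)
      also have "\<dots> \<le> energy p n x v + real p * L ^ (2 * p) * (\<eta> * ?N\<^sup>2)"
        using that L eN by (intro add_left_mono mult_right_mono) auto
      finally show ?thesis using c by (simp add: s_def D_def field_simps)
    qed
    then have u: "\<bar>w k 1\<bar> \<le> sqrt s" if "k < p" for k
      using that by (metis real_sqrt_abs real_sqrt_le_iff)
    have s0: "0 \<le> s" using c D eN energy_nonneg[of p n x v] by (simp add: s_def)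
    have "?N \<le> A * sqrt s"
      unfolding A_def using u by (intro companion_observable[OF p]) (auto simp: w_def)
    then have "?N\<^sup>2 \<le> (A * sqrt s)\<^sup>2" using N0 by (intro power_mono)
    then have "?N\<^sup>2 \<le> A\<^sup>2 * s" using s0 by (simp add: power_mult_distrib)
    then have "c * ?N\<^sup>2 \<le> c * (A\<^sup>2 * s)" using c by (intro mult_left_mono) auto
    also have "\<dots> = A\<^sup>2 * energy p n x v + (A\<^sup>2 * D * \<eta>) * ?N\<^sup>2"
      using c by (simp add: s_def field_simps)
    also have "A\<^sup>2 * D * \<eta> = c / 2" using A D by (simp add: \<eta>_def)
    finally have "c / 2 * ?N\<^sup>2 \<le> A\<^sup>2 * energy p n x v" by simp
    then show "c / (2 * A\<^sup>2) * ?N\<^sup>2 \<le> energy p n x v" using A by (simp add: field_simps)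
  qed
qed

section \<open>Sample autocovariances as a Gram matrix, and the Yule-Walker equations\<close>

definition zero_pad :: "nat \<Rightarrow> nat \<Rightarrow> (int \<Rightarrow> real) \<Rightarrow> int \<Rightarrow> real" where
  "zero_pad p n x s = (if 1 - int p \<le> s \<and> s \<le> int n then x s else 0)"

lemma sample_acov_eq:
  assumes "i \<le> p" "j \<le> p"
  shows "sample_acov p n x (int i - int j)
    = (\<Sum>t=1 - int p..int n + int p. zero_pad p n x (t - int i) * zero_pad p n x (t - int j)) / real n"
proof -
  have *: "(\<Sum>t=1 - int p..int n + int p. zero_pad p n x (t - int i) * zero_pad p n x (t - int j))
      = (\<Sum>s=1 - int p..int n - (int i - int j). x s * x (s + (int i - int j)))"
    if "j \<le> i" "i \<le> p" for i j
  proof -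
    have "(\<Sum>t=1 - int p..int n + int p. zero_pad p n x (t - int i) * zero_pad p n x (t - int j))
      = (\<Sum>t=1 - int p + int i..int n + int j. x (t - int i) * x (t - int j))"
      by (rule sum.mono_neutral_cong_right) (use that in \<open>auto simp: zero_pad_def\<close>)
    also have "\<dots> = (\<Sum>s=1 - int p..int n - (int i - int j). x s * x (s + (int i - int j)))"
      by (rule sum.reindex_bij_witness[of _ "\<lambda>s. s + int i" "\<lambda>t. t - int i"]) auto
    finally show ?thesis .
  qed
  show ?thesis
  proof (cases "j \<le> i")
    case True
    then show ?thesis using *[OF True assms(1)] by (simp add: sample_acov_def)
  next
    case False
    then have "i \<le> j" by simp
    from *[OF this assms(2)] show ?thesis using False
      by (simp add: sample_acov_def mult.commute)
  qed
qed

text \<open>The quadratic form is a sum of squares over the enlarged window. Keeping only the times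
  in \<open>{1..int n}\<close> leaves the energy, since there all lags fall into the observed range
  and padding changes nothing.\<close>

lemma acov_quadratic_form:
  assumes n: "n \<ge> 1"
  shows "energy p n x v \<le> (\<Sum>i=1..p. \<Sum>j=1..p. v i * sample_acov p n x (int i - int j) * v j)"
proof -
  let ?T = "{1 - int p..int n + int p}" and ?y = "zero_pad p n x"
  have "(\<Sum>t=1..int n. (regress p v x t)\<^sup>2) = (\<Sum>t=1..int n. (regress p v ?y t)\<^sup>2)"
    by (intro sum.cong refl arg_cong[where f="\<lambda>a. a\<^sup>2"]) (auto simp: regress_def zero_pad_def intro!: sum.cong)
  also have "\<dots> \<le> (\<Sum>t\<in>?T. (regress p v ?y t)\<^sup>2)" by (rule sum_mono2) auto
  also have "\<dots> = (\<Sum>t\<in>?T. \<Sum>i=1..p. \<Sum>j=1..p. v i * (?y (t - int i) * ?y (t - int j)) * v j)"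
    unfolding regress_def power2_eq_square sum_product by (simp add: mult_ac)
  also have "\<dots> = (\<Sum>i=1..p. \<Sum>t\<in>?T. \<Sum>j=1..p. v i * (?y (t - int i) * ?y (t - int j)) * v j)"
    by (rule sum.swap)
  also have "\<dots> = (\<Sum>i=1..p. \<Sum>j=1..p. \<Sum>t\<in>?T. v i * (?y (t - int i) * ?y (t - int j)) * v j)"
    by (intro sum.cong refl sum.swap)
  also have "\<dots> = (\<Sum>i=1..p. \<Sum>j=1..p. v i * (real n * sample_acov p n x (int i - int j)) * v j)"
  proof (intro sum.cong refl)
    fix i j assume "i \<in> {1..p}" "j \<in> {1..p}"
    then have "real n * sample_acov p n x (int i - int j) = (\<Sum>t\<in>?T. ?y (t - int i) * ?y (t - int j))"
      using n by (simp add: sample_acov_eq)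
    then show "(\<Sum>t\<in>?T. v i * (?y (t - int i) * ?y (t - int j)) * v j) = v i * (real n * sample_acov p n x (int i - int j)) * v j"
      by (simp only: sum_distrib_left sum_distrib_right)
  qed
  also have "\<dots> = real n * (\<Sum>i=1..p. \<Sum>j=1..p. v i * sample_acov p n x (int i - int j) * v j)"
    by (simp add: sum_distrib_left mult_ac)
  finally show ?thesis using n by (simp add: energy_def field_simps)
qed

lemma sum_Suc_index: "(\<Sum>i<p. f (Suc i)) = (\<Sum>i=1..p. f i)"
  by (rule sum.reindex_bij_witness[of _ "\<lambda>i. i - 1" Suc]) auto

lemma sample_acov_mat_mult:
  assumes i: "i < p" and w: "w \<in> carrier_vec p"
  shows "vec_index (sample_acov_mat p n x *\<^sub>v w) i
     = (\<Sum>j=1..p. sample_acov p n x (int (Suc i) - int j) * vec_index w (j - 1))"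
proof -
  have "vec_index (sample_acov_mat p n x *\<^sub>v w) i = (\<Sum>j<p. sample_acov p n x (int i - int j) * vec_index w j)"
    using i w by (simp add: sample_acov_mat_def scalar_prod_def lessThan_atLeast0)
  then show ?thesis using sum_Suc_index[of "\<lambda>j. sample_acov p n x (int (Suc i) - int j) * vec_index w (j - 1)" p]
    by simp
qed

lemma sample_acov_mat_carrier: "sample_acov_mat p n x \<in> carrier_mat p p"
  and sample_acov_vec_carrier: "sample_acov_vec p n x \<in> carrier_vec p"
  by (auto simp: sample_acov_mat_def sample_acov_vec_def)

lemma yule_walker_solves:
  assumes "Determinant.det (sample_acov_mat p n x) \<noteq> 0"
  shows "yule_walker p n x \<in> carrier_vec p"
    and "sample_acov_mat p n x *\<^sub>v yule_walker p n x = sample_acov_vec p n x"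
proof -
  let ?A = "sample_acov_mat p n x" and ?g = "sample_acov_vec p n x"
  note A = sample_acov_mat_carrier[of p n x] and g = sample_acov_vec_carrier[of p n x]
  \<comment> \<open>The argument \<open>()\<close> only fills the arbitrary extension field of the
    matrix ring record.\<close>
  have "mat_inverse ?A \<noteq> None"
    using mat_inverse(1)[OF A, of "()"] det_non_zero_imp_unit[OF A assms, of "()"] by blast
  then obtain B where B: "mat_inverse ?A = Some B" by blast
  with mat_inverse(2)[OF A B] have AB: "?A * B = 1\<^sub>m p" "B \<in> carrier_mat p p" by auto
  have yw: "yule_walker p n x = B *\<^sub>v ?g" by (simp add: yule_walker_def B)
  then show "yule_walker p n x \<in> carrier_vec p" using AB g by auto
  have "?A *\<^sub>v (B *\<^sub>v ?g) = (?A * B) *\<^sub>v ?g" by (rule assoc_mult_mat_vec[symmetric, OF A AB(2) g])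
  then show "?A *\<^sub>v yule_walker p n x = ?g" using AB g yw by simp
qed

text \<open>Used for measurability: Cramer's rule exhibits the estimator as a quotient of
  polynomials in the sample autocovariances. A vanishing determinant is exactly the case in which
  \<open>mat_inverse\<close> returns \<open>None\<close>.\<close>

lemma yule_walker_cramer:
  assumes "i < p"
  shows "vec_index (yule_walker p n x) i =
    (if Determinant.det (sample_acov_mat p n x) = 0 then 0
     else Determinant.det (replace_col (sample_acov_mat p n x) (sample_acov_vec p n x) i)
       / Determinant.det (sample_acov_mat p n x))"
proof (cases "Determinant.det (sample_acov_mat p n x) = 0")
  case True
  let ?A = "sample_acov_mat p n x"
  have "mat_inverse ?A = None"
  proof (rule ccontr)
    assume "mat_inverse ?A \<noteq> None"
    then obtain B where "mat_inverse ?A = Some B" by blast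
    from mat_inverse(2)[OF sample_acov_mat_carrier this]
    have AB: "?A * B = 1\<^sub>m p" "B \<in> carrier_mat p p" by auto
    then have "Determinant.det ?A * Determinant.det B = 1"
      using det_mult[OF sample_acov_mat_carrier AB(2), of n x] by simp
    then show False using True by simp
  qed
  then show ?thesis using True assms by (simp add: yule_walker_def)
next
  case False
  from cramer_lemma_mat[OF sample_acov_mat_carrier[of p n x] yule_walker_solves(1)[OF False] assms]
  show ?thesis using False yule_walker_solves(2)[OF False] by (simp add: field_simps)
qed

text \<open>The estimation error solves a linear system with the sample autocovariance matrix. Up to
  sign, its right-hand side consists of the sums of innovations times regressors and of the
  contributions of the \<open>2 * p\<close> times at which padding cuts the recursion. Testing the
  system with the error itself and using coercivity leaves one factor of the norm to cancel.\<close>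

lemma yule_walker_error:
  assumes n: "n \<ge> 1" and x: "\<And>s. x s = regress p \<phi> x s + z s"
    and \<kappa>: "\<kappa> > 0" "\<And>v. \<kappa> * (norm1 p v)\<^sup>2 \<le> energy p n x v"
    and E: "\<And>i. i \<in> {1..p} \<Longrightarrow> \<bar>\<Sum>t=1..int n. z t * x (t - int i)\<bar> \<le> E"
    and S: "\<And>a. a \<in> {1 - int p..0} \<union> {int n + 1 - int p..int n} \<Longrightarrow> \<bar>x a\<bar> \<le> S" "S \<ge> 0"
  shows "\<kappa> * (real n * norm1 p (\<lambda>i. \<phi> i - vec_index (yule_walker p n x) (i - 1)))
     \<le> \<bar>E\<bar> + 2 * real p * (1 + norm1 p \<phi>) * S\<^sup>2"
proof -
  let ?A = "sample_acov_mat p n x" and ?g = "\<lambda>k. sample_acov p n x k" and ?y = "zero_pad p n x"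
  let ?T = "{1 - int p..int n + int p}" and ?E = "{1 - int p..0} \<union> {int n + 1..int n + int p}" and ?r = "\<lambda>i t. ?y (t - int i) * (?y t - regress p \<phi> ?y t)"
  define R where "R = \<bar>E\<bar> + 2 * real p * (1 + norm1 p \<phi>) * S\<^sup>2"
  have R0: "0 \<le> R" using norm1_nonneg[of p \<phi>] by (simp add: R_def)
  \<comment> \<open>Coercivity makes the matrix injective, so the default value 0 of the estimator
    does not occur here.\<close>
  have det: "Determinant.det ?A \<noteq> 0"
  proof
    assume "Determinant.det ?A = 0"
    then obtain w where w: "w \<in> carrier_vec p" "w \<noteq> 0\<^sub>v p" "?A *\<^sub>v w = 0\<^sub>v p"
      using det_0_iff_vec_prod_zero_field[OF sample_acov_mat_carrier] by auto
    define v where "v i = vec_index w (i - 1)" for i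
    have z: "(\<Sum>j=1..p. ?g (int i - int j) * v j) = 0" if "i \<in> {1..p}" for i
    proof -
      have "vec_index (?A *\<^sub>v w) (i - 1) = 0" using that unfolding w(3) by auto
      then show ?thesis using sample_acov_mat_mult[of "i - 1" p w n x] that w(1) by (auto simp: v_def)
    qed
    have "(\<Sum>i=1..p. \<Sum>j=1..p. v i * ?g (int i - int j) * v j)
       = (\<Sum>i=1..p. v i * (\<Sum>j=1..p. ?g (int i - int j) * v j))"
      by (simp add: sum_distrib_left mult_ac)
    also have "\<dots> = 0" using z by simp
    finally have "\<kappa> * (norm1 p v)\<^sup>2 \<le> 0" using \<kappa>(2)[of v] acov_quadratic_form[OF n, of p x v] by linarith
    then have "norm1 p v = 0" using \<kappa>(1) by (simp add: mult_le_0_iff)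
    then have "v i = 0" if "i \<in> {1..p}" for i using abs_le_norm1[OF that, of v] by simp
    then have "v (Suc i) = 0" if "i < p" for i using that by simp
    then have "w = 0\<^sub>v p" using w(1) by (intro eq_vecI) (auto simp: v_def)
    then show False using w(2) by simp
  qed
  define \<delta> where "\<delta> i = \<phi> i - vec_index (yule_walker p n x) (i - 1)" for i
  have bound: "\<bar>real n * (\<Sum>j=1..p. ?g (int i - int j) * \<delta> j)\<bar> \<le> R" if i: "i \<in> {1..p}" for i
  proof -
    \<comment> \<open>Column index 0 stands for the vector \<open>sample_acov_vec\<close>.\<close>
    have yw: "(\<Sum>j=1..p. ?g (int i - int j) * vec_index (yule_walker p n x) (j - 1)) = ?g (int i - int 0)"
      using sample_acov_mat_mult[of "i - 1" p "yule_walker p n x" n x] i yule_walker_solves[OF det]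
      by (auto simp: sample_acov_vec_def of_nat_diff)
    have e: "real n * ?g (int i - int j) = (\<Sum>t\<in>?T. ?y (t - int i) * ?y (t - int j))" if "j \<le> p" for j
      using sample_acov_eq[of i p j n x] i that n by simp
    have "real n * (\<Sum>j=1..p. ?g (int i - int j) * \<delta> j)
       = (\<Sum>j=1..p. (real n * ?g (int i - int j)) * \<phi> j) - real n * ?g (int i - int 0)"
      unfolding yw[symmetric] \<delta>_def by (simp add: sum_distrib_left right_diff_distrib sum_subtractf mult_ac)
    also have "\<dots> = (\<Sum>j=1..p. \<Sum>t\<in>?T. ?y (t - int i) * (?y (t - int j) * \<phi> j)) - (\<Sum>t\<in>?T. ?y (t - int i) * ?y t)"
    proof -
      have "(\<Sum>j=1..p. (real n * ?g (int i - int j)) * \<phi> j) = (\<Sum>j=1..p. \<Sum>t\<in>?T. ?y (t - int i) * (?y (t - int j) * \<phi> j))"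
        by (intro sum.cong refl) (simp add: e sum_distrib_right mult.assoc del: of_nat_diff)
      then show ?thesis using e[of 0] by simp
    qed
    also have "\<dots> = - (\<Sum>t\<in>?T. ?r i t)"
      by (subst sum.swap)
         (simp add: regress_def sum_distrib_left right_diff_distrib sum_subtractf mult_ac)
    \<comment> \<open>Within \<open>{1..int n}\<close> no lag is padded and the recursion leaves the
      innovation; the remaining times form the edges.\<close>
    also have "?T = {1..int n} \<union> ?E" by auto
    also have "(\<Sum>t\<in>{1..int n} \<union> ?E. ?r i t)
       = (\<Sum>t\<in>{1..int n}. ?r i t)
         + (\<Sum>t\<in>?E. ?r i t)"
      by (rule sum.union_disjoint) auto
    also have "(\<Sum>t\<in>{1..int n}. ?r i t) = (\<Sum>t\<in>{1..int n}. z t * x (t - int i))"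
    proof (rule sum.cong[OF refl])
      fix t assume t: "t \<in> {1..int n}"
      have "regress p \<phi> ?y t = regress p \<phi> x t"
        unfolding regress_def using t by (intro sum.cong) (auto simp: zero_pad_def)
      then show "?r i t = z t * x (t - int i)"
        using x[of t] t i by (simp add: zero_pad_def)
    qed
    finally have eq: "\<bar>real n * (\<Sum>j=1..p. ?g (int i - int j) * \<delta> j)\<bar> \<le> \<bar>\<Sum>t\<in>{1..int n}. z t * x (t - int i)\<bar>
         + \<bar>\<Sum>t\<in>?E. ?r i t\<bar>"
      by linarith
    \<comment> \<open>At an edge time every shifted value is either a padded 0 or one of the first
      or last \<open>p\<close> observations, which \<open>S\<close> bounds.\<close>
    have edge: "\<bar>?r i t\<bar> \<le> (1 + norm1 p \<phi>) * S\<^sup>2"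
      if t: "t \<in> ?E" for t
    proof -
      have y: "\<bar>?y (t - int j)\<bar> \<le> S" if "j \<le> p" for j
      proof (cases "1 - int p \<le> t - int j \<and> t - int j \<le> int n")
        case True
        then have "t - int j \<in> {1 - int p..0} \<union> {int n + 1 - int p..int n}" using t that by auto
        then show ?thesis using S(1) True by (simp add: zero_pad_def)
      qed (auto simp: zero_pad_def S(2))
      have "\<bar>regress p \<phi> ?y t\<bar> \<le> norm1 p \<phi> * S"
        unfolding regress_def by (rule abs_sum_le_norm1) (use y in auto)
      then have "\<bar>?y t - regress p \<phi> ?y t\<bar> \<le> (1 + norm1 p \<phi>) * S"
        using y[of 0] by (simp add: algebra_simps)
      then have "\<bar>?y (t - int i)\<bar> * \<bar>?y t - regress p \<phi> ?y t\<bar> \<le> S * ((1 + norm1 p \<phi>) * S)"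
        using y[of i] i S(2) by (intro mult_mono) auto
      moreover have "S * ((1 + norm1 p \<phi>) * S) = (1 + norm1 p \<phi>) * S\<^sup>2" by (simp add: power2_eq_square)
      ultimately show ?thesis by (simp only: abs_mult)
    qed
    have "\<bar>\<Sum>t\<in>?E. ?r i t\<bar>
       \<le> (\<Sum>t\<in>?E. (1 + norm1 p \<phi>) * S\<^sup>2)"
      by (rule order_trans[OF sum_abs]) (intro sum_mono edge)
    also have "\<dots> = real (card ?E) * ((1 + norm1 p \<phi>) * S\<^sup>2)"
      by simp
    also have "card ?E = 2 * p"
      by (subst card_Un_disjoint) auto
    also have "real (2 * p) * ((1 + norm1 p \<phi>) * S\<^sup>2) = 2 * real p * (1 + norm1 p \<phi>) * S\<^sup>2" by simp
    finally show ?thesis using eq E[OF i] unfolding R_def by linarith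
  qed
  have "\<kappa> * (norm1 p \<delta>)\<^sup>2 \<le> (\<Sum>i=1..p. \<Sum>j=1..p. \<delta> i * ?g (int i - int j) * \<delta> j)"
    using \<kappa>(2)[of \<delta>] acov_quadratic_form[OF n, of p x \<delta>] by linarith
  then have "real n * (\<kappa> * (norm1 p \<delta>)\<^sup>2) \<le> real n * (\<Sum>i=1..p. \<Sum>j=1..p. \<delta> i * ?g (int i - int j) * \<delta> j)"
    by (intro mult_left_mono) auto
  also have "\<dots> = (\<Sum>i=1..p. \<delta> i * (real n * (\<Sum>j=1..p. ?g (int i - int j) * \<delta> j)))"
    by (simp add: sum_distrib_left mult_ac)
  also have "\<dots> \<le> norm1 p \<delta> * R"
    by (rule order_trans[OF abs_ge_self abs_sum_le_norm1[OF bound]])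
  finally have "norm1 p \<delta> * (\<kappa> * (real n * norm1 p \<delta>)) \<le> norm1 p \<delta> * R"
    by (simp add: power2_eq_square mult_ac)
  \<comment> \<open>Cancelling \<open>norm1 p \<delta>\<close>; if it is 0, the claim is
    \<open>0 \<le> R\<close>.\<close>
  then have "\<kappa> * (real n * norm1 p \<delta>) \<le> R"
    using norm1_nonneg[of p \<delta>] R0 by (cases "norm1 p \<delta> = 0") auto
  then show ?thesis by (simp add: R_def \<delta>_def[abs_def])
qed

section \<open>Events of high probability and innovation sums\<close>

context prob_space
begin

text \<open>Along the sequence, \<open>E n\<close> fails at most on an event whose probability is eventually at most \<open>\<tau>\<close>.\<close>

definition whp :: "real \<Rightarrow> (nat \<Rightarrow> 'a \<Rightarrow> bool) \<Rightarrow> bool" where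
  "whp \<tau> E \<longleftrightarrow> (\<exists>B. (\<forall>n. B n \<in> events) \<and>
     (\<forall>\<^sub>F n in sequentially. prob (B n) \<le> \<tau> \<and> (AE \<omega> in M. \<omega> \<notin> B n \<longrightarrow> E n \<omega>)))"

lemma whp_conj:
  assumes "whp \<tau>1 E1" "whp \<tau>2 E2"
  shows "whp (\<tau>1 + \<tau>2) (\<lambda>n \<omega>. E1 n \<omega> \<and> E2 n \<omega>)"
proof -
  obtain B1 B2 where B: "\<forall>n. B1 n \<in> events" "\<forall>n. B2 n \<in> events"
    "\<forall>\<^sub>F n in sequentially. prob (B1 n) \<le> \<tau>1 \<and> (AE \<omega> in M. \<omega> \<notin> B1 n \<longrightarrow> E1 n \<omega>)"
    "\<forall>\<^sub>F n in sequentially. prob (B2 n) \<le> \<tau>2 \<and> (AE \<omega> in M. \<omega> \<notin> B2 n \<longrightarrow> E2 n \<omega>)"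
    using assms unfolding whp_def by (elim exE conjE)
  from B(3,4) have "\<forall>\<^sub>F n in sequentially. prob (B1 n \<union> B2 n) \<le> \<tau>1 + \<tau>2
      \<and> (AE \<omega> in M. \<omega> \<notin> B1 n \<union> B2 n \<longrightarrow> E1 n \<omega> \<and> E2 n \<omega>)"
  proof eventually_elim
    case (elim n)
    have "prob (B1 n \<union> B2 n) \<le> prob (B1 n) + prob (B2 n)"
      using B by (intro measure_Un_le) auto
    moreover from elim have "AE \<omega> in M. \<omega> \<notin> B1 n \<longrightarrow> E1 n \<omega>" "AE \<omega> in M. \<omega> \<notin> B2 n \<longrightarrow> E2 n \<omega>" by auto
    then have "AE \<omega> in M. \<omega> \<notin> B1 n \<union> B2 n \<longrightarrow> E1 n \<omega> \<and> E2 n \<omega>"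
      by eventually_elim auto
    ultimately show ?case using elim by linarith
  qed
  then show ?thesis unfolding whp_def using B(1,2) by (intro exI[of _ "\<lambda>n. B1 n \<union> B2 n"]) auto
qed

text \<open>The exceptional events are kept, so the new property need not define a measurable set,
  and it may follow from the old one only almost surely and for large \<open>n\<close>.\<close>

lemma whp_mono:
  assumes "whp \<tau> E" "\<forall>\<^sub>F n in sequentially. AE \<omega> in M. E n \<omega> \<longrightarrow> E' n \<omega>"
  shows "whp \<tau> E'"
proof -
  obtain B where B: "\<forall>n. B n \<in> events"
    "\<forall>\<^sub>F n in sequentially. prob (B n) \<le> \<tau> \<and> (AE \<omega> in M. \<omega> \<notin> B n \<longrightarrow> E n \<omega>)"
    using assms(1) unfolding whp_def by (elim exE conjE)
  from B(2) assms(2) have "\<forall>\<^sub>F n in sequentially. prob (B n) \<le> \<tau> \<and> (AE \<omega> in M. \<omega> \<notin> B n \<longrightarrow> E' n \<omega>)"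
  proof eventually_elim
    case (elim n)
    then show ?case by (auto elim: AE_mp)
  qed
  then show ?thesis unfolding whp_def using B(1) by blast
qed

text \<open>Union bound. The level is halved whenever an index is added, which is why the hypothesis
  is required at every level.\<close>

lemma whp_ball:
  assumes "finite I" "\<And>i \<tau>. i \<in> I \<Longrightarrow> \<tau> > 0 \<Longrightarrow> whp \<tau> (E i)" "\<tau> > 0"
  shows "whp \<tau> (\<lambda>n \<omega>. \<forall>i\<in>I. E i n \<omega>)"
  using assms
proof (induction I arbitrary: \<tau> rule: finite_induct)
  case empty
  then show ?case unfolding whp_def by (intro exI[of _ "\<lambda>_. {}"]) auto
next
  case (insert i I)
  have "whp (\<tau> / 2) (E i)" using insert.prems by auto
  moreover have "whp (\<tau> / 2) (\<lambda>n \<omega>. \<forall>i\<in>I. E i n \<omega>)" using insert.prems by (intro insert.IH) auto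
  ultimately have "whp (\<tau> / 2 + \<tau> / 2) (\<lambda>n \<omega>. E i n \<omega> \<and> (\<forall>i\<in>I. E i n \<omega>))" by (rule whp_conj)
  then show ?case by simp
qed

lemma whp_ball_tight:
  assumes "finite I" "\<And>i \<tau>. i \<in> I \<Longrightarrow> \<tau> > 0 \<Longrightarrow> \<exists>C. whp \<tau> (\<lambda>n \<omega>. Y i n \<omega> \<le> (C :: real))" "\<tau> > 0"
  shows "\<exists>C. whp \<tau> (\<lambda>n \<omega>. \<forall>i\<in>I. Y i n \<omega> \<le> C)"
  using assms
proof (induction I arbitrary: \<tau> rule: finite_induct)
  case empty
  then show ?case unfolding whp_def by (intro exI[of _ 0] exI[of _ "\<lambda>_. {}"]) auto
next
  case (insert i I)
  obtain C1 where 1: "whp (\<tau> / 2) (\<lambda>n \<omega>. Y i n \<omega> \<le> C1)" using insert.prems(1)[of i "\<tau> / 2"] insert.prems(2) by auto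
  obtain C2 where 2: "whp (\<tau> / 2) (\<lambda>n \<omega>. \<forall>i\<in>I. Y i n \<omega> \<le> C2)" using insert.IH[of "\<tau> / 2"] insert.prems by auto
  have "whp (\<tau> / 2 + \<tau> / 2) (\<lambda>n \<omega>. \<forall>i\<in>insert i I. Y i n \<omega> \<le> max C1 C2)"
    by (rule whp_mono[OF whp_conj[OF 1 2]]) (auto simp: le_max_iff_disj)
  then show ?case by auto
qed

lemma markov_bound:
  fixes Y :: "'a \<Rightarrow> real"
  assumes "integrable M Y" "\<And>\<omega>. 0 \<le> Y \<omega>" "expectation Y \<le> b" "a > 0"
  shows "prob {\<omega> \<in> space M. a < Y \<omega>} \<le> b / a"
proof -
  have [measurable]: "Y \<in> borel_measurable M" using assms(1) by auto
  have "prob {\<omega> \<in> space M. a < Y \<omega>} \<le> prob {\<omega> \<in> space M. a \<le> Y \<omega>}"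
    by (intro finite_measure_mono) auto
  also have "\<dots> \<le> expectation Y / a"
    using assms by (intro integral_Markov_inequality_measure[where A="{}"]) auto
  also have "\<dots> \<le> b / a" using assms by (intro divide_right_mono) auto
  finally show ?thesis .
qed

lemma whp_tight:
  fixes Y :: "nat \<Rightarrow> 'a \<Rightarrow> real"
  assumes "\<And>n. n \<ge> 1 \<Longrightarrow> integrable M (Y n)" "\<And>n \<omega>. n \<ge> 1 \<Longrightarrow> 0 \<le> Y n \<omega>" "\<And>n. n \<ge> 1 \<Longrightarrow> expectation (Y n) \<le> c" "\<tau> > 0"
  shows "\<exists>C. whp \<tau> (\<lambda>n \<omega>. Y n \<omega> \<le> C)"
proof -
  define C where "C = (\<bar>c\<bar> + 1) / \<tau>"
  have C: "C > 0" using assms by (simp add: C_def)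
  \<comment> \<open>Nothing is known about \<open>Y 0\<close>, not even measurability, because later
    instances are averages; index 0 gets the empty event.\<close>
  define B where "B n = (if n = 0 then {} else {\<omega> \<in> space M. C < Y n \<omega>})" for n
  have "B n \<in> events" for n
    using borel_measurable_integrable[OF assms(1)[of n]] by (auto simp: B_def)
  moreover have "prob (B n) \<le> \<tau>" if "n \<ge> 1" for n
  proof -
    have "prob (B n) \<le> c / C" using markov_bound[OF assms(1,2,3) C, of n] that by (simp add: B_def)
    also have "\<dots> \<le> (\<bar>c\<bar> + 1) / C" using C by (intro divide_right_mono) auto
    finally show ?thesis using assms(4) by (simp add: C_def)
  qed
  ultimately have "whp \<tau> (\<lambda>n \<omega>. Y n \<omega> \<le> C)"
    unfolding whp_def
    by (intro exI[of _ B]) (auto simp: eventually_sequentially B_def not_less intro!: exI[of _ 1] AE_I2)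
  then show ?thesis by blast
qed

lemma whp_vanish:
  fixes Y :: "nat \<Rightarrow> 'a \<Rightarrow> real"
  assumes "\<And>n. n \<ge> 1 \<Longrightarrow> integrable M (Y n)" "\<And>n \<omega>. n \<ge> 1 \<Longrightarrow> 0 \<le> Y n \<omega>" "\<And>n. n \<ge> 1 \<Longrightarrow> expectation (Y n) \<le> b n"
    "b \<longlonglongrightarrow> 0" "e > 0" "\<tau> > 0"
  shows "whp \<tau> (\<lambda>n \<omega>. Y n \<omega> \<le> e)"
proof -
  define B where "B n = (if n = 0 then {} else {\<omega> \<in> space M. e < Y n \<omega>})" for n
  have ev: "B n \<in> events" for n
    using borel_measurable_integrable[OF assms(1)[of n]] by (auto simp: B_def)
  have "\<forall>\<^sub>F n in sequentially. b n < \<tau> * e"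
    using assms(4) by (rule order_tendstoD) (use assms in auto)
  then have "\<forall>\<^sub>F n in sequentially. prob (B n) \<le> \<tau> \<and> (AE \<omega> in M. \<omega> \<notin> B n \<longrightarrow> Y n \<omega> \<le> e)"
    using eventually_ge_at_top[of 1]
  proof eventually_elim
    case (elim n)
    have "prob (B n) \<le> b n / e" using markov_bound[OF assms(1,2,3) \<open>e > 0\<close>, of n] elim by (simp add: B_def)
    also have "\<dots> \<le> \<tau>" using elim assms(5) by (simp add: field_simps)
    finally show ?case using elim by (auto simp: B_def not_less intro!: AE_I2)
  qed
  then show ?thesis unfolding whp_def using ev by blast
qed

lemma small_o_probI:
  assumes "\<And>n. Y n \<in> borel_measurable M"
    and "\<And>e \<tau>. e > 0 \<Longrightarrow> \<tau> > 0 \<Longrightarrow> whp \<tau> (\<lambda>n \<omega>. \<bar>Y n \<omega>\<bar> \<le> e * a n)"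
  shows "small_o_prob M Y a"
  unfolding small_o_prob_def
proof (intro conjI allI impI)
  fix e :: real assume e: "e > 0"
  show "(\<lambda>n. prob {\<omega> \<in> space M. \<bar>Y n \<omega>\<bar> > e * a n}) \<longlonglongrightarrow> 0"
  proof (rule tendstoI)
    fix r :: real assume "r > 0"
    then have "whp (r / 2) (\<lambda>n \<omega>. \<bar>Y n \<omega>\<bar> \<le> e * a n)" using assms(2)[OF e, of "r / 2"] by simp
    then obtain B where B: "\<forall>n. B n \<in> events"
      "\<forall>\<^sub>F n in sequentially. prob (B n) \<le> r / 2 \<and> (AE \<omega> in M. \<omega> \<notin> B n \<longrightarrow> \<bar>Y n \<omega>\<bar> \<le> e * a n)"
      unfolding whp_def by (elim exE conjE)
    from B(2) show "\<forall>\<^sub>F n in sequentially. dist (prob {\<omega> \<in> space M. \<bar>Y n \<omega>\<bar> > e * a n}) 0 < r"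
    proof eventually_elim
      case (elim n)
      have "prob {\<omega> \<in> space M. \<bar>Y n \<omega>\<bar> > e * a n} \<le> prob (B n)"
        using B(1) elim by (intro finite_measure_mono_AE) auto
      then show ?case using elim \<open>r > 0\<close> by simp
    qed
  qed
qed (rule assms(1))

lemma integrable_mult_of_squares:
  fixes f g :: "'a \<Rightarrow> real"
  assumes [measurable]: "f \<in> borel_measurable M" "g \<in> borel_measurable M"
    and "integrable M (\<lambda>\<omega>. (f \<omega>)\<^sup>2)" "integrable M (\<lambda>\<omega>. (g \<omega>)\<^sup>2)"
  shows "integrable M (\<lambda>\<omega>. f \<omega> * g \<omega>)"
proof (rule Bochner_Integration.integrable_bound)
  show "integrable M (\<lambda>\<omega>. (f \<omega>)\<^sup>2 + (g \<omega>)\<^sup>2)" using assms by auto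
  show "AE \<omega> in M. norm (f \<omega> * g \<omega>) \<le> norm ((f \<omega>)\<^sup>2 + (g \<omega>)\<^sup>2)"
  proof (rule AE_I2)
    fix \<omega>
    have "0 \<le> (\<bar>f \<omega>\<bar> - \<bar>g \<omega>\<bar>)\<^sup>2" by simp
    then have "2 * (\<bar>f \<omega>\<bar> * \<bar>g \<omega>\<bar>) \<le> (f \<omega>)\<^sup>2 + (g \<omega>)\<^sup>2" by (simp add: power2_diff)
    moreover have "0 \<le> \<bar>f \<omega>\<bar> * \<bar>g \<omega>\<bar>" by simp
    ultimately have "\<bar>f \<omega>\<bar> * \<bar>g \<omega>\<bar> \<le> (f \<omega>)\<^sup>2 + (g \<omega>)\<^sup>2" by linarith
    then show "norm (f \<omega> * g \<omega>) \<le> norm ((f \<omega>)\<^sup>2 + (g \<omega>)\<^sup>2)" by (simp add: abs_mult)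
  qed
qed measurable

lemma expectation_square_sum_orthogonal:
  fixes D :: "'b \<Rightarrow> 'a \<Rightarrow> real"
  assumes "finite A" and [measurable]: "\<And>t. t \<in> A \<Longrightarrow> D t \<in> borel_measurable M"
    and "\<And>t. t \<in> A \<Longrightarrow> integrable M (\<lambda>\<omega>. (D t \<omega>)\<^sup>2)"
    and "\<And>s t. s \<in> A \<Longrightarrow> t \<in> A \<Longrightarrow> s \<noteq> t \<Longrightarrow> expectation (\<lambda>\<omega>. D s \<omega> * D t \<omega>) = 0"
  shows "integrable M (\<lambda>\<omega>. (\<Sum>t\<in>A. D t \<omega>)\<^sup>2)"
    and "expectation (\<lambda>\<omega>. (\<Sum>t\<in>A. D t \<omega>)\<^sup>2) = (\<Sum>t\<in>A. expectation (\<lambda>\<omega>. (D t \<omega>)\<^sup>2))"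
proof -
  have int: "integrable M (\<lambda>\<omega>. D s \<omega> * D t \<omega>)" if "s \<in> A" "t \<in> A" for s t
    using assms that by (intro integrable_mult_of_squares) auto
  have eq: "(\<Sum>t\<in>A. D t \<omega>)\<^sup>2 = (\<Sum>s\<in>A. \<Sum>t\<in>A. D s \<omega> * D t \<omega>)" for \<omega>
    by (simp add: power2_eq_square sum_product)
  show "integrable M (\<lambda>\<omega>. (\<Sum>t\<in>A. D t \<omega>)\<^sup>2)"
    unfolding eq by (intro Bochner_Integration.integrable_sum int)
  have "expectation (\<lambda>\<omega>. (\<Sum>t\<in>A. D t \<omega>)\<^sup>2) = (\<Sum>s\<in>A. \<Sum>t\<in>A. expectation (\<lambda>\<omega>. D s \<omega> * D t \<omega>))"
    unfolding eq by (simp add: Bochner_Integration.integral_sum int Bochner_Integration.integrable_sum)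
  also have "\<dots> = (\<Sum>s\<in>A. \<Sum>t\<in>A. if s = t then expectation (\<lambda>\<omega>. (D s \<omega>)\<^sup>2) else 0)"
    using assms(4) by (intro sum.cong refl) (auto simp: power2_eq_square)
  also have "\<dots> = (\<Sum>t\<in>A. expectation (\<lambda>\<omega>. (D t \<omega>)\<^sup>2))"
    using assms(1) by simp
  finally show "expectation (\<lambda>\<omega>. (\<Sum>t\<in>A. D t \<omega>)\<^sup>2) = (\<Sum>t\<in>A. expectation (\<lambda>\<omega>. (D t \<omega>)\<^sup>2))" .
qed

end

section \<open>Innovations and the sigma-algebras of their past\<close>

locale iid_space = prob_space M for M :: "'a measure" +
  fixes Z :: "int \<Rightarrow> 'a \<Rightarrow> real" and P :: "real measure"
  assumes indep: "indep_vars (\<lambda>_. borel) Z UNIV"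
    and distr_Z: "\<And>t. distr M borel (Z t) = P"
begin

lemma Z_measurable [measurable]: "Z t \<in> borel_measurable M"
  using indep by (auto simp: indep_vars_def)

lemma real_distribution_P: "real_distribution P"
  using real_distribution_distr[of "Z 0"] distr_Z[of 0] by simp

sublocale P: real_distribution P by (rule real_distribution_P)

lemma expectation_Z:
  assumes [measurable]: "g \<in> borel_measurable borel"
  shows "expectation (\<lambda>\<omega>. g (Z t \<omega>)) = (\<integral>z. g z \<partial>P :: real)"
  unfolding distr_Z[of t, symmetric] by (subst integral_distr) auto

lemma integrable_Z:
  fixes g :: "real \<Rightarrow> real"
  assumes [measurable]: "g \<in> borel_measurable borel"
  shows "integrable M (\<lambda>\<omega>. g (Z t \<omega>)) \<longleftrightarrow> integrable P g"
  unfolding distr_Z[of t, symmetric] by (subst integrable_distr_eq) auto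

text \<open>Generated by a single map into a product space. The sets are then literally preimages
  under this map, which is the form in which independence of disjoint blocks of innovations is
  available.\<close>

definition past :: "int \<Rightarrow> 'a measure" where
  "past t = vimage_algebra (space M) (\<lambda>\<omega>. \<lambda>u\<in>{..<t}. Z u \<omega>) (Pi\<^sub>M {..<t} (\<lambda>_. borel))"

lemma space_past [simp]: "space (past t) = space M"
  by (simp add: past_def)

lemma Z_restrict_measurable: "(\<lambda>\<omega>. \<lambda>u\<in>I. Z u \<omega>) \<in> measurable M (Pi\<^sub>M I (\<lambda>_. borel))"
  by (intro measurable_restrict) simp

lemma Z_past [measurable]:
  assumes "s < t" shows "Z s \<in> borel_measurable (past t)"
proof -
  have "(\<lambda>\<omega>. \<lambda>u\<in>{..<t}. Z u \<omega>) \<in> measurable (past t) (Pi\<^sub>M {..<t} (\<lambda>_. borel))"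
    unfolding past_def
    by (rule measurable_vimage_algebra1, rule Pi_I, rule measurable_space[OF Z_restrict_measurable])
  then have "(\<lambda>\<omega>. (\<lambda>u\<in>{..<t}. Z u \<omega>) s) \<in> borel_measurable (past t)"
    by (rule measurable_compose[OF _ measurable_component_singleton]) (use assms in simp)
  then show ?thesis using assms by simp
qed

lemma past_mono: "s \<le> t \<Longrightarrow> sets (past s) \<subseteq> sets (past t)"
  unfolding past_def[of s]
  by (intro sets_image_in_sets measurable_restrict) auto

lemma past_subset: "sets (past t) \<subseteq> sets M"
  unfolding past_def by (intro sets_image_in_sets Z_restrict_measurable) auto

lemma measurable_past_mono: "f \<in> measurable (past s) N \<Longrightarrow> s \<le> t \<Longrightarrow> f \<in> measurable (past t) N"
  using past_mono[of s t] by (auto simp: measurable_def)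

lemma measurable_past: "f \<in> measurable (past t) N \<Longrightarrow> f \<in> measurable M N"
  using past_subset[of t] by (auto simp: measurable_def)

text \<open>The restrictions of \<open>Z\<close> to the disjoint blocks \<open>{t}\<close> and
  \<open>{..<t}\<close> are independent, and every event of \<open>W\<close> belongs to the second
  block. The map \<open>g\<close> carries \<open>Z t\<close> into the value type of
  \<open>W\<close>, since \<open>indep_var\<close> demands equal types.\<close>

lemma indep_past:
  assumes W: "W \<in> measurable (past t) N" and g [measurable]: "g \<in> measurable borel N'"
  shows "indep_var N' (\<lambda>\<omega>. g (Z t \<omega>)) N W"
proof -
  let ?Q = "\<lambda>I \<omega>. \<lambda>u\<in>I. Z u \<omega>" and ?\<Pi> = "\<lambda>I :: int set. Pi\<^sub>M I (\<lambda>_. borel :: real measure)"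
  have "indep_var (?\<Pi> {t}) (?Q {t}) (?\<Pi> {..<t}) (?Q {..<t})"
    using indep by (rule indep_var_restrict) auto
  then have ind: "indep_set (sigma_sets (space M) { ?Q {t} -` A \<inter> space M | A. A \<in> sets (?\<Pi> {t})})
      (sigma_sets (space M) { ?Q {..<t} -` A \<inter> space M | A. A \<in> sets (?\<Pi> {..<t})})"
    unfolding indep_var_eq by blast
  have 1: "{(\<lambda>\<omega>. g (Z t \<omega>)) -` A \<inter> space M | A. A \<in> sets N'} \<subseteq> { ?Q {t} -` A \<inter> space M | A. A \<in> sets (?\<Pi> {t})}"
  proof safe
    fix A assume A: "A \<in> sets N'"
    let ?A = "(\<lambda>f. g (f t)) -` A \<inter> space (?\<Pi> {t})"
    have "(\<lambda>f. g (f t)) \<in> measurable (?\<Pi> {t}) N'"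
      by (rule measurable_compose[OF measurable_component_singleton[of t] g]) simp
    then have "?A \<in> sets (?\<Pi> {t})" using A by (rule measurable_sets)
    moreover have "(\<lambda>\<omega>. g (Z t \<omega>)) -` A \<inter> space M = ?Q {t} -` ?A \<inter> space M"
      using measurable_space[OF Z_restrict_measurable[of "{t}"]] by auto
    ultimately show "\<exists>B. (\<lambda>\<omega>. g (Z t \<omega>)) -` A \<inter> space M = ?Q {t} -` B \<inter> space M \<and> B \<in> sets (?\<Pi> {t})" by blast
  qed
  have 2: "{W -` A \<inter> space M | A. A \<in> sets N} \<subseteq> { ?Q {..<t} -` A \<inter> space M | A. A \<in> sets (?\<Pi> {..<t})}"
  proof -
    have "sets (past t) = { ?Q {..<t} -` A \<inter> space M | A. A \<in> sets (?\<Pi> {..<t})}"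
      unfolding past_def using measurable_space[OF Z_restrict_measurable[of "{..<t}"]]
      by (intro sets_vimage_algebra2) auto
    moreover have "W -` A \<inter> space M \<in> sets (past t)" if "A \<in> sets N" for A
      using measurable_sets[OF W that] by simp
    ultimately show ?thesis by auto
  qed
  have "indep_set (sigma_sets (space M) {(\<lambda>\<omega>. g (Z t \<omega>)) -` A \<inter> space M | A. A \<in> sets N'})
      (sigma_sets (space M) {W -` A \<inter> space M | A. A \<in> sets N})"
    using ind unfolding indep_set_def
    by (rule indep_sets_mono_sets) (auto split: bool.split dest: subsetD[OF sigma_sets_mono'[OF 1]] subsetD[OF sigma_sets_mono'[OF 2]])
  then show ?thesis unfolding indep_var_eq using measurable_past[OF W] by simp
qed

text \<open>This takes the place of conditional expectation: \<open>Z t\<close> is independent of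
  the pair of \<open>W\<close> and \<open>J\<close>, so the joint law is a product, and Fubini's
  theorem integrates over the innovation first with \<open>W\<close> and \<open>J\<close> frozen.
  That inner integral is 0 by \<open>cent\<close>.\<close>

lemma expectation_innovation_mult_past:
  fixes H :: "real \<Rightarrow> real \<Rightarrow> real"
  assumes [measurable]: "case_prod H \<in> borel_measurable (borel \<Otimes>\<^sub>M borel)"
    and W: "W \<in> borel_measurable (past t)" and J: "J \<in> borel_measurable (past t)"
    and cent: "\<And>w. (\<integral>z. H z w \<partial>P) = 0"
    and int: "integrable M (\<lambda>\<omega>. H (Z t \<omega>) (W \<omega>) * J \<omega>)"
  shows "expectation (\<lambda>\<omega>. H (Z t \<omega>) (W \<omega>) * J \<omega>) = 0"
proof -
  note [measurable] = measurable_past[OF W] measurable_past[OF J]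
  let ?B = "borel \<Otimes>\<^sub>M borel :: (real \<times> real) measure"
  have WJ: "(\<lambda>\<omega>. (W \<omega>, J \<omega>)) \<in> measurable (past t) ?B" using W J by simp
  note [measurable] = measurable_past[OF WJ]
  \<comment> \<open>The added coordinate 0 gives both factors the type of pairs of reals, as
    \<open>indep_past\<close> requires.\<close>
  let ?R = "distr M ?B (\<lambda>\<omega>. (W \<omega>, J \<omega>))" and ?S = "distr M ?B (\<lambda>\<omega>. (Z t \<omega>, 0))"
  interpret R: prob_space ?R by (rule prob_space_distr) simp
  interpret S: prob_space ?S by (rule prob_space_distr) simp
  interpret PR: pair_sigma_finite ?S ?R ..
  let ?V = "\<lambda>\<omega>. ((Z t \<omega>, 0 :: real), (W \<omega>, J \<omega>))" and ?f = "\<lambda>y. H (fst (fst y)) (fst (snd y)) * snd (snd y)"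
  have eq: "?S \<Otimes>\<^sub>M ?R = distr M (?B \<Otimes>\<^sub>M ?B) ?V"
    using indep_past[OF WJ, of "\<lambda>z. (z, 0 :: real)" ?B] unfolding indep_var_distribution_eq by simp
  have "(\<lambda>y. case_prod H (fst (fst y), fst (snd y)) * snd (snd y)) \<in> borel_measurable (?B \<Otimes>\<^sub>M ?B)" by measurable
  then have f [measurable]: "?f \<in> borel_measurable (?B \<Otimes>\<^sub>M ?B)" by simp
  have "integrable (distr M (?B \<Otimes>\<^sub>M ?B) ?V) ?f"
    using int by (subst integrable_distr_eq) auto
  then have i: "integrable (?S \<Otimes>\<^sub>M ?R) ?f" by (simp add: eq)
  have fe: "(\<lambda>(z, y). ?f (z, y)) = ?f" by auto
  have i': "integrable (?S \<Otimes>\<^sub>M ?R) (\<lambda>(z, y). ?f (z, y))" unfolding fe by (rule i)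
  have inner: "(\<integral>z. ?f (z, y) \<partial>?S) = 0" for y
  proof -
    have Hm: "(\<lambda>z. H z (fst y)) \<in> borel_measurable borel"
    proof -
      have "(\<lambda>z. case_prod H (z, fst y)) \<in> borel_measurable borel" by measurable
      then show ?thesis by simp
    qed
    have fm: "(\<lambda>z. ?f (z, y)) \<in> borel_measurable ?B"
      by simp
    have "(\<integral>z. ?f (z, y) \<partial>?S) = expectation (\<lambda>\<omega>. H (Z t \<omega>) (fst y) * snd y)"
      by (subst integral_distr[OF _ fm]) auto
    also have "\<dots> = (\<integral>z. H z (fst y) \<partial>P) * snd y"
      using expectation_Z[OF Hm, of t] by simp
    finally show ?thesis by (simp add: cent)
  qed
  have "expectation (\<lambda>\<omega>. H (Z t \<omega>) (W \<omega>) * J \<omega>) = integral\<^sup>L (distr M (?B \<Otimes>\<^sub>M ?B) ?V) ?f"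
    by (subst integral_distr) auto
  also have "\<dots> = (\<integral>y. (\<integral>z. ?f (z, y) \<partial>?S) \<partial>?R)"
    unfolding eq[symmetric] using PR.integral_fst'[OF i] PR.Fubini_integral[OF i'] by simp
  also have "\<dots> = 0" unfolding inner by simp
  finally show ?thesis .
qed

text \<open>For \<open>s < t\<close> the term at time \<open>s\<close> is measurable with respect to
  \<open>past t\<close> and serves as \<open>J\<close>, so all mixed terms vanish. The second
  argument of \<open>H\<close> carries the regressor known before time \<open>t\<close>.\<close>

lemma expectation_square_sum_innovations:
  fixes H :: "real \<Rightarrow> real \<Rightarrow> real"
  assumes H: "case_prod H \<in> borel_measurable (borel \<Otimes>\<^sub>M borel)"
    and W: "\<And>t. W t \<in> borel_measurable (past t)"
    and cent: "\<And>w. (\<integral>z. H z w \<partial>P) = 0"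
    and sq: "\<And>t. integrable M (\<lambda>\<omega>. (H (Z t \<omega>) (W t \<omega>))\<^sup>2)" and A: "finite A"
  shows "integrable M (\<lambda>\<omega>. (\<Sum>t\<in>A. H (Z t \<omega>) (W t \<omega>))\<^sup>2)"
    and "expectation (\<lambda>\<omega>. (\<Sum>t\<in>A. H (Z t \<omega>) (W t \<omega>))\<^sup>2) = (\<Sum>t\<in>A. expectation (\<lambda>\<omega>. (H (Z t \<omega>) (W t \<omega>))\<^sup>2))"
proof -
  note [measurable] = H
  have meas: "(\<lambda>\<omega>. H (Z s \<omega>) (W s \<omega>)) \<in> borel_measurable (past t)" if "s < t" for s t
  proof -
    have [measurable]: "W s \<in> borel_measurable (past t)" "Z s \<in> borel_measurable (past t)"
      using measurable_past_mono[OF W[of s], of t] that by auto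
    have "(\<lambda>\<omega>. case_prod H (Z s \<omega>, W s \<omega>)) \<in> borel_measurable (past t)" by measurable
    then show ?thesis by simp
  qed
  have m: "(\<lambda>\<omega>. H (Z s \<omega>) (W s \<omega>)) \<in> borel_measurable M" for s
    using measurable_past[OF meas[of s "s + 1"]] by simp
  have orth: "expectation (\<lambda>\<omega>. H (Z t \<omega>) (W t \<omega>) * H (Z s \<omega>) (W s \<omega>)) = 0" if "s < t" for s t
    by (rule expectation_innovation_mult_past[OF H W meas[OF that] cent integrable_mult_of_squares[OF m m sq sq]])
  have orth': "expectation (\<lambda>\<omega>. H (Z s \<omega>) (W s \<omega>) * H (Z t \<omega>) (W t \<omega>)) = 0" if "s \<noteq> t" for s t
    using orth[of s t] orth[of t s] that by (cases "s < t") (auto simp: mult.commute)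
  show "integrable M (\<lambda>\<omega>. (\<Sum>t\<in>A. H (Z t \<omega>) (W t \<omega>))\<^sup>2)"
    "expectation (\<lambda>\<omega>. (\<Sum>t\<in>A. H (Z t \<omega>) (W t \<omega>))\<^sup>2) = (\<Sum>t\<in>A. expectation (\<lambda>\<omega>. (H (Z t \<omega>) (W t \<omega>))\<^sup>2))"
    using expectation_square_sum_orthogonal[of A "\<lambda>t \<omega>. H (Z t \<omega>) (W t \<omega>)"] A m sq orth' by auto
qed

end

section \<open>The stationary solution\<close>

lemma abs_le_one_plus_square: "\<bar>x :: real\<bar> \<le> 1 + x\<^sup>2"
  using zero_le_power2[of "\<bar>x\<bar> - 1"] by (simp add: power2_diff)

text \<open>Its expectation measures distance in probability. Being bounded, it can be applied to
  \<open>X\<close> before any moment of \<open>X\<close> is known to exist.\<close>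

definition trunc_abs :: "real \<Rightarrow> real" where "trunc_abs y = min 1 \<bar>y\<bar>"

lemma trunc_abs_bounds: "0 \<le> trunc_abs y" "trunc_abs y \<le> 1" "trunc_abs 0 = 0"
  by (auto simp: trunc_abs_def)

lemma trunc_abs_add: "trunc_abs (x + y) \<le> trunc_abs x + trunc_abs y"
  by (auto simp: trunc_abs_def min_def)

lemma trunc_abs_sum: "trunc_abs (\<Sum>i\<in>A. f i) \<le> (\<Sum>i\<in>A. trunc_abs (f i))"
proof (induction A rule: infinite_finite_induct)
  case (insert x F)
  then show ?case using trunc_abs_add[of "f x" "sum f F"] by simp
qed (auto simp: trunc_abs_bounds)

lemma trunc_abs_measurable [measurable]: "trunc_abs \<in> borel_measurable borel"
  unfolding trunc_abs_def by measurable

lemma trunc_abs_tendsto: "f \<longlonglongrightarrow> l \<Longrightarrow> (\<lambda>n. trunc_abs (f n)) \<longlonglongrightarrow> trunc_abs l"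
  unfolding trunc_abs_def by (intro tendsto_intros)

context iid_space
begin

text \<open>The series converges only almost surely; elsewhere \<open>suminf\<close> has some
  unspecified value. Even so, the definition is measurable for the past itself, without null sets
  being added, which a process that merely agrees with it almost surely need not be.\<close>

definition lin_proc :: "(nat \<Rightarrow> real) \<Rightarrow> int \<Rightarrow> 'a \<Rightarrow> real" where
  "lin_proc \<psi> t \<omega> = (\<Sum>j. \<psi> j * Z (t - int j) \<omega>)"

lemma lin_proc_past: "t < s \<Longrightarrow> lin_proc \<psi> t \<in> borel_measurable (past s)"
  unfolding lin_proc_def by measurable

lemma lin_proc_measurable [measurable]: "lin_proc \<psi> t \<in> borel_measurable M"
  by (rule measurable_past[OF lin_proc_past[of t "t + 1"]]) simp

context
  fixes \<psi> :: "nat \<Rightarrow> real"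
  assumes sq: "integrable P (\<lambda>z. z\<^sup>2)" and summable: "summable (\<lambda>j. \<bar>\<psi> j\<bar>)"
begin

text \<open>The weighted sum of squares serves twice: its finiteness gives almost sure convergence
  of the series, and by Cauchy-Schwarz it dominates the square of the series.\<close>

lemma nn_integral_weighted_squares:
  "(\<integral>\<^sup>+\<omega>. (\<Sum>j. ennreal (\<bar>\<psi> j\<bar> * (Z (t - int j) \<omega>)\<^sup>2)) \<partial>M) = ennreal ((\<Sum>j. \<bar>\<psi> j\<bar>) * (\<integral>z. z\<^sup>2 \<partial>P))"
proof -
  have "(\<integral>\<^sup>+\<omega>. (\<Sum>j. ennreal (\<bar>\<psi> j\<bar> * (Z (t - int j) \<omega>)\<^sup>2)) \<partial>M)
      = (\<Sum>j. \<integral>\<^sup>+\<omega>. ennreal (\<bar>\<psi> j\<bar> * (Z (t - int j) \<omega>)\<^sup>2) \<partial>M)"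
    by (rule nn_integral_suminf) measurable
  also have "\<dots> = (\<Sum>j. ennreal (\<bar>\<psi> j\<bar> * (\<integral>z. z\<^sup>2 \<partial>P)))"
  proof (rule suminf_cong)
    fix j
    have "(\<integral>\<^sup>+\<omega>. ennreal (\<bar>\<psi> j\<bar> * (Z (t - int j) \<omega>)\<^sup>2) \<partial>M) = ennreal (expectation (\<lambda>\<omega>. \<bar>\<psi> j\<bar> * (Z (t - int j) \<omega>)\<^sup>2))"
      by (rule nn_integral_eq_integral) (use sq integrable_Z[of "\<lambda>z. z\<^sup>2"] in auto)
    then show "(\<integral>\<^sup>+\<omega>. ennreal (\<bar>\<psi> j\<bar> * (Z (t - int j) \<omega>)\<^sup>2) \<partial>M) = ennreal (\<bar>\<psi> j\<bar> * (\<integral>z. z\<^sup>2 \<partial>P))"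
      using expectation_Z[of "\<lambda>z. z\<^sup>2"] by simp
  qed
  also have "\<dots> = ennreal (\<Sum>j. \<bar>\<psi> j\<bar> * (\<integral>z. z\<^sup>2 \<partial>P))"
    by (rule suminf_ennreal2) (auto intro: summable_mult2[OF summable])
  also have "(\<Sum>j. \<bar>\<psi> j\<bar> * (\<integral>z. z\<^sup>2 \<partial>P)) = (\<Sum>j. \<bar>\<psi> j\<bar>) * (\<integral>z. z\<^sup>2 \<partial>P)"
    by (rule suminf_mult2[symmetric, OF summable])
  finally show ?thesis .
qed

lemma AE_weighted_squares_summable: "AE \<omega> in M. summable (\<lambda>j. \<bar>\<psi> j\<bar> * (Z (t - int j) \<omega>)\<^sup>2)"
proof -
  have "AE \<omega> in M. (\<Sum>j. ennreal (\<bar>\<psi> j\<bar> * (Z (t - int j) \<omega>)\<^sup>2)) \<noteq> \<infinity>"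
    by (rule nn_integral_PInf_AE) (auto simp: nn_integral_weighted_squares)
  then show ?thesis
    by eventually_elim (rule summable_suminf_not_top, auto)
qed

lemma summable_of_weighted_squares:
  assumes "summable (\<lambda>j. \<bar>\<psi> j\<bar> * (z j)\<^sup>2)"
  shows "summable (\<lambda>j. \<psi> j * z j)"
proof (rule summable_comparison_test'[of _ 0])
  show "summable (\<lambda>j. \<bar>\<psi> j\<bar> + \<bar>\<psi> j\<bar> * (z j)\<^sup>2)" using summable assms by (rule summable_add)
  fix j
  have "\<bar>\<psi> j\<bar> * \<bar>z j\<bar> \<le> \<bar>\<psi> j\<bar> * (1 + (z j)\<^sup>2)" by (intro mult_left_mono abs_le_one_plus_square) auto
  then show "norm (\<psi> j * z j) \<le> \<bar>\<psi> j\<bar> + \<bar>\<psi> j\<bar> * (z j)\<^sup>2" by (simp add: abs_mult algebra_simps)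
qed

lemma lin_proc_sums: "AE \<omega> in M. (\<lambda>j. \<psi> j * Z (t - int j) \<omega>) sums lin_proc \<psi> t \<omega>"
  using AE_weighted_squares_summable[of t]
  by eventually_elim (auto simp: lin_proc_def intro!: summable_sums summable_of_weighted_squares)

text \<open>Cauchy-Schwarz with the weight \<open>\<bar>\<psi> j\<bar>\<close> split into two square
  roots, first for partial sums.\<close>

lemma square_suminf_le:
  assumes z: "summable (\<lambda>j. \<bar>\<psi> j\<bar> * (z j)\<^sup>2)"
  shows "(\<Sum>j. \<psi> j * z j)\<^sup>2 \<le> (\<Sum>j. \<bar>\<psi> j\<bar>) * (\<Sum>j. \<bar>\<psi> j\<bar> * (z j)\<^sup>2)"
proof (rule LIMSEQ_le_const2)
  show "(\<lambda>m. (\<Sum>j<m. \<psi> j * z j)\<^sup>2) \<longlonglongrightarrow> (\<Sum>j. \<psi> j * z j)\<^sup>2"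
    by (intro tendsto_power summable_LIMSEQ summable_of_weighted_squares z)
  have "(\<Sum>j<m. \<psi> j * z j)\<^sup>2 \<le> (\<Sum>j. \<bar>\<psi> j\<bar>) * (\<Sum>j. \<bar>\<psi> j\<bar> * (z j)\<^sup>2)" for m
  proof -
    have "(\<Sum>j<m. \<psi> j * z j) = (\<Sum>j<m. sqrt \<bar>\<psi> j\<bar> * (sgn (\<psi> j) * sqrt \<bar>\<psi> j\<bar> * z j))"
      by (intro sum.cong refl) (simp add: sgn_if)
    then have "(\<Sum>j<m. \<psi> j * z j)\<^sup>2 \<le> (\<Sum>j<m. (sqrt \<bar>\<psi> j\<bar>)\<^sup>2) * (\<Sum>j<m. (sgn (\<psi> j) * sqrt \<bar>\<psi> j\<bar> * z j)\<^sup>2)"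
      using Cauchy_Schwarz_ineq_sum by metis
    also have "\<dots> = (\<Sum>j<m. \<bar>\<psi> j\<bar>) * (\<Sum>j<m. \<bar>\<psi> j\<bar> * (z j)\<^sup>2)"
      by (intro arg_cong2[where f="(*)"] sum.cong refl) (auto simp: power_mult_distrib sgn_if)
    also have "\<dots> \<le> (\<Sum>j. \<bar>\<psi> j\<bar>) * (\<Sum>j. \<bar>\<psi> j\<bar> * (z j)\<^sup>2)"
      by (intro mult_mono sum_le_suminf summable z suminf_nonneg sum_nonneg) auto
    finally show ?thesis .
  qed
  then show "\<exists>N. \<forall>m\<ge>N. (\<Sum>j<m. \<psi> j * z j)\<^sup>2 \<le> (\<Sum>j. \<bar>\<psi> j\<bar>) * (\<Sum>j. \<bar>\<psi> j\<bar> * (z j)\<^sup>2)" by blast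
qed

lemma lin_proc_square:
  shows "integrable M (\<lambda>\<omega>. (lin_proc \<psi> t \<omega>)\<^sup>2)"
    and "expectation (\<lambda>\<omega>. (lin_proc \<psi> t \<omega>)\<^sup>2) \<le> (\<Sum>j. \<bar>\<psi> j\<bar>)\<^sup>2 * (\<integral>z. z\<^sup>2 \<partial>P)"
proof -
  let ?S = "\<Sum>j. \<bar>\<psi> j\<bar>" and ?Q = "\<lambda>\<omega>. \<Sum>j. ennreal (\<bar>\<psi> j\<bar> * (Z (t - int j) \<omega>)\<^sup>2)"
  have S: "0 \<le> ?S" by (intro suminf_nonneg summable) auto
  have "(\<integral>\<^sup>+\<omega>. ennreal ((lin_proc \<psi> t \<omega>)\<^sup>2) \<partial>M)
     \<le> (\<integral>\<^sup>+\<omega>. ennreal ?S * ?Q \<omega> \<partial>M)"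
  proof (rule nn_integral_mono_AE)
    show "AE \<omega> in M. ennreal ((lin_proc \<psi> t \<omega>)\<^sup>2) \<le> ennreal ?S * ?Q \<omega>"
      using AE_weighted_squares_summable[of t]
    proof eventually_elim
      case (elim \<omega>)
      have "ennreal ?S * ?Q \<omega> = ennreal (?S * (\<Sum>j. \<bar>\<psi> j\<bar> * (Z (t - int j) \<omega>)\<^sup>2))"
        using S elim by (subst suminf_ennreal2) (auto simp: ennreal_mult[symmetric] suminf_nonneg)
      then show ?case using square_suminf_le[OF elim] by (simp add: lin_proc_def ennreal_leI)
    qed
  qed
  also have "\<dots> = ennreal ?S * ennreal (?S * (\<integral>z. z\<^sup>2 \<partial>P))"
    by (subst nn_integral_cmult) (auto simp: nn_integral_weighted_squares)
  also have "\<dots> = ennreal (?S\<^sup>2 * (\<integral>z. z\<^sup>2 \<partial>P))"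
    using S by (subst ennreal_mult[symmetric]) (auto simp: power2_eq_square mult.assoc)
  finally have le: "(\<integral>\<^sup>+\<omega>. ennreal ((lin_proc \<psi> t \<omega>)\<^sup>2) \<partial>M) \<le> ennreal (?S\<^sup>2 * (\<integral>z. z\<^sup>2 \<partial>P))" .
  show i: "integrable M (\<lambda>\<omega>. (lin_proc \<psi> t \<omega>)\<^sup>2)"
    by (rule integrableI_nonneg) (use le in \<open>auto intro: le_less_trans\<close>)
  show "expectation (\<lambda>\<omega>. (lin_proc \<psi> t \<omega>)\<^sup>2) \<le> ?S\<^sup>2 * (\<integral>z. z\<^sup>2 \<partial>P)"
    using le nn_integral_eq_integral[OF i] by (simp add: ennreal_le_iff)
qed

end

text \<open>The remainder of the \<open>m\<close>-step expansion of \<open>X t\<close> tends to 0 in probability because its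
  coefficients vanish while the \<open>X s\<close> all have the same distribution.\<close>

lemma stationary_solution_unique:
  assumes sq: "integrable P (\<lambda>z. z\<^sup>2)" and p: "p \<ge> 1" and causal: "ar_causal p \<phi>"
    and [measurable]: "\<And>t. X t \<in> borel_measurable M" and stat: "\<And>s. distr M borel (X s) = distr M borel (X 0)"
    and ar: "AE \<omega> in M. \<forall>t. X t \<omega> = regress p \<phi> (\<lambda>s. X s \<omega>) t + Z t \<omega>"
  shows "AE \<omega> in M. \<forall>t. X t \<omega> = lin_proc (ma_coeff p \<phi>) t \<omega>"
  unfolding AE_all_countable
proof
  fix t
  let ?\<psi> = "ma_coeff p \<phi>" and ?d = "ar_rem p \<phi>"
  let ?X = "lin_proc ?\<psi> t"
  define S where "S m \<omega> = (\<Sum>j<m. ?\<psi> j * Z (t - int j) \<omega>)" for m \<omega>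
  have [measurable]: "S m \<in> borel_measurable M" for m unfolding S_def by measurable
  have int: "integrable M (\<lambda>\<omega>. trunc_abs (f \<omega>))" if [measurable]: "f \<in> borel_measurable M" for f
    by (rule integrable_const_bound[of _ 1]) (auto simp: trunc_abs_bounds)
  \<comment> \<open>Stationarity enters here: the estimate of the remainder must not depend on the
    time \<open>t - m - l\<close>, which recedes as \<open>m\<close> grows.\<close>
  have shift: "expectation (\<lambda>\<omega>. trunc_abs (c * X s \<omega>)) = expectation (\<lambda>\<omega>. trunc_abs (c * X 0 \<omega>))" for c s
  proof -
    have "expectation (\<lambda>\<omega>. trunc_abs (c * X s \<omega>)) = (\<integral>x. trunc_abs (c * x) \<partial>distr M borel (X s))" for s
      by (subst integral_distr) auto
    then show ?thesis by (simp add: stat[of s])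
  qed
  let ?A = "\<lambda>m. expectation (\<lambda>\<omega>. trunc_abs (S m \<omega> - ?X \<omega>))" and ?R = "\<lambda>m. \<Sum>l<p. expectation (\<lambda>\<omega>. trunc_abs (?d m l * X 0 \<omega>))"
  \<comment> \<open>The distance splits into the tail of the series and the remainder of the
    expansion. The left side does not involve \<open>m\<close>, so it is 0 once both parts are shown
    to vanish in the limit.\<close>
  have bound: "expectation (\<lambda>\<omega>. trunc_abs (X t \<omega> - ?X \<omega>))
     \<le> ?A m + ?R m" for m
  proof -
    have "expectation (\<lambda>\<omega>. trunc_abs (X t \<omega> - ?X \<omega>))
      \<le> expectation (\<lambda>\<omega>. trunc_abs (S m \<omega> - ?X \<omega>) + (\<Sum>l<p. trunc_abs (?d m l * X (t - int m - int l) \<omega>)))"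
    proof (rule integral_mono_AE)
      show "AE \<omega> in M. trunc_abs (X t \<omega> - ?X \<omega>) \<le> trunc_abs (S m \<omega> - ?X \<omega>) + (\<Sum>l<p. trunc_abs (?d m l * X (t - int m - int l) \<omega>))"
        using ar
      proof eventually_elim
        case (elim \<omega>)
        have "X t \<omega> = S m \<omega> + (\<Sum>l<p. ?d m l * X (t - int m - int l) \<omega>)"
          using elim unfolding S_def regress_def
          by (intro ar_expansion[OF p, of "\<lambda>s. X s \<omega>" \<phi> "\<lambda>s. Z s \<omega>"]) (rule spec)
        then have "X t \<omega> - ?X \<omega> = (S m \<omega> - ?X \<omega>) + (\<Sum>l<p. ?d m l * X (t - int m - int l) \<omega>)" by simp
        then have "trunc_abs (X t \<omega> - ?X \<omega>) \<le> trunc_abs (S m \<omega> - ?X \<omega>) + trunc_abs (\<Sum>l<p. ?d m l * X (t - int m - int l) \<omega>)"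
          by (simp only: trunc_abs_add)
        then show ?case using trunc_abs_sum[of "\<lambda>l. ?d m l * X (t - int m - int l) \<omega>" "{..<p}"] by linarith
      qed
    qed (intro Bochner_Integration.integrable_add Bochner_Integration.integrable_sum int; measurable)+
    also have "\<dots> = ?A m + (\<Sum>l<p. expectation (\<lambda>\<omega>. trunc_abs (?d m l * X (t - int m - int l) \<omega>)))"
    proof -
      have "integrable M (\<lambda>\<omega>. trunc_abs (S m \<omega> - ?X \<omega>))" by (rule int) measurable
      moreover have i2: "integrable M (\<lambda>\<omega>. trunc_abs (?d m l * X (t - int m - int l) \<omega>))" for l by (rule int) measurable
      ultimately show ?thesis
        by (subst Bochner_Integration.integral_add) (auto intro!: Bochner_Integration.integrable_sum Bochner_Integration.integral_sum)
    qed
    also have "(\<Sum>l<p. expectation (\<lambda>\<omega>. trunc_abs (?d m l * X (t - int m - int l) \<omega>))) = ?R m"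
      by (intro sum.cong refl shift)
    finally show ?thesis .
  qed
  have "(\<lambda>m. ?A m) \<longlonglongrightarrow> expectation (\<lambda>\<omega>. 0)"
  proof (rule integral_dominated_convergence[where w="\<lambda>_. 1"])
    show "AE \<omega> in M. (\<lambda>m. trunc_abs (S m \<omega> - ?X \<omega>)) \<longlonglongrightarrow> 0"
      using lin_proc_sums[OF sq ma_coeff_summable(1)[OF causal], of t]
    proof eventually_elim
      case (elim \<omega>)
      then have "(\<lambda>m. S m \<omega> - ?X \<omega>) \<longlonglongrightarrow> ?X \<omega> - ?X \<omega>"
        unfolding S_def sums_def by (intro tendsto_diff) auto
      from trunc_abs_tendsto[OF this] show ?case by (simp add: trunc_abs_bounds)
    qed
  qed (auto simp: trunc_abs_bounds)
  moreover have "(\<lambda>m. expectation (\<lambda>\<omega>. trunc_abs (?d m l * X 0 \<omega>))) \<longlonglongrightarrow> expectation (\<lambda>\<omega>. 0)" for l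
  proof (rule integral_dominated_convergence[where w="\<lambda>_. 1"])
    show "AE \<omega> in M. (\<lambda>m. trunc_abs (?d m l * X 0 \<omega>)) \<longlonglongrightarrow> 0"
    proof (rule AE_I2)
      fix \<omega>
      have "(\<lambda>m. ?d m l * X 0 \<omega>) \<longlonglongrightarrow> 0 * X 0 \<omega>" by (intro tendsto_intros ar_rem_tendsto_0 causal p)
      from trunc_abs_tendsto[OF this] show "(\<lambda>m. trunc_abs (?d m l * X 0 \<omega>)) \<longlonglongrightarrow> 0"
        by (simp add: trunc_abs_bounds)
    qed
  qed (auto simp: trunc_abs_bounds)
  ultimately have "(\<lambda>m. ?A m + ?R m)
     \<longlonglongrightarrow> 0 + (\<Sum>l<p. 0)"
    by (intro tendsto_add tendsto_sum) auto
  then have "expectation (\<lambda>\<omega>. trunc_abs (X t \<omega> - ?X \<omega>)) \<le> 0"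
    by (intro LIMSEQ_le_const[where X="\<lambda>m. ?A m + ?R m"])
       (use bound in auto)
  moreover have "0 \<le> expectation (\<lambda>\<omega>. trunc_abs (X t \<omega> - ?X \<omega>))"
    by (intro Bochner_Integration.integral_nonneg) (simp add: trunc_abs_bounds)
  ultimately have "AE \<omega> in M. trunc_abs (X t \<omega> - ?X \<omega>) = 0"
    using integral_nonneg_eq_0_iff_AE[OF int[of "\<lambda>\<omega>. X t \<omega> - ?X \<omega>"]] by (auto simp: trunc_abs_bounds)
  then show "AE \<omega> in M. X t \<omega> = ?X \<omega>"
    by eventually_elim (auto simp: trunc_abs_def min_def split: if_splits)
qed

end

section \<open>Rate of the Yule-Walker estimator\<close>

lemma inverse_sqrt_tendsto_0: "(\<lambda>n. a / sqrt (real n)) \<longlonglongrightarrow> 0"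
  by (intro tendsto_divide_0[OF tendsto_const] filterlim_at_top_imp_at_infinity
      filterlim_compose[OF sqrt_at_top filterlim_real_sequentially])

definition edges :: "nat \<Rightarrow> nat \<Rightarrow> int set" where
  "edges p n = {1 - int p..0} \<union> {int n + 1 - int p..int n}"

lemma finite_edges [simp]: "finite (edges p n)"
  by (simp add: edges_def)

lemma card_edges: "real (card (edges p n)) \<le> 2 * real p"
proof -
  have "card (edges p n) \<le> 2 * p"
    unfolding edges_def by (rule order_trans[OF card_Un_le]) simp
  then have "real (card (edges p n)) \<le> real (2 * p)" by (simp only: of_nat_le_iff)
  then show ?thesis by simp
qed

text \<open>Summing the recursion over time gives an equation for the sum of the observations,
  because the lagged sums differ from it only at the edges. After division by the nonzero factor
  \<open>1 - (\<Sum>i=1..p. \<phi> i)\<close>, the law of large numbers for the observations reduces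
  to the one for the innovations.\<close>

lemma lagged_sum_bound:
  assumes x: "\<And>s. x s = regress p \<phi> x s + z s" and phi: "(\<Sum>i=1..p. \<phi> i) \<noteq> 1"
    and D: "(\<Sum>a\<in>edges p n. \<bar>x a\<bar>) \<le> D" and i: "i \<le> p"
  shows "\<bar>\<Sum>t=1..int n. x (t - int i)\<bar>
    \<le> 2 * D + (norm1 p \<phi> * (2 * D) + \<bar>\<Sum>t=1..int n. z t\<bar>) / \<bar>1 - (\<Sum>i=1..p. \<phi> i)\<bar>"
proof -
  define S where "S i = (\<Sum>t=1..int n. x (t - int i))" for i :: nat
  have diff: "\<bar>S i - S 0\<bar> \<le> 2 * D" if "i \<le> p" for i
  proof -
    \<comment> \<open>The time windows of the lagged and of the unlagged sum; what lies in only one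
      of them belongs to \<open>edges p n\<close>.\<close>
    let ?A = "{1 - int i..int n - int i}" and ?B = "{1..int n}"
    have "S i = (\<Sum>t\<in>?A. x t)" unfolding S_def
      by (rule sum.reindex_bij_witness[of _ "\<lambda>t. t + int i" "\<lambda>t. t - int i"]) auto
    also have "\<dots> = (\<Sum>t\<in>?A \<inter> ?B. x t) + (\<Sum>t\<in>?A - ?B. x t)" by (rule sum.Int_Diff) simp
    finally have 1: "S i = (\<Sum>t\<in>?A \<inter> ?B. x t) + (\<Sum>t\<in>?A - ?B. x t)" .
    have 2: "S 0 = (\<Sum>t\<in>?A \<inter> ?B. x t) + (\<Sum>t\<in>?B - ?A. x t)"
      unfolding S_def using sum.Int_Diff[of ?B x ?A] by (simp add: Int_commute)
    have "\<bar>\<Sum>t\<in>C. x t\<bar> \<le> D" if "C \<subseteq> edges p n" for C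
      using sum_abs[of x C] sum_mono2[OF finite_edges that, of "\<lambda>a. \<bar>x a\<bar>"] D
      by (meson abs_ge_zero order_trans)
    moreover have "?A - ?B \<subseteq> edges p n" "?B - ?A \<subseteq> edges p n" using that by (auto simp: edges_def)
    ultimately have "\<bar>\<Sum>t\<in>?A - ?B. x t\<bar> \<le> D" "\<bar>\<Sum>t\<in>?B - ?A. x t\<bar> \<le> D" by blast+
    then show ?thesis using 1 2 by linarith
  qed
  have "S 0 = (\<Sum>t=1..int n. regress p \<phi> x t + z t)"
    unfolding S_def using x by (intro sum.cong) auto
  also have "\<dots> = (\<Sum>i=1..p. \<phi> i * S i) + (\<Sum>t=1..int n. z t)"
    unfolding sum.distrib regress_def S_def sum_distrib_left by (subst sum.swap) simp
  also have "(\<Sum>i=1..p. \<phi> i * S i) = (\<Sum>i=1..p. \<phi> i * (S i - S 0)) + (\<Sum>i=1..p. \<phi> i) * S 0"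
    by (simp add: right_diff_distrib sum_subtractf sum_distrib_right)
  finally have "(1 - (\<Sum>i=1..p. \<phi> i)) * S 0 = (\<Sum>i=1..p. \<phi> i * (S i - S 0)) + (\<Sum>t=1..int n. z t)"
    by (simp add: algebra_simps)
  moreover have "\<bar>\<Sum>i=1..p. \<phi> i * (S i - S 0)\<bar> \<le> norm1 p \<phi> * (2 * D)"
    by (rule abs_sum_le_norm1) (use diff in auto)
  ultimately have "\<bar>1 - (\<Sum>i=1..p. \<phi> i)\<bar> * \<bar>S 0\<bar> \<le> norm1 p \<phi> * (2 * D) + \<bar>\<Sum>t=1..int n. z t\<bar>"
    unfolding abs_mult[symmetric] by linarith
  then have "\<bar>S 0\<bar> \<le> (norm1 p \<phi> * (2 * D) + \<bar>\<Sum>t=1..int n. z t\<bar>) / \<bar>1 - (\<Sum>i=1..p. \<phi> i)\<bar>"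
    using phi by (simp add: pos_le_divide_eq mult.commute)
  then show ?thesis using diff[OF i] unfolding S_def[symmetric] by linarith
qed

text \<open>\<open>X\<close> stands for a version of the process that is truly adapted to the
  innovations. The truncated second moment \<open>\<mu>\<close> serves to bound the sum of squared
  innovations from below by a sum of bounded variables.\<close>

locale ar_space = iid_space M Z P for M :: "'a measure" and Z P +
  fixes X :: "int \<Rightarrow> 'a \<Rightarrow> real" and p :: nat and \<phi> :: "nat \<Rightarrow> real" and c \<mu> :: real
  assumes p: "p \<ge> 1"
    and X_past: "\<And>t. X t \<in> borel_measurable (past (t + 1))"
    and X_sq: "\<And>t. integrable M (\<lambda>\<omega>. (X t \<omega>)\<^sup>2)"
    and X_le: "\<And>t. expectation (\<lambda>\<omega>. (X t \<omega>)\<^sup>2) \<le> c"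
    and ar: "AE \<omega> in M. \<forall>t. X t \<omega> = regress p \<phi> (\<lambda>s. X s \<omega>) t + Z t \<omega>"
    and phi_sum: "(\<Sum>i=1..p. \<phi> i) \<noteq> 1"
    and P_sq: "integrable P (\<lambda>z. z\<^sup>2)" and P_mean: "(\<integral>z. z \<partial>P) = 0"
    and \<mu>: "\<mu> > 0" "(\<integral>z. min (z\<^sup>2) 1 \<partial>P) = \<mu>"
begin

definition v2 :: real where "v2 = (\<integral>z. z\<^sup>2 \<partial>P)"

lemma v2_nonneg: "0 \<le> v2"
  unfolding v2_def by (intro Bochner_Integration.integral_nonneg) auto

lemma c_nonneg: "0 \<le> c"
  using order_trans[OF _ X_le[of 0]] by (auto intro: Bochner_Integration.integral_nonneg)

lemma X_measurable [measurable]: "X t \<in> borel_measurable M"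
  by (rule measurable_past[OF X_past])

lemma X_lag_past: "s < t \<Longrightarrow> X s \<in> borel_measurable (past t)"
  by (rule measurable_past_mono[OF X_past]) simp

lemma Z_X_square:
  assumes "s < t"
  shows "integrable M (\<lambda>\<omega>. (Z t \<omega> * X s \<omega>)\<^sup>2)" and "expectation (\<lambda>\<omega>. (Z t \<omega> * X s \<omega>)\<^sup>2) \<le> v2 * c"
proof -
  have "(\<lambda>\<omega>. (X s \<omega>)\<^sup>2) \<in> borel_measurable (past t)"
    using X_lag_past[OF assms] by measurable
  then have ind: "indep_var borel (\<lambda>\<omega>. (Z t \<omega>)\<^sup>2) borel (\<lambda>\<omega>. (X s \<omega>)\<^sup>2)"
    by (rule indep_past) measurable
  have iZ: "integrable M (\<lambda>\<omega>. (Z t \<omega>)\<^sup>2)" and eZ: "expectation (\<lambda>\<omega>. (Z t \<omega>)\<^sup>2) = v2"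
    using integrable_Z[of "\<lambda>z. z\<^sup>2" t] expectation_Z[of "\<lambda>z. z\<^sup>2" t] P_sq by (auto simp: v2_def)
  show "integrable M (\<lambda>\<omega>. (Z t \<omega> * X s \<omega>)\<^sup>2)"
    using indep_var_integrable[OF ind iZ X_sq] by (simp add: power_mult_distrib)
  show "expectation (\<lambda>\<omega>. (Z t \<omega> * X s \<omega>)\<^sup>2) \<le> v2 * c"
    using indep_var_lebesgue_integral[OF ind iZ X_sq] eZ X_le[of s] v2_nonneg
    by (simp add: power_mult_distrib mult_left_mono)
qed

lemma cross_sum_square:
  assumes "finite A" "i \<ge> 1"
  shows "integrable M (\<lambda>\<omega>. (\<Sum>t\<in>A. Z t \<omega> * X (t - int i) \<omega>)\<^sup>2)"
    and "expectation (\<lambda>\<omega>. (\<Sum>t\<in>A. Z t \<omega> * X (t - int i) \<omega>)\<^sup>2) \<le> real (card A) * (v2 * c)"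
proof -
  have H: "(\<lambda>(z, w). z * w :: real) \<in> borel_measurable (borel \<Otimes>\<^sub>M borel)" by measurable
  have W: "X (t - int i) \<in> borel_measurable (past t)" for t using assms by (intro X_lag_past) auto
  have cent: "(\<integral>z. z * w \<partial>P) = 0" for w by (simp add: P_mean)
  have sq: "integrable M (\<lambda>\<omega>. (Z t \<omega> * X (t - int i) \<omega>)\<^sup>2)" for t using assms by (intro Z_X_square) auto
  note * = expectation_square_sum_innovations[OF H W cent sq assms(1)]
  show "integrable M (\<lambda>\<omega>. (\<Sum>t\<in>A. Z t \<omega> * X (t - int i) \<omega>)\<^sup>2)" by (rule *(1))
  show "expectation (\<lambda>\<omega>. (\<Sum>t\<in>A. Z t \<omega> * X (t - int i) \<omega>)\<^sup>2) \<le> real (card A) * (v2 * c)"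
    unfolding *(2) using assms by (intro sum_bounded_above Z_X_square) auto
qed

lemma whp_sum_of_square:
  assumes int: "\<And>n. integrable M (\<lambda>\<omega>. (S n \<omega>)\<^sup>2)" and le: "\<And>n. expectation (\<lambda>\<omega>. (S n \<omega>)\<^sup>2) \<le> real n * b"
    and "e > 0" "\<tau> > 0"
  shows "whp \<tau> (\<lambda>n \<omega>. \<bar>S n \<omega>\<bar> \<le> e * real n)"
proof -
  have "whp \<tau> (\<lambda>n \<omega>. (S n \<omega>)\<^sup>2 / (real n)\<^sup>2 \<le> e\<^sup>2)"
  proof (rule whp_vanish[where b="\<lambda>n. b / real n"])
    fix n :: nat assume n: "n \<ge> 1"
    have "expectation (\<lambda>\<omega>. (S n \<omega>)\<^sup>2) / (real n)\<^sup>2 \<le> real n * b / (real n)\<^sup>2"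
      using le by (intro divide_right_mono) auto
    then show "expectation (\<lambda>\<omega>. (S n \<omega>)\<^sup>2 / (real n)\<^sup>2) \<le> b / real n"
      using n by (simp add: power2_eq_square field_simps)
  qed (use assms in \<open>auto intro: lim_const_over_n\<close>)
  then show ?thesis
  proof (rule whp_mono, intro eventually_sequentiallyI[of 1] AE_I2 impI)
    fix n \<omega> assume n: "n \<ge> (1::nat)" and "(S n \<omega>)\<^sup>2 / (real n)\<^sup>2 \<le> e\<^sup>2"
    then have "(S n \<omega>)\<^sup>2 \<le> (e * real n)\<^sup>2" by (simp add: field_simps power_mult_distrib)
    then show "\<bar>S n \<omega>\<bar> \<le> e * real n" using assms by (simp add: abs_le_square_iff[symmetric])
  qed
qed

lemma whp_cross_vanish:
  assumes i: "i \<ge> 1" and "e > 0" "\<tau> > 0"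
  shows "whp \<tau> (\<lambda>n \<omega>. \<bar>\<Sum>t=1..int n - 1. Z t \<omega> * X (t - int i) \<omega>\<bar> \<le> e * real n)"
proof (rule whp_sum_of_square[where b="v2 * c"])
  fix n
  have "expectation (\<lambda>\<omega>. (\<Sum>t=1..int n - 1. Z t \<omega> * X (t - int i) \<omega>)\<^sup>2) \<le> real (card {1..int n - 1}) * (v2 * c)"
    by (rule cross_sum_square(2)[OF _ i]) simp
  also have "\<dots> \<le> real n * (v2 * c)"
    using v2_nonneg c_nonneg by (intro mult_right_mono) auto
  finally show "expectation (\<lambda>\<omega>. (\<Sum>t=1..int n - 1. Z t \<omega> * X (t - int i) \<omega>)\<^sup>2) \<le> real n * (v2 * c)" .
qed (use assms cross_sum_square(1) in auto)

lemma whp_cross_tight: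
  assumes i: "i \<ge> 1" and "\<tau> > 0"
  shows "\<exists>C. whp \<tau> (\<lambda>n \<omega>. (\<Sum>t=1..int n. Z t \<omega> * X (t - int i) \<omega>)\<^sup>2 / real n \<le> C)"
proof (rule whp_tight)
  fix n :: nat assume n: "n \<ge> 1"
  let ?S = "\<lambda>\<omega>. \<Sum>t=1..int n. Z t \<omega> * X (t - int i) \<omega>"
  show "integrable M (\<lambda>\<omega>. (?S \<omega>)\<^sup>2 / real n)" using cross_sum_square(1)[OF _ i] by simp
  have "expectation (\<lambda>\<omega>. (?S \<omega>)\<^sup>2) \<le> real (card {1..int n}) * (v2 * c)"
    by (rule cross_sum_square(2)[OF _ i]) simp
  then show "expectation (\<lambda>\<omega>. (?S \<omega>)\<^sup>2 / real n) \<le> v2 * c"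
    using n by (simp add: field_simps)
qed (use assms in auto)

lemma whp_last_vanish:
  assumes "e > 0" "\<tau> > 0"
  shows "whp \<tau> (\<lambda>n \<omega>. (X (int n - int i) \<omega>)\<^sup>2 \<le> e * real n)"
proof -
  have "whp \<tau> (\<lambda>n \<omega>. (X (int n - int i) \<omega>)\<^sup>2 / real n \<le> e)"
  proof (rule whp_vanish[where b="\<lambda>n. c / real n"])
    fix n :: nat assume n: "n \<ge> 1"
    show "expectation (\<lambda>\<omega>. (X (int n - int i) \<omega>)\<^sup>2 / real n) \<le> c / real n"
      using X_le[of "int n - int i"] n by (simp add: divide_right_mono)
  qed (use assms X_sq in \<open>auto intro: lim_const_over_n\<close>)
  then show ?thesis
    by (rule whp_mono) (auto intro!: eventually_sequentiallyI[of 1] simp: field_simps)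
qed

text \<open>The squares are replaced by the smaller variables \<open>min (z\<^sup>2) 1\<close>,
  whose centred sum has variance at most \<open>n\<close>. Of the mean
  \<open>(n - 1) * \<mu>\<close>, at least \<open>n * \<mu> / 2\<close> from \<open>n = 2\<close>
  on, half is given up to the fluctuation.\<close>

lemma whp_innovation_energy:
  assumes "\<tau> > 0"
  shows "whp \<tau> (\<lambda>n \<omega>. \<mu> / 4 * real n \<le> (\<Sum>t=1..int n - 1. (Z t \<omega>)\<^sup>2))"
proof -
  \<comment> \<open>The second argument is a dummy that fits the lemma on innovation sums.\<close>
  define H :: "real \<Rightarrow> real \<Rightarrow> real" where "H z w = min (z\<^sup>2) 1 - \<mu>" for z w
  let ?S = "\<lambda>n \<omega>. \<Sum>t=1..int n - 1. H (Z t \<omega>) 0"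
  have Hm: "case_prod H \<in> borel_measurable (borel \<Otimes>\<^sub>M borel)" unfolding H_def by measurable
  have im: "integrable P (\<lambda>z. min (z\<^sup>2) 1)" by (rule P.integrable_const_bound[of _ 1]) auto
  have cent: "(\<integral>z. H z w \<partial>P) = 0" for w
    unfolding H_def using im P.prob_space by (simp add: \<mu>(2))
  have \<mu>1: "\<mu> \<le> 1"
  proof -
    have "\<mu> \<le> (\<integral>z. 1 \<partial>P)" unfolding \<mu>(2)[symmetric] by (intro integral_mono im) auto
    then show ?thesis using P.prob_space by simp
  qed
  have Hb: "(H z w)\<^sup>2 \<le> 1" for z w
  proof -
    have "0 \<le> min (z\<^sup>2) 1" "min (z\<^sup>2) 1 \<le> 1" by auto
    then have "\<bar>H z w\<bar> \<le> 1" using \<mu>(1) \<mu>1 unfolding H_def by linarith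
    then show ?thesis by (simp add: abs_square_le_1)
  qed
  have Hsq: "integrable M (\<lambda>\<omega>. (H (Z t \<omega>) 0)\<^sup>2)" for t
    by (rule integrable_const_bound[of _ 1]) (auto simp: Hb, simp add: H_def)
  note * = expectation_square_sum_innovations[OF Hm, of "\<lambda>_ _. 0", OF _ cent Hsq, simplified]
  have "whp \<tau> (\<lambda>n \<omega>. \<bar>?S n \<omega>\<bar> \<le> \<mu> / 4 * real n)"
  proof (rule whp_sum_of_square[where b=1])
    fix n
    have "expectation (\<lambda>\<omega>. (?S n \<omega>)\<^sup>2) = (\<Sum>t=1..int n - 1. expectation (\<lambda>\<omega>. (H (Z t \<omega>) 0)\<^sup>2))"
      by (rule *(2)) simp
    also have "\<dots> \<le> (\<Sum>t=1..int n - 1. expectation (\<lambda>\<omega>. 1))"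
      by (intro sum_mono integral_mono Hsq) (auto simp: Hb)
    also have "\<dots> \<le> real n" by (simp add: prob_space)
    finally show "expectation (\<lambda>\<omega>. (?S n \<omega>)\<^sup>2) \<le> real n * 1" by simp
  qed (use assms \<mu> *(1) in auto)
  then show ?thesis
  proof (rule whp_mono, intro eventually_sequentiallyI[of 2] AE_I2 impI)
    fix n \<omega> assume n: "n \<ge> (2::nat)" and "\<bar>?S n \<omega>\<bar> \<le> \<mu> / 4 * real n"
    then have "- (\<mu> / 4 * real n) \<le> ?S n \<omega>" by linarith
    moreover have "?S n \<omega> = (\<Sum>t=1..int n - 1. min ((Z t \<omega>)\<^sup>2) 1) - (real n - 1) * \<mu>"
      using n by (simp add: H_def sum_subtractf of_nat_diff)
    moreover have "(\<Sum>t=1..int n - 1. min ((Z t \<omega>)\<^sup>2) 1) \<le> (\<Sum>t=1..int n - 1. (Z t \<omega>)\<^sup>2)"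
      by (intro sum_mono) auto
    moreover have "2 * (\<mu> / 4 * real n) \<le> (real n - 1) * \<mu>"
      using n \<mu>(1) mult_right_mono[of "real n / 2" "real n - 1" \<mu>] by (simp add: mult.commute)
    ultimately show "\<mu> / 4 * real n \<le> (\<Sum>t=1..int n - 1. (Z t \<omega>)\<^sup>2)" by linarith
  qed
qed

text \<open>There are at most \<open>2 * p\<close> summands with bounded means, so any bound tending
  to infinity would hold; \<open>sqrt n\<close> is the order that the edge terms may have in
  \<open>yule_walker_error\<close>.\<close>

lemma whp_edges_vanish:
  assumes "\<tau> > 0"
  shows "whp \<tau> (\<lambda>n \<omega>. (\<Sum>a\<in>edges p n. (X a \<omega>)\<^sup>2) \<le> sqrt (real n))"
proof -
  have "whp \<tau> (\<lambda>n \<omega>. (\<Sum>a\<in>edges p n. (X a \<omega>)\<^sup>2) / sqrt (real n) \<le> 1)"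
  proof (rule whp_vanish[where b="\<lambda>n. 2 * real p * c / sqrt (real n)"])
    fix n :: nat assume n: "n \<ge> 1"
    have "expectation (\<lambda>\<omega>. \<Sum>a\<in>edges p n. (X a \<omega>)\<^sup>2) = (\<Sum>a\<in>edges p n. expectation (\<lambda>\<omega>. (X a \<omega>)\<^sup>2))"
      by (intro Bochner_Integration.integral_sum X_sq)
    also have "\<dots> \<le> real (card (edges p n)) * c" by (intro sum_bounded_above X_le)
    also have "\<dots> \<le> 2 * real p * c"
      by (rule mult_right_mono[OF card_edges c_nonneg])
    finally show "expectation (\<lambda>\<omega>. (\<Sum>a\<in>edges p n. (X a \<omega>)\<^sup>2) / sqrt (real n)) \<le> 2 * real p * c / sqrt (real n)"
      by (simp add: divide_right_mono)
    show "integrable M (\<lambda>\<omega>. (\<Sum>a\<in>edges p n. (X a \<omega>)\<^sup>2) / sqrt (real n))"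
      using X_sq by (intro integrable_divide Bochner_Integration.integrable_sum) auto
  next
    show "(\<lambda>n. 2 * real p * c / sqrt (real n)) \<longlonglongrightarrow> 0" by (rule inverse_sqrt_tendsto_0)
  qed (use assms in \<open>auto intro!: sum_nonneg divide_nonneg_nonneg\<close>)
  then show ?thesis
    by (rule whp_mono) (auto intro!: eventually_sequentiallyI[of 1] simp: field_simps)
qed

lemma whp_regressors_tight:
  assumes "\<tau> > 0"
  shows "\<exists>C. whp \<tau> (\<lambda>n \<omega>. (\<Sum>t=1..int n. \<Sum>i=1..p. (X (t - int i) \<omega>)\<^sup>2) / real n \<le> C)"
proof (rule whp_tight)
  fix n :: nat assume n: "n \<ge> 1"
  let ?S = "\<lambda>\<omega>. \<Sum>t=1..int n. \<Sum>i=1..p. (X (t - int i) \<omega>)\<^sup>2"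
  show "integrable M (\<lambda>\<omega>. ?S \<omega> / real n)"
    using X_sq by (intro integrable_divide Bochner_Integration.integrable_sum) auto
  have "expectation ?S = (\<Sum>t=1..int n. \<Sum>i=1..p. expectation (\<lambda>\<omega>. (X (t - int i) \<omega>)\<^sup>2))"
    using X_sq by (simp add: Bochner_Integration.integral_sum Bochner_Integration.integrable_sum)
  also have "\<dots> \<le> (\<Sum>t=1..int n. \<Sum>i=1..p. c)" by (intro sum_mono X_le)
  finally have "expectation ?S \<le> real n * (real p * c)" by simp
  then show "expectation (\<lambda>\<omega>. ?S \<omega> / real n) \<le> real p * c" using n by (simp add: field_simps)
qed (use assms in \<open>auto intro!: divide_nonneg_nonneg sum_nonneg\<close>)

lemma whp_innovation_mean:
  assumes "e > 0" "\<tau> > 0"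
  shows "whp \<tau> (\<lambda>n \<omega>. \<bar>\<Sum>t=1..int n. Z t \<omega>\<bar> \<le> e * real n)"
proof -
  have Hm: "(\<lambda>(z, w). z) \<in> borel_measurable (borel \<Otimes>\<^sub>M borel :: (real \<times> real) measure)" by measurable
  have Zsq: "integrable M (\<lambda>\<omega>. (Z t \<omega>)\<^sup>2)" for t
    using integrable_Z[of "\<lambda>z. z\<^sup>2" t] P_sq by simp
  note * = expectation_square_sum_innovations[OF Hm, of "\<lambda>_ _. 0", OF _ P_mean Zsq, simplified]
  show ?thesis
  proof (rule whp_sum_of_square[where b=v2])
    show "expectation (\<lambda>\<omega>. (\<Sum>t=1..int n. Z t \<omega>)\<^sup>2) \<le> real n * v2" for n
      using expectation_Z[of "\<lambda>z. z\<^sup>2"] by (simp add: *(2) v2_def)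
  qed (use assms *(1) in auto)
qed

lemma whp_lagged_mean:
  assumes e: "e > 0" and \<tau>: "\<tau> > 0"
  shows "whp \<tau> (\<lambda>n \<omega>. \<forall>i\<in>{1..p}. \<bar>\<Sum>t=1..int n. X (t - int i) \<omega>\<bar> \<le> e * real n)"
proof -
  let ?q = "\<bar>1 - (\<Sum>i=1..p. \<phi> i)\<bar>"
  \<comment> \<open>The constant of \<open>lagged_sum_bound\<close> when the edge sum and the
    innovation sum are both at most \<open>e' * n\<close>; hence \<open>e' = e / K\<close>.\<close>
  define K where "K = 2 + (norm1 p \<phi> * 2 + 1) / ?q"
  have q: "?q > 0" using phi_sum by simp
  have K: "K > 0" unfolding K_def using q norm1_nonneg[of p \<phi>] by (intro add_pos_nonneg) auto
  define e' where "e' = e / K"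
  have e': "e' > 0" using e K by (simp add: e'_def)
  \<comment> \<open>By \<open>abs_le_one_plus_square\<close> the edge sum of absolute values is at
    most \<open>2 * p + sqrt n\<close>, which is eventually below \<open>e' * n\<close>.\<close>
  have "(\<lambda>n. (2 * real p) / real n + 1 / sqrt (real n)) \<longlonglongrightarrow> 0 + 0"
    by (intro tendsto_add lim_const_over_n inverse_sqrt_tendsto_0)
  then have ev: "\<forall>\<^sub>F n in sequentially. (2 * real p) / real n + 1 / sqrt (real n) < e'"
    using e' by (auto dest: order_tendstoD)
  let ?good = "\<lambda>n \<omega>. (\<Sum>a\<in>edges p n. (X a \<omega>)\<^sup>2) \<le> sqrt (real n) \<and> \<bar>\<Sum>t=1..int n. Z t \<omega>\<bar> \<le> e' * real n"
  have "whp (\<tau> / 2 + \<tau> / 2) (\<lambda>n \<omega>. ?good n \<omega>)"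
    using \<tau> e' by (intro whp_conj whp_edges_vanish whp_innovation_mean) auto
  then have "whp \<tau> (\<lambda>n \<omega>. ?good n \<omega>)"
    by simp
  then show ?thesis
  proof (rule whp_mono)
    show "\<forall>\<^sub>F n in sequentially. AE \<omega> in M. ?good n \<omega> \<longrightarrow> (\<forall>i\<in>{1..p}. \<bar>\<Sum>t=1..int n. X (t - int i) \<omega>\<bar> \<le> e * real n)"
      using ev eventually_ge_at_top[of 1]
    proof eventually_elim
      case (elim n)
      then have "((2 * real p) / real n + 1 / sqrt (real n)) * real n \<le> e' * real n"
        by (intro mult_right_mono) auto
      moreover have "((2 * real p) / real n + 1 / sqrt (real n)) * real n = 2 * real p + sqrt (real n)"
        using elim by (simp add: distrib_right real_div_sqrt)
      ultimately have small: "2 * real p + sqrt (real n) \<le> e' * real n" by simp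
      show ?case using ar
      proof eventually_elim
        case (elim \<omega>)
        show ?case
        proof (intro impI ballI)
          fix i assume h: "?good n \<omega>"
            and i: "i \<in> {1..p}"
          have "(\<Sum>a\<in>edges p n. \<bar>X a \<omega>\<bar>) \<le> (\<Sum>a\<in>edges p n. 1 + (X a \<omega>)\<^sup>2)"
            by (intro sum_mono abs_le_one_plus_square)
          also have "\<dots> \<le> 2 * real p + sqrt (real n)"
            using h card_edges[of p n] by (simp add: sum.distrib)
          finally have D: "(\<Sum>a\<in>edges p n. \<bar>X a \<omega>\<bar>) \<le> e' * real n" using small by simp
          have "\<bar>\<Sum>t=1..int n. X (t - int i) \<omega>\<bar>
             \<le> 2 * (e' * real n) + (norm1 p \<phi> * (2 * (e' * real n)) + \<bar>\<Sum>t=1..int n. Z t \<omega>\<bar>) / ?q"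
            by (rule lagged_sum_bound[of "\<lambda>s. X s \<omega>" p \<phi> "\<lambda>s. Z s \<omega>" n, OF _ phi_sum D])
              (use elim in blast, use i in simp)
          also have "\<dots> \<le> 2 * (e' * real n) + (norm1 p \<phi> * (2 * (e' * real n)) + e' * real n) / ?q"
            using h q by (intro add_left_mono divide_right_mono) auto
          also have "\<dots> = K * e' * real n" using q unfolding K_def by (simp add: field_simps)
          also have "\<dots> = e * real n" using K by (simp add: e'_def)
          finally show "\<bar>\<Sum>t=1..int n. X (t - int i) \<omega>\<bar> \<le> e * real n" .
        qed
      qed
    qed
  qed
qed

lemma whp_yule_walker_tight:
  assumes \<tau>: "\<tau> > 0"
  shows "\<exists>C. whp \<tau> (\<lambda>n \<omega>. sqrt (real n) * norm1 p (\<lambda>i. \<phi> i - vec_index (yule_walker p n (\<lambda>s. X s \<omega>)) (i - 1)) \<le> C)"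
proof (rule energy_coercive[OF p, of "\<mu> / 4" \<phi>])
  show "\<mu> / 4 > 0" using \<mu>(1) by simp
next
  fix \<kappa> \<eta> :: real
  assume \<kappa>: "\<kappa> > 0" and \<eta>: "\<eta> > 0" and coercive:
    "\<And>x z n v. \<lbrakk>n \<ge> 1; \<And>s. x s = regress p \<phi> x s + z s; \<mu> / 4 * real n \<le> (\<Sum>t=1..int n - 1. (z t)\<^sup>2);
      \<And>i. i \<in> {1..p} \<Longrightarrow> \<bar>\<Sum>t=1..int n - 1. z t * x (t - int i)\<bar> \<le> \<eta> * real n;
      \<And>i. i \<in> {1..p} \<Longrightarrow> (x (int n - int i))\<^sup>2 \<le> \<eta> * real n\<rbrakk>
      \<Longrightarrow> \<kappa> * (norm1 p v)\<^sup>2 \<le> energy p n x v"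
  let ?\<tau> = "\<tau> / 5"
  have \<tau>': "?\<tau> > 0" using \<tau> by simp
  obtain C where C: "whp ?\<tau> (\<lambda>n \<omega>. \<forall>i\<in>{1..p}. (\<Sum>t=1..int n. Z t \<omega> * X (t - int i) \<omega>)\<^sup>2 / real n \<le> C)"
    using whp_ball_tight[of "{1..p}" "\<lambda>i n \<omega>. (\<Sum>t=1..int n. Z t \<omega> * X (t - int i) \<omega>)\<^sup>2 / real n", OF _ _ \<tau>']
      whp_cross_tight by fastforce
  \<comment> \<open>In \<open>yule_walker_error\<close>, \<open>E\<close> becomes
    \<open>sqrt (\<bar>C\<bar> * n)\<close> and \<open>S\<^sup>2\<close> is at most
    \<open>sqrt n\<close>. Both terms are then multiples of \<open>sqrt n\<close>, and
    \<open>K\<close> is the total factor divided by \<open>\<kappa>\<close>.\<close>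
  define K where "K = (sqrt \<bar>C\<bar> + 2 * real p * (1 + norm1 p \<phi>)) / \<kappa>"
  have w1: "whp ?\<tau> (\<lambda>n \<omega>. \<forall>i\<in>{1..p}. \<bar>\<Sum>t=1..int n - 1. Z t \<omega> * X (t - int i) \<omega>\<bar> \<le> \<eta> * real n)"
    by (intro whp_ball whp_cross_vanish \<eta> \<tau>') auto
  have w2: "whp ?\<tau> (\<lambda>n \<omega>. \<forall>i\<in>{1..p}. (X (int n - int i) \<omega>)\<^sup>2 \<le> \<eta> * real n)"
    by (intro whp_ball whp_last_vanish \<eta> \<tau>') auto
  note w = whp_conj[OF C whp_conj[OF w1 whp_conj[OF w2 whp_conj[OF whp_innovation_energy[OF \<tau>'] whp_edges_vanish[OF \<tau>']]]]]
  let ?good = "\<lambda>n \<omega>. (\<forall>i\<in>{1..p}. (\<Sum>t=1..int n. Z t \<omega> * X (t - int i) \<omega>)\<^sup>2 / real n \<le> C) \<and>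
      (\<forall>i\<in>{1..p}. \<bar>\<Sum>t=1..int n - 1. Z t \<omega> * X (t - int i) \<omega>\<bar> \<le> \<eta> * real n) \<and>
      (\<forall>i\<in>{1..p}. (X (int n - int i) \<omega>)\<^sup>2 \<le> \<eta> * real n) \<and>
      \<mu> / 4 * real n \<le> (\<Sum>t=1..int n - 1. (Z t \<omega>)\<^sup>2) \<and>
      (\<Sum>a\<in>edges p n. (X a \<omega>)\<^sup>2) \<le> sqrt (real n)"
  let ?err = "\<lambda>n \<omega>. sqrt (real n) * norm1 p (\<lambda>i. \<phi> i - vec_index (yule_walker p n (\<lambda>s. X s \<omega>)) (i - 1))"
  have "whp \<tau> (\<lambda>n \<omega>. ?err n \<omega> \<le> K)"
  proof (rule whp_mono)
    show "whp \<tau> (\<lambda>n \<omega>. ?good n \<omega>)"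
      using w by simp
    show "\<forall>\<^sub>F n in sequentially. AE \<omega> in M. ?good n \<omega> \<longrightarrow> ?err n \<omega> \<le> K"
    proof (rule eventually_sequentiallyI[of 1])
      fix n :: nat assume n: "n \<ge> 1"
      show "AE \<omega> in M. ?good n \<omega> \<longrightarrow> ?err n \<omega> \<le> K"
        using ar
      proof (eventually_elim, intro impI, elim conjE)
        fix \<omega>
        assume x: "\<forall>t. X t \<omega> = regress p \<phi> (\<lambda>s. X s \<omega>) t + Z t \<omega>"
          and h1: "\<forall>i\<in>{1..p}. (\<Sum>t=1..int n. Z t \<omega> * X (t - int i) \<omega>)\<^sup>2 / real n \<le> C"
          and h2: "\<forall>i\<in>{1..p}. \<bar>\<Sum>t=1..int n - 1. Z t \<omega> * X (t - int i) \<omega>\<bar> \<le> \<eta> * real n"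
          and h3: "\<forall>i\<in>{1..p}. (X (int n - int i) \<omega>)\<^sup>2 \<le> \<eta> * real n"
          and h4: "\<mu> / 4 * real n \<le> (\<Sum>t=1..int n - 1. (Z t \<omega>)\<^sup>2)"
          and h5: "(\<Sum>a\<in>edges p n. (X a \<omega>)\<^sup>2) \<le> sqrt (real n)"
        let ?\<delta> = "\<lambda>i. \<phi> i - vec_index (yule_walker p n (\<lambda>s. X s \<omega>)) (i - 1)"
        let ?S = "sqrt (\<Sum>a\<in>edges p n. (X a \<omega>)\<^sup>2)" and ?E = "sqrt (\<bar>C\<bar> * real n)"
        have coer: "\<kappa> * (norm1 p v)\<^sup>2 \<le> energy p n (\<lambda>s. X s \<omega>) v" for v
          by (rule coercive[OF n, of _ "\<lambda>s. Z s \<omega>"]) (use x h2 h3 h4 in blast)+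
        have E: "\<bar>\<Sum>t=1..int n. Z t \<omega> * X (t - int i) \<omega>\<bar> \<le> ?E" if "i \<in> {1..p}" for i
        proof -
          have "(\<Sum>t=1..int n. Z t \<omega> * X (t - int i) \<omega>)\<^sup>2 / real n \<le> \<bar>C\<bar>" using h1 that by fastforce
          then have "(\<Sum>t=1..int n. Z t \<omega> * X (t - int i) \<omega>)\<^sup>2 \<le> \<bar>C\<bar> * real n" using n by (simp add: field_simps)
          then show ?thesis by (simp add: real_le_rsqrt flip: real_sqrt_abs)
        qed
        have S: "\<bar>X a \<omega>\<bar> \<le> ?S" if "a \<in> {1 - int p..0} \<union> {int n + 1 - int p..int n}" for a
        proof -
          have "(X a \<omega>)\<^sup>2 \<le> (\<Sum>a\<in>edges p n. (X a \<omega>)\<^sup>2)"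
            by (rule member_le_sum) (use that in \<open>auto simp: edges_def\<close>)
          then show ?thesis by (simp flip: real_sqrt_abs)
        qed
        have S2: "?S\<^sup>2 \<le> sqrt (real n)" using h5 by (simp add: sum_nonneg)
        have "\<kappa> * (real n * norm1 p ?\<delta>) \<le> \<bar>?E\<bar> + 2 * real p * (1 + norm1 p \<phi>) * ?S\<^sup>2"
          by (rule yule_walker_error[where x="\<lambda>s. X s \<omega>" and z="\<lambda>s. Z s \<omega>", OF n x[rule_format] \<kappa> coer E S])
            (simp_all add: sum_nonneg)
        also have "\<dots> \<le> sqrt \<bar>C\<bar> * sqrt (real n) + 2 * real p * (1 + norm1 p \<phi>) * sqrt (real n)"
          using S2 norm1_nonneg[of p \<phi>] by (intro add_mono mult_left_mono) (auto simp: real_sqrt_mult)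
        also have "\<dots> = \<kappa> * (K * sqrt (real n))" using \<kappa> by (simp add: K_def distrib_right)
        finally have "real n * norm1 p ?\<delta> \<le> K * sqrt (real n)" using \<kappa> by simp
        then have "sqrt (real n) * (sqrt (real n) * norm1 p ?\<delta>) \<le> sqrt (real n) * K"
          by (simp add: mult.assoc[symmetric] mult.commute)
        then show "sqrt (real n) * norm1 p ?\<delta> \<le> K" using n by simp
      qed
    qed
  qed
  then show ?thesis by blast
qed

end

section \<open>Smoothed indicators and the smoothed distribution function\<close>

text \<open>A shift by \<open>m\<close> consists of \<open>m\<close> unit shifts, each telescoping
  to a difference of two values in the unit interval. The bound is free of \<open>N\<close>, which
  later permits infinitely many grid points.\<close>

lemma grid_telescope:
  fixes g :: "int \<Rightarrow> real"
  assumes "\<And>k. 0 \<le> g k" "\<And>k. g k \<le> 1"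
  shows "(\<Sum>k=-int N..int N. g (k + int m) - g k) \<le> real m"
proof (induction m)
  case 0 then show ?case by simp
next
  case (Suc m)
  have tel: "(\<Sum>k\<in>{-int N..int N}. g (k + int m + 1) - g (k + int m)) = g (int N + int m + 1) - g (- int N + int m)"
  proof (induction N)
    case 0 then show ?case by simp
  next
    case (Suc N)
    have "{-int (Suc N)..int (Suc N)} = insert (-int (Suc N)) (insert (int (Suc N)) {-int N..int N})"
      by auto
    then show ?case using Suc by (simp add: algebra_simps)
  qed
  have "(\<Sum>k=-int N..int N. g (k + int (Suc m)) - g k)
     = (\<Sum>k=-int N..int N. g (k + int m) - g k) + (\<Sum>k\<in>{-int N..int N}. g (k + int m + 1) - g (k + int m))"
    by (simp add: sum.distrib[symmetric] algebra_simps)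
  also have "\<dots> \<le> real m + 1"
    using Suc tel assms(1)[of "- int N + int m"] assms(2)[of "int N + int m + 1"] by linarith
  finally show ?case by simp
qed

text \<open>A positive shift is covered by \<open>m\<close> mesh widths, \<open>m\<close> being
  \<open>a / d\<close> rounded up, and monotonicity compares the two shifts. A negative shift is
  reversed by starting from \<open>x + a\<close>.\<close>

lemma grid_variation:
  fixes G :: "real \<Rightarrow> real"
  assumes mono: "mono G" and b: "\<And>x. 0 \<le> G x" "\<And>x. G x \<le> 1" and d: "d > 0"
  shows "(\<Sum>k=-int N..int N. \<bar>G (of_int k * d + x + a) - G (of_int k * d + x)\<bar>) \<le> \<bar>a\<bar> / d + 1"
proof -
  have pos: "(\<Sum>k=-int N..int N. \<bar>G (of_int k * d + x + a) - G (of_int k * d + x)\<bar>) \<le> \<bar>a\<bar> / d + 1"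
    if a: "a \<ge> 0" for x a
  proof -
    define m where "m = nat \<lceil>a / d\<rceil>"
    have m1: "a \<le> real m * d"
      using d a by (simp add: m_def pos_divide_le_eq[symmetric])
    have m2: "real m \<le> a / d + 1"
      using d a by (simp add: m_def)
    have "(\<Sum>k=-int N..int N. \<bar>G (of_int k * d + x + a) - G (of_int k * d + x)\<bar>)
       \<le> (\<Sum>k=-int N..int N. G (of_int (k + int m) * d + x) - G (of_int k * d + x))"
    proof (rule sum_mono)
      fix k
      have "G (of_int k * d + x) \<le> G (of_int k * d + x + a)" using a by (intro monoD[OF mono]) simp
      moreover have "G (of_int k * d + x + a) \<le> G (of_int (k + int m) * d + x)"
        using m1 by (intro monoD[OF mono]) (simp add: algebra_simps)
      ultimately show "\<bar>G (of_int k * d + x + a) - G (of_int k * d + x)\<bar> \<le> G (of_int (k + int m) * d + x) - G (of_int k * d + x)"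
        by simp
    qed
    also have "\<dots> \<le> real m" by (rule grid_telescope) (use b in auto)
    finally show ?thesis using m2 a by simp
  qed
  show ?thesis
  proof (cases "a \<ge> 0")
    case True then show ?thesis by (rule pos)
  next
    case False
    then have "(\<Sum>k=-int N..int N. \<bar>G (of_int k * d + (x + a) + (- a)) - G (of_int k * d + (x + a))\<bar>) \<le> \<bar>- a\<bar> / d + 1"
      by (intro pos) simp
    then show ?thesis by (simp add: add.assoc abs_minus_commute)
  qed
qed

section \<open>The distribution function of the kernel\<close>

definition kernel_int :: "(real \<Rightarrow> real) \<Rightarrow> real \<Rightarrow> real" where
  "kernel_int K x = (LBINT u:{..x}. K u)"

context
  fixes K :: "real \<Rightarrow> real"
  assumes kernel: "symmetric_kernel K"
begin

lemma kernel_nonneg: "0 \<le> K u" and kernel_integrable: "integrable lborel K"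
  and kernel_total: "integral\<^sup>L lborel K = 1"
  using kernel unfolding symmetric_kernel_def has_bochner_integral_iff by auto

lemma kernel_borel: "K \<in> borel_measurable borel"
  using borel_measurable_integrable[OF kernel_integrable] by simp

lemma kernel_set_integrable: "A \<in> sets borel \<Longrightarrow> set_integrable lborel A K"
  unfolding set_integrable_def using kernel_integrable
  by (intro integrable_mult_indicator) auto

lemma kernel_int_diff:
  assumes "x \<le> y" shows "kernel_int K y - kernel_int K x = (LBINT u:{x<..y}. K u)"
proof -
  have "{..y} = {..x} \<union> {x<..y}" using assms by auto
  then have "kernel_int K y = (LBINT u:{..x}. K u) + (LBINT u:{x<..y}. K u)"
    unfolding kernel_int_def
    by (simp only:) (rule set_integral_Un, auto intro: kernel_set_integrable)
  then show ?thesis by (simp add: kernel_int_def)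
qed

lemma kernel_int_mono: "mono (kernel_int K)"
proof (rule monoI)
  fix x y :: real assume "x \<le> y"
  from kernel_int_diff[OF this] show "kernel_int K x \<le> kernel_int K y"
    using kernel_nonneg by (smt (verit) set_lebesgue_integral_def Bochner_Integration.integral_nonneg indicator_pos_le scaleR_nonneg_nonneg)
qed

lemma kernel_int_nonneg: "0 \<le> kernel_int K x"
  unfolding kernel_int_def set_lebesgue_integral_def
  by (intro Bochner_Integration.integral_nonneg) (simp add: kernel_nonneg)

lemma kernel_int_le_1: "kernel_int K x \<le> 1"
proof -
  have "kernel_int K x \<le> integral\<^sup>L lborel K"
    unfolding kernel_int_def set_lebesgue_integral_def
    using kernel_set_integrable[of "{..x}"] kernel_integrable
    by (intro integral_mono) (auto simp: set_integrable_def indicator_def kernel_nonneg)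
  then show ?thesis by (simp add: kernel_total)
qed

lemma kernel_int_lipschitz:
  assumes "\<And>u. K u \<le> B"
  shows "\<bar>kernel_int K y - kernel_int K x\<bar> \<le> B * \<bar>y - x\<bar>"
proof -
  have *: "\<bar>kernel_int K y - kernel_int K x\<bar> \<le> B * \<bar>y - x\<bar>" if xy: "x \<le> y" for x y
  proof -
    have fin: "emeasure lborel {x<..y} < \<infinity>" using xy by simp
    have "(LBINT u:{x<..y}. K u) \<le> (LBINT u:{x<..y}. B)"
      using assms
      by (intro set_integral_mono kernel_set_integrable)
        (auto simp: set_integrable_def fin[simplified])
    also have "\<dots> = B * (y - x)"
      using xy fin by (simp add: set_lebesgue_integral_def)
    finally have "kernel_int K y - kernel_int K x \<le> B * (y - x)" using kernel_int_diff[OF xy] by simp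
    then show ?thesis using monoD[OF kernel_int_mono xy] xy by simp
  qed
  show ?thesis
    using *[of x y] *[of y x] by (cases "x \<le> y") (auto simp: abs_minus_commute)
qed

lemma kernel_int_continuous:
  assumes "\<And>u. K u \<le> B"
  shows "continuous_on UNIV (kernel_int K)"
proof -
  have "0 \<le> B" using assms[of 0] kernel_nonneg[of 0] by linarith
  then have "B-lipschitz_on UNIV (kernel_int K)"
    using kernel_int_lipschitz[OF assms] by (intro lipschitz_onI) (auto simp: dist_real_def)
  then show ?thesis by (rule lipschitz_on_continuous_on)
qed

lemma integral_scaled_kernel:
  assumes "h > 0"
  shows "(LBINT u:{..z}. scaled_kernel K h (u - e)) = kernel_int K ((z - e) / h)"
proof -
  have "(LBINT u:{..z}. scaled_kernel K h (u - e))
      = \<bar>h\<bar> *\<^sub>R (\<integral>u. indicator {..z} (e + h * u) *\<^sub>R scaled_kernel K h (e + h * u - e) \<partial>lborel)"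
    unfolding set_lebesgue_integral_def
    by (rule lborel_integral_real_affine) (use assms in auto)
  also have "\<dots> = (\<integral>u. \<bar>h\<bar> *\<^sub>R (indicator {..z} (e + h * u) *\<^sub>R scaled_kernel K h (e + h * u - e)) \<partial>lborel)"
    by (rule Bochner_Integration.integral_scaleR_right[symmetric])
  also have "\<dots> = kernel_int K ((z - e) / h)"
    unfolding kernel_int_def set_lebesgue_integral_def
    using assms by (intro Bochner_Integration.integral_cong)
      (auto simp: scaled_kernel_def indicator_def field_simps)
  finally show ?thesis .
qed

lemma kernel_cdf_eq:
  assumes "h > 0"
  shows "kernel_cdf K h n e z = (\<Sum>t=1..int n. kernel_int K ((z - e t) / h)) / real n"
  unfolding kernel_cdf_def by (simp add: integral_scaled_kernel[OF assms])

text \<open>Fubini's theorem for the indicator of \<open>h * v + z \<le> x\<close>, which has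
  probability \<open>cdf P (x - h * v)\<close> in \<open>z\<close>. Smoothing the indicator thus
  becomes smoothing \<open>cdf P\<close>, to which a Taylor expansion applies.\<close>

lemma expectation_kernel_int:
  assumes "real_distribution P" and h: "h > 0"
  shows "(\<integral>z. kernel_int K ((x - z) / h) \<partial>P) = (\<integral>v. K v * cdf P (x - h * v) \<partial>lborel)"
proof -
  interpret P: real_distribution P by fact
  interpret pair_sigma_finite lborel P ..
  note [measurable] = kernel_borel
  let ?f = "\<lambda>v z. indicator {y. h * v + y \<le> x} z * K v"
  have [measurable]: "(\<lambda>(v,z). ?f v z) \<in> borel_measurable (lborel \<Otimes>\<^sub>M P)"
    unfolding indicator_def by measurable
  have int: "integrable (lborel \<Otimes>\<^sub>M P) (\<lambda>(v,z). ?f v z)"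
  proof (rule Bochner_Integration.integrable_bound)
    show "integrable (lborel \<Otimes>\<^sub>M P) (\<lambda>(v,z). K v)"
    proof (rule Fubini_integrable)
      show "integrable lborel (\<lambda>v. \<integral>z. norm (case (v, z) of (v,z) \<Rightarrow> K v) \<partial>P)"
        using kernel_integrable by (simp add: P.prob_space[simplified])
    qed auto
  qed (auto simp: indicator_def)
  have "(\<integral>z. kernel_int K ((x - z) / h) \<partial>P) = (\<integral>z. (\<integral>v. ?f v z \<partial>lborel) \<partial>P)"
    unfolding kernel_int_def set_lebesgue_integral_def
    by (intro Bochner_Integration.integral_cong refl) (use h in \<open>auto simp: indicator_def field_simps\<close>)
  also have "\<dots> = (\<integral>v. (\<integral>z. ?f v z \<partial>P) \<partial>lborel)"
    by (rule Fubini_integral[OF int])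
  also have "\<dots> = (\<integral>v. K v * cdf P (x - h * v) \<partial>lborel)"
  proof (rule Bochner_Integration.integral_cong[OF refl])
    fix v
    have "{y. h * v + y \<le> x} = {..x - h * v}" by auto
    then show "(\<integral>z. ?f v z \<partial>P) = K v * cdf P (x - h * v)"
      by (simp add: cdf_def)
  qed
  finally show ?thesis .
qed

lemma kernel_bounded:
  assumes "K \<in> cont_diff_class 2"
  obtains B where "B > 0" "\<And>u. K u \<le> B"
proof -
  have "\<forall>x. K differentiable at x" using assms unfolding cont_diff_class_def by (auto dest: spec[of _ 0])
  then have "continuous_on {-1..1} K"
    by (meson continuous_at_imp_continuous_on differentiable_imp_continuous_within)
  then have "bounded (K ` {-1..1})" by (intro compact_imp_bounded compact_continuous_image) auto
  then obtain B where "\<forall>x\<in>K ` {-1..1}. norm x \<le> B" unfolding bounded_iff by blast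
  then have B: "\<bar>K u\<bar> \<le> B" if "u \<in> {-1..1}" for u using that by auto
  have "K u \<le> max B 1" for u
  proof (cases "\<bar>u\<bar> \<le> 1")
    case True
    then have "\<bar>K u\<bar> \<le> B" by (intro B) auto
    then show ?thesis by simp
  next
    case False
    then have "K u = 0" using kernel unfolding symmetric_kernel_def by auto
    then show ?thesis by simp
  qed
  then show ?thesis by (intro that[of "max B 1"]) auto
qed

end

text \<open>\<open>F'\<close> is the derivative of \<open>F\<close>, whereas a density is determined
  only up to null sets. Its bounds are therefore read off difference quotients via
  \<open>lip\<close>; the remainder estimate is the mean value theorem followed by the Hoelder
  condition.\<close>

lemma holder_class_1_taylor:
  assumes F: "F \<in> holder_class 1 \<beta>" and lip: "\<And>x y. x \<le> y \<Longrightarrow> 0 \<le> F y - F x \<and> F y - F x \<le> C * (y - x)"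
    and \<beta>: "\<beta> > 0"
  obtains F' H where "H \<ge> 0" "continuous_on UNIV F'" "\<And>x. 0 \<le> F' x" "\<And>x. F' x \<le> C"
    "\<And>x a. \<bar>F (x + a) - F x - a * F' x\<bar> \<le> H * \<bar>a\<bar> powr (1 + \<beta>)"
proof -
  define F' where "F' = deriv F"
  have der: "(F has_real_derivative F' x) (at x)" for x
    using F unfolding holder_class_def F'_def by (auto simp: DERIV_deriv_iff_real_differentiable)
  obtain H where H: "\<And>x y. x \<noteq> y \<Longrightarrow> \<bar>F' x - F' y\<bar> / \<bar>x - y\<bar> powr \<beta> \<le> H"
  proof -
    obtain H where "\<forall>q\<in>{\<bar>F' x - F' y\<bar> / \<bar>x - y\<bar> powr \<beta> | x y. x \<noteq> y}. q \<le> H"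
      using F unfolding holder_class_def F'_def bdd_above_def by auto
    then show ?thesis by (intro that[of H]) blast
  qed
  have H0: "H \<ge> 0" using H[of 0 1] by auto
  have hold: "\<bar>F' x - F' y\<bar> \<le> H * \<bar>x - y\<bar> powr \<beta>" for x y
  proof (cases "x = y")
    case False
    then show ?thesis using H[OF False] by (simp add: pos_divide_le_eq)
  qed simp
  have cont: "continuous_on UNIV F'"
  proof (rule continuous_at_imp_continuous_on, rule ballI)
    fix x :: real
    have "((\<lambda>y. H * \<bar>y - x\<bar> powr \<beta>) \<longlongrightarrow> H * \<bar>x - x\<bar> powr \<beta>) (at x)"
      using \<beta> by (intro tendsto_intros tendsto_powr') auto
    then have lim: "((\<lambda>y. H * \<bar>y - x\<bar> powr \<beta>) \<longlongrightarrow> 0) (at x)" using \<beta> by simp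
    have "((\<lambda>y. F' y - F' x) \<longlongrightarrow> 0) (at x)"
      by (rule Lim_null_comparison[OF _ lim]) (simp add: hold)
    then show "isCont F' x" unfolding isCont_def by (simp add: LIM_zero_iff)
  qed
  have quot: "((\<lambda>y. (F y - F x) / (y - x)) \<longlongrightarrow> F' x) (at x)" for x
    using der[of x] by (simp add: has_field_derivative_iff)
  have q: "0 \<le> (F y - F x) / (y - x) \<and> (F y - F x) / (y - x) \<le> C" if "y \<noteq> x" for x y
  proof (cases "x < y")
    case True
    then show ?thesis using lip[of x y] by (auto simp: field_simps)
  next
    case False
    then have "y < x" using that by simp
    then show ?thesis using lip[of y x] by (auto simp: divide_simps algebra_simps)
  qed
  have nn: "0 \<le> F' x" for x
    by (rule tendsto_lowerbound[OF quot]) (auto simp: eventually_at_filter q)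
  have le: "F' x \<le> C" for x
    by (rule tendsto_upperbound[OF quot]) (auto simp: eventually_at_filter q)
  have taylor: "\<bar>F (x + a) - F x - a * F' x\<bar> \<le> H * \<bar>a\<bar> powr (1 + \<beta>)" for x a
  proof (cases "a = 0")
    case False
    have "\<exists>c. \<bar>c - x\<bar> \<le> \<bar>a\<bar> \<and> F (x + a) - F x = a * F' c"
    proof (cases "a > 0")
      case True
      then obtain c where "x < c" "c < x + a" "F (x + a) - F x = (x + a - x) * F' c"
        using MVT2[of x "x + a" F F'] der by auto
      then show ?thesis by (intro exI[of _ c]) auto
    next
      case False
      with \<open>a \<noteq> 0\<close> obtain c where "x + a < c" "c < x" "F x - F (x + a) = (x - (x + a)) * F' c"
        using MVT2[of "x + a" x F F'] der by auto
      then show ?thesis by (intro exI[of _ c]) (auto simp: algebra_simps)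
    qed
    then obtain c where c: "\<bar>c - x\<bar> \<le> \<bar>a\<bar>" "F (x + a) - F x = a * F' c" by blast
    have "F (x + a) - F x - a * F' x = a * (F' c - F' x)"
      using c(2) by (simp only: right_diff_distrib)
    then have "\<bar>F (x + a) - F x - a * F' x\<bar> = \<bar>a\<bar> * \<bar>F' c - F' x\<bar>"
      by (simp only: abs_mult)
    also have "\<dots> \<le> \<bar>a\<bar> * (H * \<bar>a\<bar> powr \<beta>)"
      using hold[of c x] c(1) H0 \<beta>
      by (intro mult_left_mono order_trans[OF hold] powr_mono2) auto
    also have "\<dots> = H * \<bar>a\<bar> powr (1 + \<beta>)" using False by (simp add: powr_add)
    finally show ?thesis .
  qed simp
  show ?thesis using that[OF H0 cont nn le taylor] .
qed

text \<open>The expansion of \<open>cdf P\<close> at \<open>x - h * v\<close> is averaged with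
  weight \<open>K v\<close>. As the kernel has total mass 1, the bound is the same for every
  bandwidth. The slope \<open>s\<close> does not depend on \<open>a\<close>, so it can be taken out
  of sums over different shifts.\<close>

lemma smoothed_cdf_taylor:
  assumes P: "real_distribution P" and kernel: "symmetric_kernel K" and h: "h > 0"
    and F': "continuous_on UNIV F'" "\<And>x. 0 \<le> F' x" "\<And>x. F' x \<le> C"
    and taylor: "\<And>x a. \<bar>cdf P (x + a) - cdf P x - a * F' x\<bar> \<le> H * \<bar>a\<bar> powr (1 + \<beta>)"
  shows "\<exists>s. 0 \<le> s \<and> s \<le> C \<and> (\<forall>a. \<bar>(\<integral>z. kernel_int K ((x + a - z) / h) \<partial>P) - (\<integral>z. kernel_int K ((x - z) / h) \<partial>P) - a * s\<bar>
            \<le> H * \<bar>a\<bar> powr (1 + \<beta>))"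
proof -
  interpret P: real_distribution P by fact
  note [measurable] = kernel_borel[OF kernel]
  have [measurable]: "F' \<in> borel_measurable borel" by (rule borel_measurable_continuous_onI[OF F'(1)])
  have int: "integrable lborel (\<lambda>v. K v * g v)" if [measurable]: "g \<in> borel_measurable borel" and "\<And>v. \<bar>g v\<bar> \<le> c" for g c
  proof (rule Bochner_Integration.integrable_bound)
    show "integrable lborel (\<lambda>v. K v * c)" using kernel_integrable[OF kernel] by simp
    have "0 \<le> c" using that(2)[of 0] by linarith
    then show "AE v in lborel. norm (K v * g v) \<le> norm (K v * c)"
      using that by (auto simp: abs_mult kernel_nonneg[OF kernel] intro!: mult_left_mono)
  qed simp
  have [measurable]: "cdf P \<in> borel_measurable borel"
    using P.cdf_nondecreasing by (intro borel_measurable_mono monoI) auto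
  have icdf: "integrable lborel (\<lambda>v. K v * cdf P (x - h * v))" for x
    by (rule int[of _ 1]) (auto simp: P.cdf_nonneg P.cdf_bounded_prob)
  have iF': "integrable lborel (\<lambda>v. K v * F' (x - h * v))"
    using F'(2,3) by (intro int[of _ C]) (auto simp: abs_le_iff intro: order_trans[of _ 0])
  define s where "s = (\<integral>v. K v * F' (x - h * v) \<partial>lborel)"
  have s0: "0 \<le> s" unfolding s_def using kernel_nonneg[OF kernel] F'(2)
    by (intro Bochner_Integration.integral_nonneg) auto
  have "s \<le> (\<integral>v. K v * C \<partial>lborel)" unfolding s_def
    using kernel_nonneg[OF kernel] F'(3) kernel_integrable[OF kernel]
    by (intro integral_mono iF') (auto intro: mult_left_mono)
  then have s1: "s \<le> C" using kernel_total[OF kernel] by simp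
  have "\<bar>(\<integral>z. kernel_int K ((x + a - z) / h) \<partial>P) - (\<integral>z. kernel_int K ((x - z) / h) \<partial>P) - a * s\<bar>
            \<le> H * \<bar>a\<bar> powr (1 + \<beta>)" (is "\<bar>?L\<bar> \<le> ?R") for a
  proof -
    have "?L = (\<integral>v. K v * cdf P (x + a - h * v) \<partial>lborel) - (\<integral>v. K v * cdf P (x - h * v) \<partial>lborel) - (\<integral>v. a * (K v * F' (x - h * v)) \<partial>lborel)"
      using h by (simp add: expectation_kernel_int[OF kernel P] s_def)
    also have "\<dots> = (\<integral>v. K v * (cdf P ((x - h * v) + a) - cdf P (x - h * v) - a * F' (x - h * v)) \<partial>lborel)"
      using icdf[of "x + a"] icdf[of x] iF'
      by (subst Bochner_Integration.integral_diff[symmetric], simp, simp)+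
         (auto intro!: Bochner_Integration.integral_cong simp: algebra_simps)
    finally have eq: "?L = \<dots>" .
    have "norm ?L \<le> (\<integral>v. K v * ?R \<partial>lborel)"
      unfolding eq
    proof (rule Bochner_Integration.integral_norm_bound_integral)
      show "integrable lborel (\<lambda>v. K v * (cdf P ((x - h * v) + a) - cdf P (x - h * v) - a * F' (x - h * v)))"
        by (rule int[OF _ taylor]) simp
      show "integrable lborel (\<lambda>v. K v * ?R)" using kernel_integrable[OF kernel] by simp
    qed (auto simp: abs_mult kernel_nonneg[OF kernel] intro!: mult_left_mono taylor)
    then show ?thesis using kernel_total[OF kernel] by simp
  qed
  with s0 s1 show ?thesis by blast
qed

section \<open>Centred increments on an infinite grid\<close>

context prob_space
begin

text \<open>Chebyshev's inequality and a union bound on \<open>{-N..N}\<close>, then continuity from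
  below as \<open>N\<close> grows, since \<open>b\<close> bounds the summed second moments for all
  \<open>N\<close>.\<close>

lemma prob_exists_int_le:
  fixes Y :: "int \<Rightarrow> 'a \<Rightarrow> real"
  assumes [measurable]: "\<And>k. Y k \<in> borel_measurable M" and int: "\<And>k. integrable M (\<lambda>\<omega>. (Y k \<omega>)\<^sup>2)"
    and b: "\<And>N. (\<Sum>k=-int N..int N. expectation (\<lambda>\<omega>. (Y k \<omega>)\<^sup>2)) \<le> b" and a: "a > 0"
  shows "prob {\<omega> \<in> space M. \<exists>k. a < \<bar>Y k \<omega>\<bar>} \<le> b / a\<^sup>2"
proof -
  define A where "A N = {\<omega> \<in> space M. \<exists>k\<in>{-int N..int N}. a < \<bar>Y k \<omega>\<bar>}" for N
  have [measurable]: "A N \<in> events" for N unfolding A_def by measurable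
  have "prob (A N) \<le> b / a\<^sup>2" for N
  proof -
    have "A N = (\<Union>k\<in>{-int N..int N}. {\<omega> \<in> space M. a < \<bar>Y k \<omega>\<bar>})" by (auto simp: A_def)
    then have "prob (A N) \<le> (\<Sum>k=-int N..int N. prob {\<omega> \<in> space M. a < \<bar>Y k \<omega>\<bar>})"
      by (simp only:) (rule measure_UNION_le, auto)
    also have "\<dots> \<le> (\<Sum>k=-int N..int N. expectation (\<lambda>\<omega>. (Y k \<omega>)\<^sup>2) / a\<^sup>2)"
    proof (rule sum_mono)
      fix k
      have "a < \<bar>y\<bar> \<longleftrightarrow> a\<^sup>2 < y\<^sup>2" for y
        using abs_le_square_iff[of y a] a by (simp add: not_le[symmetric])
      then have "{\<omega> \<in> space M. a < \<bar>Y k \<omega>\<bar>} = {\<omega> \<in> space M. a\<^sup>2 < (Y k \<omega>)\<^sup>2}" by simp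
      then show "prob {\<omega> \<in> space M. a < \<bar>Y k \<omega>\<bar>} \<le> expectation (\<lambda>\<omega>. (Y k \<omega>)\<^sup>2) / a\<^sup>2"
        using markov_bound[OF int[of k] _ order_refl, of "a\<^sup>2"] a by simp
    qed
    also have "\<dots> \<le> b / a\<^sup>2" unfolding sum_divide_distrib[symmetric] using b by (intro divide_right_mono) auto
    finally show ?thesis .
  qed
  moreover have "(\<lambda>N. prob (A N)) \<longlonglongrightarrow> prob (\<Union>N. A N)"
  proof (rule finite_Lim_measure_incseq)
    show "incseq A"
    proof (rule incseq_SucI)
      show "A N \<subseteq> A (Suc N)" for N unfolding A_def by force
    qed
  qed auto
  ultimately have "prob (\<Union>N. A N) \<le> b / a\<^sup>2" by (intro LIMSEQ_le_const2) auto
  moreover have "(\<Union>N. A N) = {\<omega> \<in> space M. \<exists>k. a < \<bar>Y k \<omega>\<bar>}"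
  proof -
    have "k \<in> {-int (nat \<bar>k\<bar>)..int (nat \<bar>k\<bar>)}" for k by auto
    then show ?thesis unfolding A_def by blast
  qed
  ultimately show ?thesis by simp
qed

end

context iid_space
begin

context
  fixes K :: "real \<Rightarrow> real" and B :: real
  assumes kernel: "symmetric_kernel K" and K_le: "\<And>u. K u \<le> B"
begin

lemma kernel_bound_nonneg: "0 \<le> B"
  using K_le[of 0] kernel_nonneg[OF kernel, of 0] by linarith

lemma kernel_int_borel [measurable]: "kernel_int K \<in> borel_measurable borel"
  by (rule borel_measurable_mono[OF kernel_int_mono[OF kernel]])

definition smooth_cdf :: "real \<Rightarrow> real \<Rightarrow> real" where
  "smooth_cdf h x = (\<integral>z. kernel_int K ((x - z) / h) \<partial>P)"

definition centred_increment :: "real \<Rightarrow> real \<Rightarrow> real \<Rightarrow> real \<Rightarrow> real" where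
  "centred_increment h x a z = (kernel_int K ((x + a - z) / h) - kernel_int K ((x - z) / h))
     - (smooth_cdf h (x + a) - smooth_cdf h x)"

lemma kernel_int_P_integrable: "integrable P (\<lambda>z. kernel_int K ((x - z) / h))"
proof (rule P.integrable_const_bound[of _ 1])
  show "AE z in P. norm (kernel_int K ((x - z) / h)) \<le> 1"
    using kernel_int_nonneg[OF kernel] kernel_int_le_1[OF kernel] by (intro AE_I2) simp
  show "(\<lambda>z. kernel_int K ((x - z) / h)) \<in> borel_measurable P" by measurable
qed

lemma kernel_int_increment:
  assumes "h > 0"
  shows "\<bar>kernel_int K ((x + a - z) / h) - kernel_int K ((x - z) / h)\<bar> \<le> B * \<bar>a\<bar> / h"
proof -
  have "\<bar>kernel_int K ((x + a - z) / h) - kernel_int K ((x - z) / h)\<bar> \<le> B * \<bar>(x + a - z) / h - (x - z) / h\<bar>"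
    by (rule kernel_int_lipschitz[OF kernel K_le])
  also have "(x + a - z) / h - (x - z) / h = a / h" by (simp add: diff_divide_distrib add_divide_distrib)
  finally show ?thesis using assms by simp
qed

lemma smooth_cdf_diff:
  "smooth_cdf h (x + a) - smooth_cdf h x = (\<integral>z. kernel_int K ((x + a - z) / h) - kernel_int K ((x - z) / h) \<partial>P)"
  unfolding smooth_cdf_def by (rule Bochner_Integration.integral_diff[symmetric]; rule kernel_int_P_integrable)

lemma smooth_cdf_increment:
  assumes "h > 0"
  shows "\<bar>smooth_cdf h (x + a) - smooth_cdf h x\<bar> \<le> B * \<bar>a\<bar> / h"
proof -
  have "norm (\<integral>z. kernel_int K ((x + a - z) / h) - kernel_int K ((x - z) / h) \<partial>P) \<le> (\<integral>z. B * \<bar>a\<bar> / h \<partial>P)"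
    by (rule Bochner_Integration.integral_norm_bound_integral)
       (auto intro!: Bochner_Integration.integrable_diff kernel_int_P_integrable kernel_int_increment assms)
  then show ?thesis using P.prob_space by (simp add: smooth_cdf_diff)
qed

lemma smooth_cdf_bounds: "0 \<le> smooth_cdf h x" "smooth_cdf h x \<le> 1"
proof -
  show "0 \<le> smooth_cdf h x" unfolding smooth_cdf_def
    by (intro Bochner_Integration.integral_nonneg kernel_int_nonneg kernel)
  have "smooth_cdf h x \<le> (\<integral>z. 1 \<partial>P)" unfolding smooth_cdf_def
    by (intro integral_mono kernel_int_P_integrable kernel_int_le_1 kernel) auto
  then show "smooth_cdf h x \<le> 1" using P.prob_space by simp
qed

lemma smooth_cdf_mono:
  assumes "h > 0" shows "mono (smooth_cdf h)"
proof (rule monoI)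
  fix x y :: real assume "x \<le> y"
  then show "smooth_cdf h x \<le> smooth_cdf h y" unfolding smooth_cdf_def
    using assms by (intro integral_mono kernel_int_P_integrable monoD[OF kernel_int_mono[OF kernel]] divide_right_mono) auto
qed

lemma centred_increment_bound:
  assumes "h > 0"
  shows "\<bar>centred_increment h x a z\<bar> \<le> 2 * (B * \<bar>a\<bar> / h)"
  unfolding centred_increment_def
  using kernel_int_increment[OF assms, of x a z] smooth_cdf_increment[OF assms, of x a] by linarith

lemma centred_increment_bound2: "\<bar>centred_increment h x a z\<bar> \<le> 2"
proof -
  have "0 \<le> kernel_int K u" "kernel_int K u \<le> 1" for u
    using kernel_int_nonneg[OF kernel] kernel_int_le_1[OF kernel] by auto
  from this[of "(x + a - z) / h"] this[of "(x - z) / h"] smooth_cdf_bounds[of h "x + a"] smooth_cdf_bounds[of h x]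
  show ?thesis unfolding centred_increment_def by linarith
qed

text \<open>In each square one factor is estimated by the Lipschitz bound and the other is kept, to
  be summed by \<open>grid_variation\<close>. The centring is itself an increment of the monotone
  function \<open>smooth_cdf\<close>, so it obeys the same two estimates.\<close>

lemma centred_increment_grid_squares:
  assumes h: "h > 0" and d: "d > 0"
  shows "(\<Sum>k=-int N..int N. (centred_increment h (of_int k * d) a z)\<^sup>2) \<le> 4 * (B * \<bar>a\<bar> / h) * (\<bar>a\<bar> / d + 1)"
proof -
  let ?I = "{-int N..int N}"
  let ?a = "\<lambda>k. \<bar>kernel_int K ((of_int k * d + a - z) / h) - kernel_int K ((of_int k * d - z) / h)\<bar>" and ?b = "\<lambda>k. \<bar>smooth_cdf h (of_int k * d + a) - smooth_cdf h (of_int k * d)\<bar>"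
  have "mono (\<lambda>x. kernel_int K (x / h))"
    using h by (intro monoI monoD[OF kernel_int_mono[OF kernel]] divide_right_mono) auto
  then have "(\<Sum>k\<in>?I. \<bar>kernel_int K ((of_int k * d + (- z) + a) / h) - kernel_int K ((of_int k * d + (- z)) / h)\<bar>) \<le> \<bar>a\<bar> / d + 1"
    using kernel_int_nonneg[OF kernel] kernel_int_le_1[OF kernel] d
    by (rule grid_variation[of "\<lambda>x. kernel_int K (x / h)"])
  moreover have "(of_int k * d + (- z) + a) / h = (of_int k * d + a - z) / h" "(of_int k * d + (- z)) / h = (of_int k * d - z) / h" for k
    by (simp_all add: algebra_simps)
  ultimately have 1: "(\<Sum>k\<in>?I. ?a k) \<le> \<bar>a\<bar> / d + 1"
    by (simp only:)
  have 2: "(\<Sum>k\<in>?I. ?b k) \<le> \<bar>a\<bar> / d + 1"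
    using grid_variation[OF smooth_cdf_mono[OF h] smooth_cdf_bounds d, where x=0] by simp
  have "(\<Sum>k\<in>?I. (centred_increment h (of_int k * d) a z)\<^sup>2)
     \<le> (\<Sum>k\<in>?I. (2 * (B * \<bar>a\<bar> / h)) * (?a k + ?b k))"
  proof (rule sum_mono)
    fix k
    have "(centred_increment h (of_int k * d) a z)\<^sup>2 = \<bar>centred_increment h (of_int k * d) a z\<bar> * \<bar>centred_increment h (of_int k * d) a z\<bar>"
      by (simp add: power2_eq_square)
    also have "\<dots> \<le> (2 * (B * \<bar>a\<bar> / h)) * (?a k + ?b k)"
    proof (rule mult_mono[OF centred_increment_bound[OF h]])
      show "0 \<le> 2 * (B * \<bar>a\<bar> / h)" using kernel_bound_nonneg h by simp
    qed (auto simp: centred_increment_def)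
    finally show "(centred_increment h (of_int k * d) a z)\<^sup>2 \<le> \<dots>" .
  qed
  also have "\<dots> = (2 * (B * \<bar>a\<bar> / h)) * ((\<Sum>k\<in>?I. ?a k) + (\<Sum>k\<in>?I. ?b k))"
    unfolding sum_distrib_left[symmetric] sum.distrib by (rule refl)
  also have "\<dots> \<le> (2 * (B * \<bar>a\<bar> / h)) * ((\<bar>a\<bar> / d + 1) + (\<bar>a\<bar> / d + 1))"
    using 1 2 kernel_bound_nonneg h by (intro mult_left_mono add_mono) auto
  also have "\<dots> = 4 * (B * \<bar>a\<bar> / h) * (\<bar>a\<bar> / d + 1)" by simp
  finally show ?thesis .
qed

lemma whp_centred_increments:
  assumes W: "\<And>t. W t \<in> borel_measurable (past t)" and W_sq: "\<And>t. integrable M (\<lambda>\<omega>. (W t \<omega>)\<^sup>2)"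
    and W_le: "\<And>t. expectation (\<lambda>\<omega>. (W t \<omega>)\<^sup>2) \<le> cw"
    and h: "\<And>n. n \<ge> 1 \<Longrightarrow> h n > 0" and lim: "(\<lambda>n. 1 / (sqrt (real n) * h n)) \<longlonglongrightarrow> 0"
    and \<epsilon>: "\<epsilon> > 0" and e: "e > 0" and \<tau>: "\<tau> > 0"
  shows "whp \<tau> (\<lambda>n \<omega>. \<forall>k :: int. \<bar>\<Sum>t=1..int n. centred_increment (h n) (of_int k * (\<epsilon> / sqrt (real n))) (W t \<omega> / sqrt (real n)) (Z t \<omega>)\<bar>
      \<le> e * sqrt (real n))"
proof -
  define H where "H n k z w = centred_increment (h n) (of_int k * (\<epsilon> / sqrt (real n))) (w / sqrt (real n)) z" for n k z w
  define Y where "Y n k \<omega> = (\<Sum>t=1..int n. H n k (Z t \<omega>) (W t \<omega>))" for n k \<omega>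
  define BB where "BB n = (if n = 0 then {} else {\<omega> \<in> space M. \<exists>k. e * sqrt (real n) < \<bar>Y n k \<omega>\<bar>})" for n
  \<comment> \<open>\<open>4 * B\<close> comes from \<open>centred_increment_grid_squares\<close>;
    the other factor bounds the mean of \<open>w\<^sup>2 / \<epsilon> + w\<^sup>2 + 1\<close> at
    \<open>w = W t \<omega>\<close>.\<close>
  define b where "b = 4 * B * (cw / \<epsilon> + cw + 1)"
  have [measurable]: "W t \<in> borel_measurable M" for t by (rule measurable_past[OF W])
  have Hm: "case_prod (H n k) \<in> borel_measurable (borel \<Otimes>\<^sub>M borel)" if "n \<ge> 1" for n k
  proof -
    have [measurable]: "smooth_cdf (h n) \<in> borel_measurable borel"
      by (rule borel_measurable_mono[OF smooth_cdf_mono[OF h[OF that]]])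
    show ?thesis unfolding H_def centred_increment_def by measurable
  qed
  have Hm': "(\<lambda>\<omega>. H n k (Z t \<omega>) (W t \<omega>)) \<in> borel_measurable M" if "n \<ge> 1" for n k t
    using measurable_compose[OF _ Hm[OF that, of k], of "\<lambda>\<omega>. (Z t \<omega>, W t \<omega>)" M] by simp
  have Hb: "(H n k z w)\<^sup>2 \<le> 4" for n k z w
  proof -
    have "\<bar>H n k z w\<bar>\<^sup>2 \<le> 2\<^sup>2" unfolding H_def by (intro power_mono centred_increment_bound2) auto
    then show ?thesis by simp
  qed
  have Hsq: "integrable M (\<lambda>\<omega>. (H n k (Z t \<omega>) (W t \<omega>))\<^sup>2)" if "n \<ge> 1" for n k t
    by (rule integrable_const_bound[of _ 4]) (use Hb Hm'[OF that] in auto)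
  have cent: "(\<integral>z. H n k z w \<partial>P) = 0" for n k w
    unfolding H_def centred_increment_def using P.prob_space
    by (subst Bochner_Integration.integral_diff)
       (auto intro: Bochner_Integration.integrable_diff kernel_int_P_integrable simp: smooth_cdf_diff)
  have [measurable]: "Y n k \<in> borel_measurable M" if "n \<ge> 1" for n k
    unfolding Y_def using Hm'[OF that] by measurable
  have bound: "prob (BB n) \<le> b / e\<^sup>2 * (1 / (sqrt (real n) * h n))" if n: "n \<ge> 1" for n
  proof -
    have hn: "h n > 0" by (rule h[OF n])
    have sn: "sqrt (real n) > 0" using n by simp
    have "(\<Sum>k=-int N..int N. expectation (\<lambda>\<omega>. (Y n k \<omega>)\<^sup>2)) \<le> real n * (b / (sqrt (real n) * h n))" for N
    proof -
      have "(\<Sum>k=-int N..int N. expectation (\<lambda>\<omega>. (Y n k \<omega>)\<^sup>2))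
        = (\<Sum>k=-int N..int N. \<Sum>t=1..int n. expectation (\<lambda>\<omega>. (H n k (Z t \<omega>) (W t \<omega>))\<^sup>2))"
        unfolding Y_def by (intro sum.cong refl expectation_square_sum_innovations[OF Hm[OF n] W cent Hsq[OF n]]) simp
      also have "\<dots> = (\<Sum>t=1..int n. expectation (\<lambda>\<omega>. \<Sum>k=-int N..int N. (H n k (Z t \<omega>) (W t \<omega>))\<^sup>2))"
        by (subst sum.swap) (simp add: Bochner_Integration.integral_sum Hsq[OF n])
      also have "\<dots> \<le> (\<Sum>t=1..int n. b / (sqrt (real n) * h n))"
      proof (rule sum_mono)
        fix t
        let ?q = "4 * B / (sqrt (real n) * h n)"
        have q: "?q \<ge> 0" using kernel_bound_nonneg hn by simp
        \<comment> \<open>Shift and mesh both carry \<open>1 / sqrt n\<close>, so their ratio is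
          free of \<open>n\<close> and the sum over the grid is at most quadratic in
          \<open>w\<close>, which the second moment of \<open>W t\<close> controls.\<close>
        have pt: "(\<Sum>k=-int N..int N. (H n k z w)\<^sup>2) \<le> ?q * (w\<^sup>2 / \<epsilon> + w\<^sup>2 + 1)" for z w
        proof -
          have "(\<Sum>k=-int N..int N. (H n k z w)\<^sup>2) \<le> 4 * (B * \<bar>w / sqrt (real n)\<bar> / h n) * (\<bar>w / sqrt (real n)\<bar> / (\<epsilon> / sqrt (real n)) + 1)"
            unfolding H_def using sn \<epsilon> by (intro centred_increment_grid_squares[OF hn]) auto
          also have "\<dots> = ?q * (\<bar>w\<bar> * (\<bar>w\<bar> / \<epsilon> + 1))" using sn by (simp add: field_simps)
          also have "\<bar>w\<bar> * (\<bar>w\<bar> / \<epsilon> + 1) = w\<^sup>2 / \<epsilon> + \<bar>w\<bar>" by (simp add: algebra_simps power2_eq_square)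
          also have "?q * (w\<^sup>2 / \<epsilon> + \<bar>w\<bar>) \<le> ?q * (w\<^sup>2 / \<epsilon> + w\<^sup>2 + 1)"
            using q zero_le_power2[of "\<bar>w\<bar> - 1"] by (intro mult_left_mono) (simp_all add: power2_diff)
          finally show ?thesis .
        qed
        have "expectation (\<lambda>\<omega>. \<Sum>k=-int N..int N. (H n k (Z t \<omega>) (W t \<omega>))\<^sup>2)
          \<le> expectation (\<lambda>\<omega>. ?q * ((W t \<omega>)\<^sup>2 / \<epsilon> + (W t \<omega>)\<^sup>2 + 1))"
          using W_sq[of t] by (intro integral_mono Bochner_Integration.integrable_sum Hsq[OF n] pt) auto
        also have "\<dots> = ?q * (expectation (\<lambda>\<omega>. (W t \<omega>)\<^sup>2) / \<epsilon> + expectation (\<lambda>\<omega>. (W t \<omega>)\<^sup>2) + 1)"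
          using W_sq[of t] by (simp add: prob_space)
        also have "\<dots> \<le> ?q * (cw / \<epsilon> + cw + 1)"
          using q \<epsilon> W_le[of t] by (intro mult_left_mono add_mono divide_right_mono) auto
        also have "\<dots> = b / (sqrt (real n) * h n)" by (simp add: b_def)
        finally show "expectation (\<lambda>\<omega>. \<Sum>k=-int N..int N. (H n k (Z t \<omega>) (W t \<omega>))\<^sup>2) \<le> b / (sqrt (real n) * h n)" .
      qed
      finally show ?thesis by simp
    qed
    moreover have "integrable M (\<lambda>\<omega>. (Y n k \<omega>)\<^sup>2)" for k
      unfolding Y_def by (intro expectation_square_sum_innovations[OF Hm[OF n] W cent Hsq[OF n]]) simp
    \<comment> \<open>Summed variances of order \<open>n / (sqrt n * h n)\<close> stand against a
      squared threshold of order \<open>n\<close>.\<close>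
    ultimately have "prob {\<omega> \<in> space M. \<exists>k. e * sqrt (real n) < \<bar>Y n k \<omega>\<bar>} \<le> real n * (b / (sqrt (real n) * h n)) / (e * sqrt (real n))\<^sup>2"
      using e sn n by (intro prob_exists_int_le) auto
    also have "\<dots> = b / e\<^sup>2 * (1 / (sqrt (real n) * h n))"
      using n e by (simp add: power_mult_distrib field_simps)
    finally show ?thesis using n by (simp add: BB_def)
  qed
  have ev: "BB n \<in> events" for n
  proof (cases "n = 0")
    case False
    then have "n \<ge> 1" by simp
    then have [measurable]: "Y n k \<in> borel_measurable M" for k by simp
    show ?thesis using False unfolding BB_def by simp
  qed (simp add: BB_def)
  have "(\<lambda>n. b / e\<^sup>2 * (1 / (sqrt (real n) * h n))) \<longlonglongrightarrow> b / e\<^sup>2 * 0"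
    by (rule tendsto_mult_left[OF lim])
  then have "\<forall>\<^sub>F n in sequentially. b / e\<^sup>2 * (1 / (sqrt (real n) * h n)) < \<tau>"
    using \<tau> by (intro order_tendstoD(2)) auto
  then have "\<forall>\<^sub>F n in sequentially. prob (BB n) \<le> \<tau> \<and> (AE \<omega> in M. \<omega> \<notin> BB n \<longrightarrow> (\<forall>k. \<bar>Y n k \<omega>\<bar> \<le> e * sqrt (real n)))"
    using eventually_ge_at_top[of 1]
  proof eventually_elim
    case (elim n)
    then have "prob (BB n) \<le> \<tau>" using bound[of n] by simp
    moreover have "AE \<omega> in M. \<omega> \<notin> BB n \<longrightarrow> (\<forall>k. \<bar>Y n k \<omega>\<bar> \<le> e * sqrt (real n))"
      using elim by (intro AE_I2) (auto simp: BB_def not_less)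
    ultimately show ?case by blast
  qed
  then show ?thesis unfolding whp_def Y_def H_def using ev by blast
qed

end

end

section \<open>Comparison of the two estimators\<close>

text \<open>Lets sums of squares control the Hoelder remainders of the expansion.\<close>

lemma powr_le_one_plus_square:
  fixes v \<beta> :: real
  assumes "0 < \<beta>" "\<beta> \<le> 1"
  shows "\<bar>v\<bar> powr (1 + \<beta>) \<le> 1 + v\<^sup>2"
proof (cases "\<bar>v\<bar> \<le> 1")
  case True
  then have "\<bar>v\<bar> powr (1 + \<beta>) \<le> 1" using assms by (intro powr_le1) auto
  then show ?thesis by (simp add: add_increasing2)
next
  case False
  then have "\<bar>v\<bar> powr (1 + \<beta>) \<le> \<bar>v\<bar> powr 2" using assms by (intro powr_mono) auto
  also have "\<dots> = v\<^sup>2" using False by (simp add: powr_numeral)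
  finally show ?thesis by simp
qed

context iid_space
begin

context
  fixes K :: "real \<Rightarrow> real" and B :: real
  assumes kernel: "symmetric_kernel K" and K_le: "\<And>u. K u \<le> B"
begin

text \<open>Each increment is a centred part plus the linear term of \<open>smooth_cdf\<close> plus
  its Taylor remainder. The linear terms share one slope, so only the sum of the \<open>V t\<close>
  counts, with its cancellations; the remainders are controlled by the sum of squares.\<close>

lemma grid_increment_bound:
  assumes n: "n \<ge> 1" and \<beta>: "0 < \<beta>" "\<beta> \<le> 1" and H: "H \<ge> 0"
    and taylor: "\<exists>s. 0 \<le> s \<and> s \<le> C \<and> (\<forall>a. \<bar>smooth_cdf K h (x + a) - smooth_cdf K h x - a * s\<bar> \<le> H * \<bar>a\<bar> powr (1 + \<beta>))"
    and inc: "\<bar>\<Sum>t=1..int n. centred_increment K h x (V t / sqrt (real n)) (\<zeta> t)\<bar> \<le> a * sqrt (real n)"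
    and b: "\<bar>\<Sum>t=1..int n. V t\<bar> \<le> b * real n" and q: "(\<Sum>t=1..int n. (V t)\<^sup>2) \<le> q * real n"
  shows "\<bar>\<Sum>t=1..int n. kernel_int K ((x + V t / sqrt (real n) - \<zeta> t) / h) - kernel_int K ((x - \<zeta> t) / h)\<bar>
     \<le> sqrt (real n) * (a + C * b + H * (1 / sqrt (real n)) powr \<beta> * (1 + q))"
proof -
  define r where "r = 1 / sqrt (real n)"
  have r: "r > 0" and rn: "r * real n = sqrt (real n)" using n by (auto simp: r_def real_div_sqrt)
  obtain s where s: "0 \<le> s" "s \<le> C" and tay: "\<And>a. \<bar>smooth_cdf K h (x + a) - smooth_cdf K h x - a * s\<bar> \<le> H * \<bar>a\<bar> powr (1 + \<beta>)"
    using taylor by blast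
  let ?I = "{1..int n}"
  let ?R = "\<lambda>t. smooth_cdf K h (x + r * V t) - smooth_cdf K h x - r * V t * s"
  have R: "\<bar>?R t\<bar> \<le> H * r powr (1 + \<beta>) * (1 + (V t)\<^sup>2)" for t
  proof -
    have "\<bar>?R t\<bar> \<le> H * \<bar>r * V t\<bar> powr (1 + \<beta>)" by (rule tay)
    also have "\<bar>r * V t\<bar> powr (1 + \<beta>) = r powr (1 + \<beta>) * \<bar>V t\<bar> powr (1 + \<beta>)"
      using r by (simp add: abs_mult powr_mult)
    also have "H * (r powr (1 + \<beta>) * \<bar>V t\<bar> powr (1 + \<beta>)) \<le> H * (r powr (1 + \<beta>) * (1 + (V t)\<^sup>2))"
      using H \<beta> by (intro mult_left_mono powr_le_one_plus_square) auto
    finally show ?thesis by (simp add: mult.assoc)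
  qed
  have "\<bar>\<Sum>t\<in>?I. ?R t\<bar> \<le> (\<Sum>t\<in>?I. H * r powr (1 + \<beta>) * (1 + (V t)\<^sup>2))"
    by (rule order_trans[OF sum_abs sum_mono]) (rule R)
  also have "\<dots> = H * r powr (1 + \<beta>) * (real n + (\<Sum>t\<in>?I. (V t)\<^sup>2))"
    by (simp add: sum_distrib_left[symmetric] sum.distrib)
  also have "\<dots> \<le> H * r powr (1 + \<beta>) * (real n + q * real n)"
    using H q by (intro mult_left_mono add_left_mono) auto
  also have "\<dots> = sqrt (real n) * (H * r powr \<beta> * (1 + q))"
    unfolding rn[symmetric] using r by (simp add: powr_add algebra_simps)
  finally have 1: "\<bar>\<Sum>t\<in>?I. ?R t\<bar> \<le> sqrt (real n) * (H * r powr \<beta> * (1 + q))" .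
  have "\<bar>\<Sum>t\<in>?I. r * V t * s\<bar> = s * (r * \<bar>\<Sum>t\<in>?I. V t\<bar>)"
    using s r by (simp add: sum_distrib_left[symmetric] sum_distrib_right[symmetric] abs_mult)
  also have "\<dots> \<le> C * (r * (b * real n))"
    using s r b by (intro mult_mono) auto
  also have "\<dots> = sqrt (real n) * (C * b)" unfolding rn[symmetric] by (simp add: mult_ac)
  finally have 2: "\<bar>\<Sum>t\<in>?I. r * V t * s\<bar> \<le> sqrt (real n) * (C * b)" .
  have 3: "\<bar>\<Sum>t\<in>?I. centred_increment K h x (r * V t) (\<zeta> t)\<bar> \<le> sqrt (real n) * a"
    using inc by (simp add: r_def mult.commute)
  have "(\<Sum>t\<in>?I. kernel_int K ((x + r * V t - \<zeta> t) / h) - kernel_int K ((x - \<zeta> t) / h))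
     = (\<Sum>t\<in>?I. centred_increment K h x (r * V t) (\<zeta> t) + r * V t * s + ?R t)"
    by (intro sum.cong refl) (simp add: centred_increment_def[OF kernel K_le])
  also have "\<dots> = (\<Sum>t\<in>?I. centred_increment K h x (r * V t) (\<zeta> t)) + (\<Sum>t\<in>?I. r * V t * s) + (\<Sum>t\<in>?I. ?R t)"
    by (simp only: sum.distrib)
  finally have "\<bar>\<Sum>t\<in>?I. kernel_int K ((x + r * V t - \<zeta> t) / h) - kernel_int K ((x - \<zeta> t) / h)\<bar>
     \<le> sqrt (real n) * a + sqrt (real n) * (C * b) + sqrt (real n) * (H * r powr \<beta> * (1 + q))"
    using 1 2 3 by linarith
  then show ?thesis by (simp add: r_def algebra_simps)
qed

text \<open>Monotonicity of the smoothed indicator traps \<open>z\<close> between two neighbouring grid points and the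
  perturbation between two past-measurable bounds, so that only countably many sums have to be controlled.\<close>

lemma kernel_cdf_sandwich:
  assumes n: "n \<ge> 1" and h: "h > 0" and \<epsilon>: "\<epsilon> > 0" and \<beta>: "0 < \<beta>" "\<beta> \<le> 1" and H: "H \<ge> 0"
    and taylor: "\<And>x. \<exists>s. 0 \<le> s \<and> s \<le> C \<and> (\<forall>a. \<bar>smooth_cdf K h (x + a) - smooth_cdf K h x - a * s\<bar> \<le> H * \<bar>a\<bar> powr (1 + \<beta>))"
    and up: "\<And>t. t \<in> {1..int n} \<Longrightarrow> \<zeta> t - (V 1 t - \<epsilon>) / sqrt (real n) \<le> e t"
    and lo: "\<And>t. t \<in> {1..int n} \<Longrightarrow> e t \<le> \<zeta> t - (V (- 1) t + \<epsilon>) / sqrt (real n)"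
    and inc: "\<And>\<sigma> k. \<sigma> \<in> {1, - 1 :: real} \<Longrightarrow>
      \<bar>\<Sum>t=1..int n. centred_increment K h (of_int k * (\<epsilon> / sqrt (real n))) (V \<sigma> t / sqrt (real n)) (\<zeta> t)\<bar> \<le> a * sqrt (real n)"
    and b: "\<And>\<sigma>. \<sigma> \<in> {1, - 1} \<Longrightarrow> \<bar>\<Sum>t=1..int n. V \<sigma> t\<bar> \<le> b * real n"
    and q: "\<And>\<sigma>. \<sigma> \<in> {1, - 1} \<Longrightarrow> (\<Sum>t=1..int n. (V \<sigma> t)\<^sup>2) \<le> q * real n"
  shows "\<bar>kernel_cdf K h n e z - kernel_cdf K h n \<zeta> z\<bar> \<le> (a + C * b + H * (1 / sqrt (real n)) powr \<beta> * (1 + q)) / sqrt (real n)"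
proof -
  define s where "s = sqrt (real n)"
  have s: "s > 0" "s * s = real n" using n by (auto simp: s_def)
  define d where "d = \<epsilon> / s"
  have d: "d > 0" using \<epsilon> s by (simp add: d_def)
  define k where "k = \<lfloor>z / d\<rfloor>"
  have k1: "of_int k * d \<le> z" using d by (simp add: k_def pos_le_divide_eq[symmetric])
  have k2: "z \<le> of_int (k + 1) * d"
  proof -
    have "z / d \<le> of_int (k + 1)" unfolding k_def by linarith
    then show ?thesis using d by (simp add: pos_divide_le_eq)
  qed
  let ?G = "\<lambda>y. kernel_int K (y / h)" and ?I = "{1..int n}"
  let ?L = "a + C * b + H * (1 / sqrt (real n)) powr \<beta> * (1 + q)"
  have Gmono: "?G x \<le> ?G y" if "x \<le> y" for x y
    using h that by (intro monoD[OF kernel_int_mono[OF kernel]] divide_right_mono) auto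
  let ?inc = "\<lambda>k \<sigma> t. ?G (of_int k * d + V \<sigma> t / s - \<zeta> t) - ?G (of_int k * d - \<zeta> t)" and ?df = "\<lambda>t. ?G (z - e t) - ?G (z - \<zeta> t)"
  have T: "\<bar>\<Sum>t\<in>?I. ?inc k \<sigma> t\<bar> \<le> s * ?L" if "\<sigma> \<in> {1, - 1}" for \<sigma> k
    unfolding s_def d_def by (rule grid_increment_bound[OF n \<beta> H taylor inc[OF that] b[OF that] q[OF that]])
  \<comment> \<open>Rounding \<open>z\<close> up to grid point \<open>k + 1\<close> costs one mesh
    width \<open>\<epsilon> / s\<close>, exactly the amount reserved in \<open>up\<close>. What
    results is an increment starting at grid point \<open>k\<close>, which also bounds the
    subtracted term because \<open>z\<close> is rounded down there.\<close>
  have "(\<Sum>t\<in>?I. ?df t) \<le> (\<Sum>t\<in>?I. ?inc k 1 t)"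
  proof (rule sum_mono)
    fix t assume t: "t \<in> ?I"
    have "z - e t \<le> of_int (k + 1) * d - (\<zeta> t - (V 1 t - \<epsilon>) / s)" using k2 up[OF t] by (simp add: s_def)
    also have "\<dots> = of_int k * d + V 1 t / s - \<zeta> t" by (simp add: d_def algebra_simps diff_divide_distrib)
    finally have "?G (z - e t) \<le> ?G (of_int k * d + V 1 t / s - \<zeta> t)" by (rule Gmono)
    moreover have "?G (of_int k * d - \<zeta> t) \<le> ?G (z - \<zeta> t)" using k1 by (intro Gmono) simp
    ultimately show "?df t \<le> ?inc k 1 t" by linarith
  qed
  then have U: "(\<Sum>t\<in>?I. ?df t) \<le> s * ?L" using T[of 1 k] by auto
  \<comment> \<open>Now \<open>z\<close> is rounded down in the first term and up in the subtracted
    one, so the increment starts at \<open>k + 1\<close>.\<close>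
  have "(\<Sum>t\<in>?I. ?inc (k + 1) (- 1) t) \<le> (\<Sum>t\<in>?I. ?df t)"
  proof (rule sum_mono)
    fix t assume t: "t \<in> ?I"
    have "of_int (k + 1) * d + V (- 1) t / s - \<zeta> t = of_int k * d - (\<zeta> t - (V (- 1) t + \<epsilon>) / s)"
      by (simp add: d_def algebra_simps add_divide_distrib)
    also have "\<dots> \<le> z - e t" using k1 lo[OF t] by (simp add: s_def)
    finally have "?G (of_int (k + 1) * d + V (- 1) t / s - \<zeta> t) \<le> ?G (z - e t)" by (rule Gmono)
    moreover have "?G (z - \<zeta> t) \<le> ?G (of_int (k + 1) * d - \<zeta> t)" using k2 by (intro Gmono) simp
    ultimately show "?inc (k + 1) (- 1) t \<le> ?df t" by linarith
  qed
  then have L: "- (s * ?L) \<le> (\<Sum>t\<in>?I. ?df t)" using T[of "- 1" "k + 1"] by auto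
  have "kernel_cdf K h n e z - kernel_cdf K h n \<zeta> z = (\<Sum>t\<in>?I. ?df t) / real n"
    by (simp add: kernel_cdf_eq[OF kernel h] sum_subtractf diff_divide_distrib)
  then have "\<bar>kernel_cdf K h n e z - kernel_cdf K h n \<zeta> z\<bar> \<le> (s * ?L) / real n"
    using U L n by (simp add: divide_right_mono abs_le_iff)
  also have "\<dots> = ?L / s" using s by (simp flip: s(2))
  finally show ?thesis by (simp add: s_def)
qed

end

end

section \<open>Bracketing the residual shift by functions of the past\<close>

context ar_space
begin

text \<open>An upper bound for \<open>\<sigma> = 1\<close> and a lower bound for
  \<open>\<sigma> = - 1\<close> of the negative residual error scaled by \<open>sqrt n\<close>. The
  first \<open>\<epsilon>\<close> pays for the mesh of the \<open>z\<close> grid, the second for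
  rounding each scaled coefficient error to \<open>\<theta> i\<close>.\<close>

definition bracket :: "real \<Rightarrow> (nat \<Rightarrow> real) \<Rightarrow> real \<Rightarrow> int \<Rightarrow> 'a \<Rightarrow> real" where
  "bracket \<epsilon> \<theta> \<sigma> t \<omega> = \<sigma> * (\<epsilon> + \<epsilon> * (\<Sum>i=1..p. \<bar>X (t - int i) \<omega>\<bar>)) - regress p \<theta> (\<lambda>s. X s \<omega>) t"

lemma bracket_past: "bracket \<epsilon> \<theta> \<sigma> t \<in> borel_measurable (past t)"
proof -
  have [measurable]: "X (t - int i) \<in> borel_measurable (past t)" if "i \<in> {1..p}" for i
    using that by (intro X_lag_past) auto
  show ?thesis unfolding bracket_def regress_def by measurable
qed

lemma bracket_square:
  assumes \<epsilon>: "0 \<le> \<epsilon>" and \<theta>: "\<And>i. i \<in> {1..p} \<Longrightarrow> \<bar>\<theta> i\<bar> \<le> T" and \<sigma>: "\<sigma> \<in> {1, - 1}"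
  shows "(bracket \<epsilon> \<theta> \<sigma> t \<omega>)\<^sup>2 \<le> 2 * \<epsilon>\<^sup>2 + 2 * (\<epsilon> + T)\<^sup>2 * real p * (\<Sum>i=1..p. (X (t - int i) \<omega>)\<^sup>2)"
proof -
  let ?y = "\<Sum>i=1..p. \<bar>X (t - int i) \<omega>\<bar>"
  have T: "0 \<le> T" using \<theta>[of 1] p by fastforce
  have y: "0 \<le> ?y" by (simp add: sum_nonneg)
  have "\<bar>regress p \<theta> (\<lambda>s. X s \<omega>) t\<bar> \<le> (\<Sum>i=1..p. \<bar>\<theta> i * X (t - int i) \<omega>\<bar>)" unfolding regress_def by (rule sum_abs)
  also have "\<dots> \<le> (\<Sum>i=1..p. T * \<bar>X (t - int i) \<omega>\<bar>)"
    using \<theta> by (intro sum_mono) (auto simp: abs_mult intro!: mult_right_mono)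
  finally have "\<bar>regress p \<theta> (\<lambda>s. X s \<omega>) t\<bar> \<le> T * ?y" by (simp add: sum_distrib_left)
  moreover have "\<bar>\<sigma> * (\<epsilon> + \<epsilon> * ?y)\<bar> = \<epsilon> + \<epsilon> * ?y" using \<sigma> \<epsilon> y by (auto simp: abs_mult)
  ultimately have "\<bar>bracket \<epsilon> \<theta> \<sigma> t \<omega>\<bar> \<le> \<epsilon> + (\<epsilon> + T) * ?y"
    unfolding bracket_def by (simp add: algebra_simps)
  then have "\<bar>bracket \<epsilon> \<theta> \<sigma> t \<omega>\<bar>\<^sup>2 \<le> (\<epsilon> + (\<epsilon> + T) * ?y)\<^sup>2" by (intro power_mono) auto
  also have "\<dots> \<le> 2 * \<epsilon>\<^sup>2 + 2 * ((\<epsilon> + T) * ?y)\<^sup>2"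
    using zero_le_power2[of "\<epsilon> - (\<epsilon> + T) * ?y"] by (simp add: power2_sum power2_diff)
  also have "\<dots> = 2 * \<epsilon>\<^sup>2 + 2 * (\<epsilon> + T)\<^sup>2 * ?y\<^sup>2" by (simp add: power_mult_distrib)
  also have "?y\<^sup>2 \<le> real p * (\<Sum>i=1..p. (X (t - int i) \<omega>)\<^sup>2)"
    using sum_squared_le_sum_of_squares[of "\<lambda>i. \<bar>X (t - int i) \<omega>\<bar>" "{1..p}"] by (simp add: mult.commute)
  finally show ?thesis by (simp add: mult_left_mono mult.assoc)
qed

lemma bracket_moment:
  assumes "0 \<le> \<epsilon>" "\<And>i. i \<in> {1..p} \<Longrightarrow> \<bar>\<theta> i\<bar> \<le> T" "\<sigma> \<in> {1, - 1}"
  shows "integrable M (\<lambda>\<omega>. (bracket \<epsilon> \<theta> \<sigma> t \<omega>)\<^sup>2)"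
    and "expectation (\<lambda>\<omega>. (bracket \<epsilon> \<theta> \<sigma> t \<omega>)\<^sup>2) \<le> 2 * \<epsilon>\<^sup>2 + 2 * (\<epsilon> + T)\<^sup>2 * real p * (real p * c)"
proof -
  let ?u = "\<lambda>\<omega>. 2 * \<epsilon>\<^sup>2 + 2 * (\<epsilon> + T)\<^sup>2 * real p * (\<Sum>i=1..p. (X (t - int i) \<omega>)\<^sup>2)"
  have [measurable]: "bracket \<epsilon> \<theta> \<sigma> t \<in> borel_measurable M" by (rule measurable_past[OF bracket_past])
  have u: "integrable M ?u" using X_sq by auto
  show i: "integrable M (\<lambda>\<omega>. (bracket \<epsilon> \<theta> \<sigma> t \<omega>)\<^sup>2)"
  proof (rule Bochner_Integration.integrable_bound[OF u])
    show "AE \<omega> in M. norm ((bracket \<epsilon> \<theta> \<sigma> t \<omega>)\<^sup>2) \<le> norm (?u \<omega>)"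
      by (intro AE_I2) (use bracket_square[OF assms, where t=t] in \<open>auto intro: order_trans[OF _ abs_ge_self]\<close>)
  qed measurable
  have "expectation (\<lambda>\<omega>. (bracket \<epsilon> \<theta> \<sigma> t \<omega>)\<^sup>2) \<le> expectation ?u"
    by (intro integral_mono i u bracket_square assms)
  also have "\<dots> = 2 * \<epsilon>\<^sup>2 + 2 * (\<epsilon> + T)\<^sup>2 * real p * (\<Sum>i=1..p. expectation (\<lambda>\<omega>. (X (t - int i) \<omega>)\<^sup>2))"
    using X_sq by (simp add: prob_space Bochner_Integration.integral_sum)
  also have "\<dots> \<le> 2 * \<epsilon>\<^sup>2 + 2 * (\<epsilon> + T)\<^sup>2 * real p * (\<Sum>i=1..p. c)"
    by (intro add_left_mono mult_left_mono sum_mono X_le) auto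
  finally show "expectation (\<lambda>\<omega>. (bracket \<epsilon> \<theta> \<sigma> t \<omega>)\<^sup>2) \<le> 2 * \<epsilon>\<^sup>2 + 2 * (\<epsilon> + T)\<^sup>2 * real p * (real p * c)" by simp
qed

text \<open>The \<open>regress\<close> part is small through cancellation in the averages of the
  observations. The slack has no cancellation; it is estimated by absolute values and is small only
  through the factor \<open>\<epsilon>\<close>.\<close>

lemma bracket_sum_bound:
  assumes \<epsilon>: "0 \<le> \<epsilon>" and \<theta>: "\<And>i. i \<in> {1..p} \<Longrightarrow> \<bar>\<theta> i\<bar> \<le> T" and \<sigma>: "\<sigma> \<in> {1, - 1}" and n: "n \<ge> 1" and e: "0 \<le> e"
    and sq: "(\<Sum>t=1..int n. \<Sum>i=1..p. (X (t - int i) \<omega>)\<^sup>2) / real n \<le> C2"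
    and mean: "\<And>i. i \<in> {1..p} \<Longrightarrow> \<bar>\<Sum>t=1..int n. X (t - int i) \<omega>\<bar> \<le> e * real n"
  shows "\<bar>\<Sum>t=1..int n. bracket \<epsilon> \<theta> \<sigma> t \<omega>\<bar> \<le> (\<epsilon> * (1 + real p + C2) + real p * T * e) * real n"
proof -
  have sq': "(\<Sum>t=1..int n. \<Sum>i=1..p. (X (t - int i) \<omega>)\<^sup>2) \<le> C2 * real n" using sq n by (simp add: field_simps)
  let ?Y = "\<Sum>t=1..int n. \<Sum>i=1..p. \<bar>X (t - int i) \<omega>\<bar>"
  have "?Y \<le> (\<Sum>t=1..int n. \<Sum>i=1..p. 1 + (X (t - int i) \<omega>)\<^sup>2)"
    by (intro sum_mono abs_le_one_plus_square)
  also have "\<dots> \<le> (real p + C2) * real n" using sq' by (simp add: sum.distrib algebra_simps)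
  finally have Y: "?Y \<le> (real p + C2) * real n" .
  have Y0: "0 \<le> ?Y" by (simp add: sum_nonneg)
  have "(\<Sum>t=1..int n. regress p \<theta> (\<lambda>s. X s \<omega>) t) = (\<Sum>i=1..p. \<theta> i * (\<Sum>t=1..int n. X (t - int i) \<omega>))"
    unfolding regress_def by (subst sum.swap) (simp add: sum_distrib_left)
  also have "\<bar>\<dots>\<bar> \<le> norm1 p \<theta> * (e * real n)" by (rule abs_sum_le_norm1[OF mean])
  also have "\<dots> \<le> (real p * T) * (e * real n)"
  proof (rule mult_right_mono)
    show "norm1 p \<theta> \<le> real p * T" unfolding norm1_def using sum_bounded_above[of "{1..p}" "\<lambda>i. \<bar>\<theta> i\<bar>" T] \<theta> by simp
  qed (use e in simp)
  finally have R: "\<bar>\<Sum>t=1..int n. regress p \<theta> (\<lambda>s. X s \<omega>) t\<bar> \<le> (real p * T) * (e * real n)" .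
  have "(\<Sum>t=1..int n. bracket \<epsilon> \<theta> \<sigma> t \<omega>) = \<sigma> * (\<epsilon> * real n + \<epsilon> * ?Y) - (\<Sum>t=1..int n. regress p \<theta> (\<lambda>s. X s \<omega>) t)"
    unfolding bracket_def by (simp add: sum_subtractf sum.distrib sum_distrib_left algebra_simps)
  moreover have "\<bar>\<sigma> * (\<epsilon> * real n + \<epsilon> * ?Y)\<bar> \<le> \<epsilon> * real n + \<epsilon> * ((real p + C2) * real n)"
    using \<sigma> \<epsilon> Y Y0 mult_left_mono[OF Y \<epsilon>] by (auto simp: abs_mult)
  ultimately have "\<bar>\<Sum>t=1..int n. bracket \<epsilon> \<theta> \<sigma> t \<omega>\<bar> \<le> \<epsilon> * real n + \<epsilon> * ((real p + C2) * real n) + (real p * T) * (e * real n)"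
    using R by linarith
  then show ?thesis by (simp add: algebra_simps)
qed

text \<open>The order of choices matters: the stochastic bounds \<open>C1\<close> and
  \<open>C2\<close> first, then \<open>\<epsilon>\<close> depending on \<open>C2\<close>, then the
  finite set \<open>\<Theta>\<close> and the precision \<open>e\<close> of the averages. The error
  \<open>E\<close> is spent in four quarters: fluctuation, slack, drift and Taylor
  remainder.\<close>

lemma whp_kernel_cdf_diff:
  assumes kernel: "symmetric_kernel K" and K_le: "\<And>u. K u \<le> B"
    and h: "\<And>n. n \<ge> 1 \<Longrightarrow> h n > 0" and lim: "(\<lambda>n. 1 / (sqrt (real n) * h n)) \<longlonglongrightarrow> 0"
    and \<beta>: "0 < \<beta>" "\<beta> \<le> 1" and H: "H \<ge> 0" and C: "C > 0"
    and taylor: "\<And>h x. h > 0 \<Longrightarrow> \<exists>s. 0 \<le> s \<and> s \<le> C \<and> (\<forall>a. \<bar>smooth_cdf K h (x + a) - smooth_cdf K h x - a * s\<bar> \<le> H * \<bar>a\<bar> powr (1 + \<beta>))"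
    and E: "E > 0" and \<tau>: "\<tau> > 0"
  shows "whp \<tau> (\<lambda>n \<omega>. \<forall>z. \<bar>kernel_cdf K (h n) n (yw_residual p n (\<lambda>t. X t \<omega>)) z
             - kernel_cdf K (h n) n (\<lambda>t. Z t \<omega>) z\<bar> \<le> E / sqrt (real n))"
proof -
  let ?\<tau> = "\<tau> / 4"
  have \<tau>': "?\<tau> > 0" using \<tau> by simp
  let ?\<delta> = "\<lambda>n \<omega> i. \<phi> i - vec_index (yule_walker p n (\<lambda>s. X s \<omega>)) (i - 1)"
  obtain C1' where C1': "whp ?\<tau> (\<lambda>n \<omega>. sqrt (real n) * norm1 p (?\<delta> n \<omega>) \<le> C1')"
    using whp_yule_walker_tight[OF \<tau>'] by blast
  obtain C2' where C2': "whp ?\<tau> (\<lambda>n \<omega>. (\<Sum>t=1..int n. \<Sum>i=1..p. (X (t - int i) \<omega>)\<^sup>2) / real n \<le> C2')"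
    using whp_regressors_tight[OF \<tau>'] by blast
  define C1 where "C1 = \<bar>C1'\<bar>"
  define C2 where "C2 = \<bar>C2'\<bar>"
  have C12: "0 \<le> C1" "0 \<le> C2" "C1' \<le> C1" "C2' \<le> C2" by (auto simp: C1_def C2_def)
  define T where "T = C1 + 2"
  define \<epsilon> where "\<epsilon> = min 1 (E / (4 * C * (1 + real p + C2)))"
  have pos: "4 * C * (1 + real p + C2) > 0" using C C12 by simp
  have \<epsilon>: "0 < \<epsilon>" "\<epsilon> \<le> 1" using E pos by (auto simp: \<epsilon>_def)
  have \<epsilon>E: "C * (\<epsilon> * (1 + real p + C2)) \<le> E / 4"
  proof -
    have "\<epsilon> \<le> E / (4 * C * (1 + real p + C2))" by (simp add: \<epsilon>_def)
    then have "\<epsilon> * (4 * C * (1 + real p + C2)) \<le> E" by (simp only: pos_le_divide_eq[OF pos])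
    then show ?thesis by (simp add: mult_ac)
  qed
  define e where "e = E / (4 * C * (real p * T + 1))"
  have pT: "0 \<le> real p * T" using C12 by (simp add: T_def)
  have e: "0 < e" using E C pT by (simp add: e_def)
  have eE: "C * (real p * T * e) \<le> E / 4"
  proof -
    have "C * (real p * T * e) \<le> C * ((real p * T + 1) * e)" using C e by (intro mult_left_mono mult_right_mono) auto
    also have "\<dots> = E / 4" using C pT by (simp add: e_def field_simps add_nonneg_eq_0_iff)
    finally show ?thesis .
  qed
  define q where "q = 2 * \<epsilon>\<^sup>2 + 2 * (\<epsilon> + T)\<^sup>2 * real p * C2"
  \<comment> \<open>Multiples of \<open>\<epsilon>\<close> by integers up to \<open>N\<close>
    contain the rounding of every number of absolute value at most \<open>C1\<close>. The 1 leaves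
    room for the floor, and \<open>\<epsilon> \<le> 1\<close> gives the bound
    \<open>T = C1 + 2\<close>.\<close>
  define N where "N = \<lceil>C1 / \<epsilon>\<rceil> + 1"
  \<comment> \<open>\<open>PiE\<close> makes the set finite; the values of \<open>\<theta>\<close>
    outside \<open>{1..p}\<close> are never read by \<open>regress\<close>.\<close>
  define \<Theta> where "\<Theta> = (\<lambda>g i. \<epsilon> * of_int (g i)) ` (PiE {1..p} (\<lambda>_. {- N..N}))"
  have fin: "finite (\<Theta> \<times> {1, - 1 :: real})" unfolding \<Theta>_def by (intro finite_SigmaI finite_imageI finite_PiE) auto
  have N: "\<epsilon> * of_int N \<le> T"
  proof -
    have "of_int N \<le> C1 / \<epsilon> + 2" unfolding N_def by linarith
    then have "\<epsilon> * of_int N \<le> \<epsilon> * (C1 / \<epsilon> + 2)" using \<epsilon> by (intro mult_left_mono) auto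
    also have "\<dots> = C1 + 2 * \<epsilon>" using \<epsilon> by (simp add: distrib_left)
    finally show ?thesis using \<epsilon> by (simp add: T_def)
  qed
  have \<Theta>: "\<bar>\<theta> i\<bar> \<le> T" if th: "\<theta> \<in> \<Theta>" and i: "i \<in> {1..p}" for \<theta> i
  proof -
    obtain g where g: "g \<in> PiE {1..p} (\<lambda>_. {- N..N})" "\<theta> = (\<lambda>i. \<epsilon> * of_int (g i))" using th unfolding \<Theta>_def by blast
    have "\<bar>g i\<bar> \<le> N" using PiE_mem[OF g(1) i] by auto
    then have "\<bar>real_of_int (g i)\<bar> \<le> of_int N" by linarith
    then have "\<epsilon> * \<bar>real_of_int (g i)\<bar> \<le> \<epsilon> * of_int N" using \<epsilon> by (intro mult_left_mono) auto
    moreover have "\<bar>\<theta> i\<bar> = \<epsilon> * \<bar>real_of_int (g i)\<bar>" using \<epsilon> by (simp add: g(2) abs_mult)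
    ultimately show ?thesis using N by linarith
  qed
  let ?inc = "\<lambda>n \<omega> \<theta>\<sigma>. \<forall>k :: int.
     \<bar>\<Sum>t=1..int n. centred_increment K (h n) (of_int k * (\<epsilon> / sqrt (real n))) (bracket \<epsilon> (fst \<theta>\<sigma>) (snd \<theta>\<sigma>) t \<omega> / sqrt (real n)) (Z t \<omega>)\<bar>
       \<le> (E / 4) * sqrt (real n)"
  have w3: "whp ?\<tau> (\<lambda>n \<omega>. \<forall>\<theta>\<sigma>\<in>\<Theta> \<times> {1, - 1}. ?inc n \<omega> \<theta>\<sigma>)"
  proof (rule whp_ball[OF fin _ \<tau>'])
    fix \<theta>\<sigma> and \<tau>'' :: real assume i: "\<theta>\<sigma> \<in> \<Theta> \<times> {1, - 1 :: real}" and \<tau>'': "\<tau>'' > 0"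
    then have th: "\<And>i. i \<in> {1..p} \<Longrightarrow> \<bar>fst \<theta>\<sigma> i\<bar> \<le> T" "snd \<theta>\<sigma> \<in> {1, - 1}" using \<Theta> by auto
    show "whp \<tau>'' (\<lambda>n \<omega>. ?inc n \<omega> \<theta>\<sigma>)"
      using \<epsilon> E by (intro whp_centred_increments[OF kernel K_le bracket_past bracket_moment(1)[OF _ th] bracket_moment(2)[OF _ th] h lim _ _ \<tau>'']) auto
  qed
  have w4: "whp ?\<tau> (\<lambda>n \<omega>. \<forall>i\<in>{1..p}. \<bar>\<Sum>t=1..int n. X (t - int i) \<omega>\<bar> \<le> e * real n)"
    by (rule whp_lagged_mean[OF e \<tau>'])
  have "(\<lambda>n. H * (1 / sqrt (real n)) powr \<beta> * (1 + q)) \<longlonglongrightarrow> H * 0 * (1 + q)"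
  proof (intro tendsto_mult tendsto_const)
    from tendsto_powr'[OF inverse_sqrt_tendsto_0[of 1] tendsto_const, of \<beta>] \<beta> show "(\<lambda>n. (1 / sqrt (real n)) powr \<beta>) \<longlonglongrightarrow> 0" by simp
  qed
  then have ev: "\<forall>\<^sub>F n in sequentially. H * (1 / sqrt (real n)) powr \<beta> * (1 + q) < E / 4"
    using E by (intro order_tendstoD(2)) auto
  let ?good = "\<lambda>n \<omega>. sqrt (real n) * norm1 p (?\<delta> n \<omega>) \<le> C1'
    \<and> (\<Sum>t=1..int n. \<Sum>i=1..p. (X (t - int i) \<omega>)\<^sup>2) / real n \<le> C2'
    \<and> (\<forall>\<theta>\<sigma>\<in>\<Theta> \<times> {1, - 1}. ?inc n \<omega> \<theta>\<sigma>)
    \<and> (\<forall>i\<in>{1..p}. \<bar>\<Sum>t=1..int n. X (t - int i) \<omega>\<bar> \<le> e * real n)"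
  let ?D = "\<lambda>n \<omega> z. \<bar>kernel_cdf K (h n) n (yw_residual p n (\<lambda>t. X t \<omega>)) z - kernel_cdf K (h n) n (\<lambda>t. Z t \<omega>) z\<bar>"
  have w: "whp \<tau> (\<lambda>n \<omega>. ?good n \<omega>)"
    using whp_conj[OF C1' whp_conj[OF C2' whp_conj[OF w3 w4]]] by simp
  show ?thesis
  proof (rule whp_mono[OF w])
    show "\<forall>\<^sub>F n in sequentially. AE \<omega> in M. ?good n \<omega> \<longrightarrow> (\<forall>z. ?D n \<omega> z \<le> E / sqrt (real n))"
      using ev eventually_ge_at_top[of 1]
    proof eventually_elim
      case (elim n)
      note small = elim(1) and n = elim(2)
      let ?s = "sqrt (real n)"
      have s: "?s > 0" using n by simp
      show ?case using ar
      proof (eventually_elim, intro impI allI, elim conjE)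
        fix \<omega> z
        assume x: "\<forall>t. X t \<omega> = regress p \<phi> (\<lambda>s. X s \<omega>) t + Z t \<omega>"
          and h1: "?s * norm1 p (?\<delta> n \<omega>) \<le> C1'"
          and h2: "(\<Sum>t=1..int n. \<Sum>i=1..p. (X (t - int i) \<omega>)\<^sup>2) / real n \<le> C2'"
          and h3: "\<forall>\<theta>\<sigma>\<in>\<Theta> \<times> {1, - 1}. ?inc n \<omega> \<theta>\<sigma>"
          and h4: "\<forall>i\<in>{1..p}. \<bar>\<Sum>t=1..int n. X (t - int i) \<omega>\<bar> \<le> e * real n"
        define \<delta> where "\<delta> = ?\<delta> n \<omega>"
        \<comment> \<open>The rounded vector depends on the whole sample, but it lies in
          \<open>\<Theta>\<close>, and \<open>h3\<close> holds for all members of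
          \<open>\<Theta>\<close> simultaneously.\<close>
        define g where "g = (\<lambda>i\<in>{1..p}. \<lfloor>?s * \<delta> i / \<epsilon>\<rfloor>)"
        define \<theta> where "\<theta> = (\<lambda>i. \<epsilon> * of_int (g i))"
        have g: "g \<in> PiE {1..p} (\<lambda>_. {- N..N})"
        proof (rule PiE_I)
          fix i assume i: "i \<in> {1..p}"
          have "\<bar>?s * \<delta> i\<bar> \<le> C1"
          proof -
            have "\<bar>?s * \<delta> i\<bar> \<le> ?s * norm1 p \<delta>" using abs_le_norm1[OF i, of \<delta>] s by (simp add: abs_mult)
            then show ?thesis using h1 C12 by (simp add: \<delta>_def)
          qed
          then have "\<bar>?s * \<delta> i / \<epsilon>\<bar> \<le> C1 / \<epsilon>" using \<epsilon> unfolding abs_divide by (simp add: divide_right_mono)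
          then have "- (\<lceil>C1 / \<epsilon>\<rceil> + 1) \<le> \<lfloor>?s * \<delta> i / \<epsilon>\<rfloor> \<and> \<lfloor>?s * \<delta> i / \<epsilon>\<rfloor> \<le> \<lceil>C1 / \<epsilon>\<rceil> + 1" by linarith
          then show "g i \<in> {- N..N}" using i unfolding g_def N_def by simp
        qed (auto simp: g_def)
        then have th: "\<theta> \<in> \<Theta>" by (auto simp: \<Theta>_def \<theta>_def)
        have close: "\<bar>?s * \<delta> i - \<theta> i\<bar> \<le> \<epsilon>" if "i \<in> {1..p}" for i
        proof -
          have "\<bar>?s * \<delta> i / \<epsilon> - of_int (g i)\<bar> \<le> 1" using that unfolding g_def by simp linarith
          then have "\<epsilon> * \<bar>?s * \<delta> i / \<epsilon> - of_int (g i)\<bar> \<le> \<epsilon> * 1" using \<epsilon> by (intro mult_left_mono) auto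
          moreover have "\<epsilon> * \<bar>?s * \<delta> i / \<epsilon> - of_int (g i)\<bar> = \<bar>?s * \<delta> i - \<theta> i\<bar>"
            unfolding \<theta>_def using \<epsilon> by (subst abs_of_pos[of \<epsilon>, symmetric], simp, subst abs_mult[symmetric]) (simp add: right_diff_distrib)
          ultimately show ?thesis by simp
        qed
        have res: "yw_residual p n (\<lambda>t. X t \<omega>) t = Z t \<omega> + regress p \<delta> (\<lambda>s. X s \<omega>) t" for t
          using x[rule_format, of t] unfolding yw_residual_def regress_def \<delta>_def
          by (simp add: left_diff_distrib sum_subtractf)
        have near: "\<bar>?s * regress p \<delta> (\<lambda>s. X s \<omega>) t - regress p \<theta> (\<lambda>s. X s \<omega>) t\<bar> \<le> \<epsilon> * (\<Sum>i=1..p. \<bar>X (t - int i) \<omega>\<bar>)" for t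
        proof -
          have "?s * regress p \<delta> (\<lambda>s. X s \<omega>) t - regress p \<theta> (\<lambda>s. X s \<omega>) t = (\<Sum>i=1..p. (?s * \<delta> i - \<theta> i) * X (t - int i) \<omega>)"
            unfolding regress_def by (simp add: sum_distrib_left left_diff_distrib sum_subtractf mult.assoc)
          also have "\<bar>\<dots>\<bar> \<le> (\<Sum>i=1..p. \<bar>(?s * \<delta> i - \<theta> i) * X (t - int i) \<omega>\<bar>)" by (rule sum_abs)
          also have "\<dots> \<le> (\<Sum>i=1..p. \<epsilon> * \<bar>X (t - int i) \<omega>\<bar>)"
            by (intro sum_mono) (simp only: abs_mult, rule mult_right_mono[OF close], auto)
          finally show ?thesis by (simp add: sum_distrib_left)
        qed
        have sumsq: "(\<Sum>t=1..int n. (bracket \<epsilon> \<theta> \<sigma> t \<omega>)\<^sup>2) \<le> q * real n" if \<sigma>: "\<sigma> \<in> {1, - 1}" for \<sigma>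
        proof -
          have "(\<Sum>t=1..int n. (bracket \<epsilon> \<theta> \<sigma> t \<omega>)\<^sup>2)
            \<le> (\<Sum>t=1..int n. 2 * \<epsilon>\<^sup>2 + 2 * (\<epsilon> + T)\<^sup>2 * real p * (\<Sum>i=1..p. (X (t - int i) \<omega>)\<^sup>2))"
            using \<epsilon> \<Theta>[OF th] \<sigma> by (intro sum_mono bracket_square) auto
          also have "\<dots> = 2 * \<epsilon>\<^sup>2 * real n + 2 * (\<epsilon> + T)\<^sup>2 * real p * (\<Sum>t=1..int n. \<Sum>i=1..p. (X (t - int i) \<omega>)\<^sup>2)"
            by (simp add: sum.distrib sum_distrib_left[symmetric])
          also have "\<dots> \<le> 2 * \<epsilon>\<^sup>2 * real n + 2 * (\<epsilon> + T)\<^sup>2 * real p * (C2 * real n)"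
          proof (intro add_left_mono mult_left_mono)
            have "(\<Sum>t=1..int n. \<Sum>i=1..p. (X (t - int i) \<omega>)\<^sup>2) / real n \<le> C2" using h2 C12 by linarith
            then show "(\<Sum>t=1..int n. \<Sum>i=1..p. (X (t - int i) \<omega>)\<^sup>2) \<le> C2 * real n" using n by (simp add: pos_divide_le_eq)
          qed auto
          finally show ?thesis by (simp add: q_def algebra_simps)
        qed
        have "?D n \<omega> z
          \<le> (E / 4 + C * (\<epsilon> * (1 + real p + C2) + real p * T * e) + H * (1 / ?s) powr \<beta> * (1 + q)) / ?s"
        proof (rule kernel_cdf_sandwich[OF kernel K_le n h[OF n] \<epsilon>(1) \<beta> H taylor[OF h[OF n]], where V="\<lambda>\<sigma> t. bracket \<epsilon> \<theta> \<sigma> t \<omega>"])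
          fix t
          have "Z t \<omega> - (bracket \<epsilon> \<theta> 1 t \<omega> - \<epsilon>) / ?s = Z t \<omega> + (regress p \<theta> (\<lambda>s. X s \<omega>) t - \<epsilon> * (\<Sum>i=1..p. \<bar>X (t - int i) \<omega>\<bar>)) / ?s"
            by (simp add: bracket_def diff_divide_distrib add_divide_distrib)
          also have "\<dots> \<le> Z t \<omega> + (?s * regress p \<delta> (\<lambda>s. X s \<omega>) t) / ?s"
            using near[of t] s by (intro add_left_mono divide_right_mono) linarith+
          finally show "Z t \<omega> - (bracket \<epsilon> \<theta> 1 t \<omega> - \<epsilon>) / ?s \<le> yw_residual p n (\<lambda>t. X t \<omega>) t" using s n by (simp add: res)
          have "Z t \<omega> + (?s * regress p \<delta> (\<lambda>s. X s \<omega>) t) / ?s \<le> Z t \<omega> + (regress p \<theta> (\<lambda>s. X s \<omega>) t + \<epsilon> * (\<Sum>i=1..p. \<bar>X (t - int i) \<omega>\<bar>)) / ?s"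
            using near[of t] s by (intro add_left_mono divide_right_mono) linarith+
          also have "\<dots> = Z t \<omega> - (bracket \<epsilon> \<theta> (- 1) t \<omega> + \<epsilon>) / ?s"
            by (simp add: bracket_def diff_divide_distrib add_divide_distrib)
          finally show "yw_residual p n (\<lambda>t. X t \<omega>) t \<le> Z t \<omega> - (bracket \<epsilon> \<theta> (- 1) t \<omega> + \<epsilon>) / ?s" using s n by (simp add: res)
        next
          fix \<sigma> :: real and k :: int assume "\<sigma> \<in> {1, - 1}"
          then have "(\<theta>, \<sigma>) \<in> \<Theta> \<times> {1, - 1}" using th by simp
          from h3[rule_format, OF this, of k]
          show "\<bar>\<Sum>t=1..int n. centred_increment K (h n) (of_int k * (\<epsilon> / ?s)) (bracket \<epsilon> \<theta> \<sigma> t \<omega> / ?s) (Z t \<omega>)\<bar> \<le> (E / 4) * ?s" by simp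
        next
          fix \<sigma> :: real assume \<sigma>: "\<sigma> \<in> {1, - 1}"
          show "\<bar>\<Sum>t=1..int n. bracket \<epsilon> \<theta> \<sigma> t \<omega>\<bar> \<le> (\<epsilon> * (1 + real p + C2) + real p * T * e) * real n"
            using \<epsilon> e h2 C12 h4 \<Theta>[OF th] \<sigma> by (intro bracket_sum_bound n) auto
          show "(\<Sum>t=1..int n. (bracket \<epsilon> \<theta> \<sigma> t \<omega>)\<^sup>2) \<le> q * real n" by (rule sumsq[OF \<sigma>])
        qed
        also have "\<dots> \<le> E / ?s"
          using \<epsilon>E eE small s by (intro divide_right_mono) (auto simp: distrib_left)
        finally show "?D n \<omega> z \<le> E / ?s" .
      qed
    qed
  qed
qed

end

section \<open>Measurability\<close>

lemma sample_acov_measurable: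
  assumes [measurable]: "\<And>t. X t \<in> borel_measurable M"
  shows "(\<lambda>\<omega>. sample_acov p n (\<lambda>t. X t \<omega>) l) \<in> borel_measurable M"
  unfolding sample_acov_def by measurable

text \<open>By the Leibniz formula the determinant is a polynomial in the entries.\<close>

lemma det_measurable:
  fixes A :: "'a \<Rightarrow> real mat"
  assumes A: "\<And>\<omega>. A \<omega> \<in> carrier_mat p p"
    and meas: "\<And>i j. i < p \<Longrightarrow> j < p \<Longrightarrow> (\<lambda>\<omega>. A \<omega> $$ (i, j)) \<in> borel_measurable M"
  shows "(\<lambda>\<omega>. Determinant.det (A \<omega>)) \<in> borel_measurable M"
proof -
  have "(\<lambda>\<omega>. \<Sum>\<pi> | \<pi> permutes {0..<p}. signof \<pi> * (\<Prod>i = 0..<p. A \<omega> $$ (i, \<pi> i))) \<in> borel_measurable M"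
  proof (intro borel_measurable_sum borel_measurable_times borel_measurable_const borel_measurable_prod meas)
    fix \<pi> i assume "\<pi> \<in> {\<pi>. \<pi> permutes {0..<p}}" "i \<in> {0..<p}"
    then show "i < p" "\<pi> i < p" using permutes_in_image[of \<pi> "{0..<p}" i] by auto
  qed
  then show ?thesis using det_def'[OF A] by simp
qed

lemma yule_walker_measurable:
  assumes X: "\<And>t. X t \<in> borel_measurable M" and i: "i < p"
  shows "(\<lambda>\<omega>. vec_index (yule_walker p n (\<lambda>t. X t \<omega>)) i) \<in> borel_measurable M"
proof -
  let ?A = "\<lambda>\<omega>. sample_acov_mat p n (\<lambda>t. X t \<omega>)" and ?g = "\<lambda>\<omega>. sample_acov_vec p n (\<lambda>t. X t \<omega>)"
  have [measurable]: "(\<lambda>\<omega>. Determinant.det (?A \<omega>)) \<in> borel_measurable M"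
    by (rule det_measurable[of _ p]) (auto simp: sample_acov_mat_def intro!: sample_acov_measurable X)
  have [measurable]: "(\<lambda>\<omega>. Determinant.det (replace_col (?A \<omega>) (?g \<omega>) i)) \<in> borel_measurable M"
  proof (rule det_measurable[of _ p])
    fix k j assume "k < p" "j < p"
    then show "(\<lambda>\<omega>. replace_col (?A \<omega>) (?g \<omega>) i $$ (k, j)) \<in> borel_measurable M"
      by (cases "j = i") (auto simp: replace_col_def sample_acov_mat_def sample_acov_vec_def intro!: sample_acov_measurable X)
  qed (auto simp: replace_col_def sample_acov_mat_def)
  show ?thesis unfolding yule_walker_cramer[OF i] by measurable
qed

lemma yw_residual_measurable:
  assumes X [measurable]: "\<And>t. X t \<in> borel_measurable M"
  shows "(\<lambda>\<omega>. yw_residual p n (\<lambda>t. X t \<omega>) t) \<in> borel_measurable M"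
proof -
  have [measurable]: "(\<lambda>\<omega>. vec_index (yule_walker p n (\<lambda>t. X t \<omega>)) (i - 1)) \<in> borel_measurable M" if "i \<in> {1..p}" for i
    using that by (intro yule_walker_measurable X) auto
  show ?thesis unfolding yw_residual_def by measurable
qed

text \<open>Makes the uncountable supremum countable, hence measurable; by continuity a bound on the
  rationals extends to their closure.\<close>

lemma SUP_continuous_rationals:
  fixes f :: "real \<Rightarrow> real"
  assumes cont: "continuous_on UNIV f" and bdd: "bdd_above (range f)"
  shows "(SUP z. f z) = (SUP z\<in>\<rat>. f z)"
proof (rule antisym)
  have bddQ: "bdd_above (f ` \<rat>)" by (rule bdd_above_mono[OF bdd]) auto
  show "(SUP z. f z) \<le> (SUP z\<in>\<rat>. f z)"
  proof (rule cSUP_least)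
    fix z
    show "f z \<le> (SUP z\<in>\<rat>. f z)"
      by (rule continuous_le_on_closure[of "\<rat>" f z])
        (use cSUP_upper[OF _ bddQ] continuous_on_subset[OF cont] in \<open>auto simp: Rats_closure_real\<close>)
  qed simp
  show "(SUP z\<in>\<rat>. f z) \<le> (SUP z. f z)"
    by (rule cSUP_subset_mono) (use bdd in auto)
qed

lemma kernel_cdf_bounds:
  assumes "symmetric_kernel K" "h > 0" "n \<ge> 1"
  shows "0 \<le> kernel_cdf K h n e z" "kernel_cdf K h n e z \<le> 1"
proof -
  have "(\<Sum>t=1..int n. kernel_int K ((z - e t) / h)) \<le> (\<Sum>t=1..int n. 1)"
    by (intro sum_mono kernel_int_le_1 assms)
  then show "kernel_cdf K h n e z \<le> 1" using assms by (simp add: kernel_cdf_eq)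
  show "0 \<le> kernel_cdf K h n e z" using assms by (auto simp: kernel_cdf_eq intro!: divide_nonneg_nonneg sum_nonneg kernel_int_nonneg)
qed

lemma kernel_cdf_sup_measurable:
  assumes kernel: "symmetric_kernel K" and B: "\<And>u. K u \<le> B" and h: "h > 0" and n: "n \<ge> 1"
    and e: "\<And>t. (\<lambda>\<omega>. e \<omega> t) \<in> borel_measurable M" and e': "\<And>t. (\<lambda>\<omega>. e' \<omega> t) \<in> borel_measurable M"
  shows "(\<lambda>\<omega>. SUP z. \<bar>kernel_cdf K h n (e \<omega>) z - kernel_cdf K h n (e' \<omega>) z\<bar>) \<in> borel_measurable M"
proof -
  let ?D = "\<lambda>\<omega> z. \<bar>kernel_cdf K h n (e \<omega>) z - kernel_cdf K h n (e' \<omega>) z\<bar>"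
  note [measurable] = e e'
  have [measurable]: "kernel_int K \<in> borel_measurable borel"
    by (rule borel_measurable_mono[OF kernel_int_mono[OF kernel]])
  have "?D \<omega> z \<le> 1" for \<omega> z
    using kernel_cdf_bounds[OF kernel h n, of "e \<omega>" z] kernel_cdf_bounds[OF kernel h n, of "e' \<omega>" z] by linarith
  then have bdd: "bdd_above (?D \<omega> ` A)" for \<omega> A by (intro bdd_aboveI[of _ 1]) auto
  have c: "continuous_on UNIV (\<lambda>z. kernel_int K ((z - a) / h))" for a
    by (rule continuous_on_compose2[OF kernel_int_continuous[OF kernel B]]) (use h in \<open>auto intro!: continuous_intros\<close>)
  have "continuous_on UNIV (?D \<omega>)" for \<omega>
    unfolding kernel_cdf_eq[OF kernel h] using n by (intro continuous_intros c) auto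
  then have "(\<lambda>\<omega>. SUP z. ?D \<omega> z) = (\<lambda>\<omega>. SUP z\<in>\<rat>. ?D \<omega> z)"
    by (intro ext SUP_continuous_rationals bdd)
  moreover have "(\<lambda>\<omega>. SUP z\<in>\<rat>. ?D \<omega> z) \<in> borel_measurable M"
  proof (rule borel_measurable_cSUP)
    show "countable (\<rat> :: real set)" by (rule countable_rat)
    show "(\<lambda>\<omega>. ?D \<omega> z) \<in> borel_measurable M" for z
      unfolding kernel_cdf_eq[OF kernel h] by measurable
  qed (rule bdd)
  ultimately show ?thesis by simp
qed

lemma powr_minus_half: "real n powr (- (1/2)) = 1 / sqrt (real n)"
  by (simp add: powr_minus_divide powr_half_sqrt)

lemma distr_shift_strictly_stationary:
  assumes "strictly_stationary M X"
  shows "distr M borel (X s) = distr M borel (X 0)"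
proof -
  have [measurable]: "X t \<in> borel_measurable M" for t using assms by (simp add: strictly_stationary_def)
  let ?J = "{0 :: int}" and ?Q = "Pi\<^sub>M {0 :: int} (\<lambda>_. borel :: real measure)"
  have eq: "distr M ?Q (\<lambda>\<omega>. \<lambda>t\<in>?J. X (t + s) \<omega>) = distr M ?Q (\<lambda>\<omega>. \<lambda>t\<in>?J. X t \<omega>)"
    using assms by (simp add: strictly_stationary_def)
  have "distr M borel (X s') = distr (distr M ?Q (\<lambda>\<omega>. \<lambda>t\<in>?J. X (t + s') \<omega>)) borel (\<lambda>f. f 0)" for s'
    by (subst distr_distr) (auto simp: comp_def intro!: measurable_component_singleton measurable_restrict)
  from this[of s] this[of 0] show ?thesis using eq by simp
qed

theorem theorem2:
  fixes M :: "'a measure"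
    and X Z :: "int \<Rightarrow> 'a \<Rightarrow> real"
    and p :: nat
    and \<phi> :: "nat \<Rightarrow> real"
    and \<sigma> \<beta> C\<^sub>f :: real
    and f F K :: "real \<Rightarrow> real"
    and h :: "nat \<Rightarrow> real"
  assumes "prob_space M"
    and "p \<ge> 1"
    and "1/3 < \<beta>" and "\<beta> \<le> 1"
    and noise: "iid_noise M Z \<sigma> f F"
    and ar: "ar_process M p \<phi> X Z"
    and smooth_F: "F \<in> holder_class 1 \<beta>"
    and "C\<^sub>f > 0" and bound_f: "\<And>z. 0 < f z \<and> f z \<le> C\<^sub>f"
    and stationary: "strictly_stationary M X"
    and causal: "ar_causal p \<phi>"
    and kernel: "symmetric_kernel K"
    and smooth_K: "K \<in> cont_diff_class 2"
    and h_pos: "\<And>n. n \<ge> 1 \<Longrightarrow> h n > 0"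
    and h_lower: "seq_much_less (\<lambda>n. real n powr (- 3/8)) h"
    and h_upper: "seq_much_less h (\<lambda>n. real n powr (- 1 / (2 * (1 + \<beta>))))"
    and tails:
      "((\<exists>\<eta>>6/5. \<forall>t. integrable M (\<lambda>\<omega>. \<bar>Z t \<omega>\<bar> powr (6 + 3 * \<eta>))) \<and>
        (\<exists>\<gamma>>0. big_o_prob M (\<lambda>n \<omega>. abs_max (\<lambda>t. X t \<omega>) n) (\<lambda>n. real n powr \<gamma>)))
       \<or> (\<forall>t. exp_tail M (Z t) f)"
  shows "small_o_prob M
    (\<lambda>n \<omega>. SUP z. \<bar>kernel_cdf K (h n) n (yw_residual p n (\<lambda>t. X t \<omega>)) z
                  - kernel_cdf K (h n) n (\<lambda>t. Z t \<omega>) z\<bar>)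
    (\<lambda>n. real n powr (- 1/2))"
proof -
  interpret prob_space M by fact
  define P where "P = distr M borel (Z 0)"
  have dist: "distributed M lborel (Z t) (\<lambda>z. ennreal (f z))" and cdf: "cdf (distr M borel (Z t)) = F" for t
    using noise unfolding iid_noise_def by auto
  have density: "distr M borel (Z t) = density lborel (\<lambda>z. ennreal (f z))" for t
  proof -
    have "distr M borel (Z t) = distr M lborel (Z t)" by (rule distr_cong) auto
    then show ?thesis using distributed_distr_eq_density[OF dist] by simp
  qed
  interpret iid: iid_space M Z P
    by unfold_locales (use noise in \<open>auto simp: iid_noise_def P_def density\<close>)
  have P_density: "P = density lborel (\<lambda>z. ennreal (f z))" by (simp add: P_def density)
  have f_meas [measurable]: "(\<lambda>z. ennreal (f z)) \<in> borel_measurable borel"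
    using distributed_borel_measurable[OF dist] by simp
  have F_cdf: "cdf P = F" by (simp add: P_def cdf)
  have P_sq: "integrable P (\<lambda>z. z\<^sup>2)"
    using noise iid.integrable_Z[of "\<lambda>z. z\<^sup>2" 0] by (auto simp: iid_noise_def has_bochner_integral_iff)
  have P_mean: "(\<integral>z. z \<partial>P) = 0"
    using noise iid.expectation_Z[of "\<lambda>z. z" 0] by (auto simp: iid_noise_def has_bochner_integral_iff)
  define \<mu> where "\<mu> = (\<integral>z. min (z\<^sup>2) 1 \<partial>P)"
  \<comment> \<open>If \<open>\<mu>\<close> were 0, the innovations would vanish almost surely. As
    the density is positive everywhere, almost every real in the Lebesgue sense would be 0, which is
    absurd.\<close>
  have \<mu>: "\<mu> > 0"
  proof -
    have i: "integrable P (\<lambda>z. min (z\<^sup>2) 1)" by (rule iid.P.integrable_const_bound[of _ 1]) auto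
    have "0 \<le> \<mu>" unfolding \<mu>_def by (intro Bochner_Integration.integral_nonneg) auto
    moreover have "\<mu> \<noteq> 0"
    proof
      assume "\<mu> = 0"
      then have "AE z in P. min (z\<^sup>2) 1 = 0"
        using integral_nonneg_eq_0_iff_AE[OF i] by (auto simp: \<mu>_def)
      then have "AE z in lborel. 0 < ennreal (f z) \<longrightarrow> min (z\<^sup>2) 1 = (0::real)"
        unfolding P_density by (subst (asm) AE_density) auto
      then have "AE z in lborel :: real measure. False"
        using AE_lborel_singleton[of 0]
      proof eventually_elim
        case (elim z)
        then show ?case using bound_f[of z] by (auto simp: min_def split: if_splits)
      qed
      then have "ae_filter (lborel :: real measure) = bot" by (simp add: trivial_limit_def)
      then show False by (simp add: ae_filter_eq_bot_iff)
    qed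
    ultimately show ?thesis by simp
  qed
  define \<psi> where "\<psi> = ma_coeff p \<phi>"
  have \<psi>: "summable (\<lambda>j. \<bar>\<psi> j\<bar>)" unfolding \<psi>_def by (rule ma_coeff_summable[OF causal])
  \<comment> \<open>\<open>X\<close> need not itself be measurable for the past, since it satisfies
    the recursion only almost surely. The bounds are proved for \<open>Y\<close> and carried over at
    the end.\<close>
  define Y where "Y = iid.lin_proc \<psi>"
  have X_meas: "X t \<in> borel_measurable M" for t using ar by (simp add: ar_process_def)
  have ar': "AE \<omega> in M. \<forall>t. X t \<omega> = regress p \<phi> (\<lambda>s. X s \<omega>) t + Z t \<omega>"
    using ar unfolding ar_process_def regress_def by (simp add: AE_all_countable)
  have XY: "AE \<omega> in M. \<forall>t. X t \<omega> = Y t \<omega>"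
    unfolding Y_def \<psi>_def
    by (rule iid.stationary_solution_unique[OF P_sq \<open>p \<ge> 1\<close> causal X_meas distr_shift_strictly_stationary[OF stationary] ar'])
  interpret ar_space M Z P Y p \<phi> "(\<Sum>j. \<bar>\<psi> j\<bar>)\<^sup>2 * (\<integral>z. z\<^sup>2 \<partial>P)" \<mu>
  proof unfold_locales
    show "AE \<omega> in M. \<forall>t. Y t \<omega> = regress p \<phi> (\<lambda>s. Y s \<omega>) t + Z t \<omega>"
      using ar' XY
    proof (eventually_elim, intro allI)
      fix \<omega> t
      assume x: "\<forall>t. X t \<omega> = regress p \<phi> (\<lambda>s. X s \<omega>) t + Z t \<omega>" and y: "\<forall>t. X t \<omega> = Y t \<omega>"
      have "regress p \<phi> (\<lambda>s. X s \<omega>) t = regress p \<phi> (\<lambda>s. Y s \<omega>) t" by (simp add: y)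
      then show "Y t \<omega> = regress p \<phi> (\<lambda>s. Y s \<omega>) t + Z t \<omega>"
        using x[rule_format, of t] y[rule_format, of t] by linarith
    qed
    show "Y t \<in> borel_measurable (iid.past (t + 1))" for t
      unfolding Y_def by (rule iid.lin_proc_past) simp
    show "integrable M (\<lambda>\<omega>. (Y t \<omega>)\<^sup>2)" for t unfolding Y_def by (rule iid.lin_proc_square(1)[OF P_sq \<psi>])
    show "expectation (\<lambda>\<omega>. (Y t \<omega>)\<^sup>2) \<le> (\<Sum>j. \<bar>\<psi> j\<bar>)\<^sup>2 * (\<integral>z. z\<^sup>2 \<partial>P)" for t
      unfolding Y_def by (rule iid.lin_proc_square(2)[OF P_sq \<psi>])
    show "(\<integral>z. min (z\<^sup>2) 1 \<partial>P) = \<mu>" by (simp add: \<mu>_def)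
  qed (fact \<open>p \<ge> 1\<close> P_sq P_mean \<mu> ma_coeff_summable(2)[OF causal])+
  obtain B where B: "B > 0" "\<And>u. K u \<le> B" using kernel_bounded[OF kernel smooth_K] by blast
  \<comment> \<open>The bound on the density is passed on through interval probabilities, because
    \<open>F'\<close> is obtained by differentiating \<open>F\<close>.\<close>
  have lip: "0 \<le> F y - F x \<and> F y - F x \<le> C\<^sub>f * (y - x)" if "x \<le> y" for x y
  proof
    show "0 \<le> F y - F x" using iid.P.cdf_nondecreasing[OF that] by (simp add: F_cdf)
    have "F y - F x = measure P {x<..y}"
      using that iid.P.cdf_diff_eq[of x y] by (cases "x = y") (auto simp: F_cdf)
    also have "\<dots> \<le> C\<^sub>f * (y - x)"
    proof -
      have "emeasure P {x<..y} = (\<integral>\<^sup>+z. ennreal (f z) * indicator {x<..y} z \<partial>lborel)"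
        unfolding P_density by (rule emeasure_density) auto
      also have "\<dots> \<le> (\<integral>\<^sup>+z. ennreal C\<^sub>f * indicator {x<..y} z \<partial>lborel)"
        using bound_f by (intro nn_integral_mono mult_right_mono ennreal_leI) auto
      also have "\<dots> = ennreal (C\<^sub>f * (y - x))"
        using that \<open>C\<^sub>f > 0\<close> by (subst nn_integral_cmult_indicator) (auto simp: ennreal_mult)
      finally show ?thesis
        using that \<open>C\<^sub>f > 0\<close> by (simp add: iid.P.emeasure_eq_measure ennreal_le_iff)
    qed
    finally show "F y - F x \<le> C\<^sub>f * (y - x)" .
  qed
  have \<beta>: "0 < \<beta>" using \<open>1/3 < \<beta>\<close> by simp
  obtain F' H where H: "H \<ge> 0" and F': "continuous_on UNIV F'" "\<And>x. 0 \<le> F' x" "\<And>x. F' x \<le> C\<^sub>f"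
    and tay: "\<And>x a. \<bar>F (x + a) - F x - a * F' x\<bar> \<le> H * \<bar>a\<bar> powr (1 + \<beta>)"
    by (rule holder_class_1_taylor[OF smooth_F lip \<beta>]) (assumption, rule that)
  have taylor: "\<exists>s. 0 \<le> s \<and> s \<le> C\<^sub>f \<and> (\<forall>a. \<bar>iid.smooth_cdf K h (x + a) - iid.smooth_cdf K h x - a * s\<bar> \<le> H * \<bar>a\<bar> powr (1 + \<beta>))"
    if "h > 0" for h x
    unfolding iid.smooth_cdf_def[OF kernel B(2)]
    by (rule smoothed_cdf_taylor[OF iid.real_distribution_P kernel that F']) (simp add: F_cdf tay)
  \<comment> \<open>Here \<open>1 / sqrt n\<close> is \<open>n\<close> to the power -1/2, and -1/2
    is below -3/8, so the lower bandwidth condition dominates.\<close>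
  have lim: "(\<lambda>n. 1 / (sqrt (real n) * h n)) \<longlonglongrightarrow> 0"
  proof (rule Lim_null_comparison)
    show "(\<lambda>n. real n powr (- 3/8) / h n) \<longlonglongrightarrow> 0" using h_lower by (simp add: seq_much_less_def)
    show "\<forall>\<^sub>F n in sequentially. norm (1 / (sqrt (real n) * h n)) \<le> real n powr (- 3/8) / h n"
    proof (rule eventually_sequentiallyI[of 1])
      fix n :: nat assume n: "n \<ge> 1"
      have "real n powr (- (1/2)) \<le> real n powr (- 3/8)" using n by (intro powr_mono) auto
      then have "real n powr (- (1/2)) / h n \<le> real n powr (- 3/8) / h n"
        using h_pos[OF n] by (intro divide_right_mono) auto
      then show "norm (1 / (sqrt (real n) * h n)) \<le> real n powr (- 3/8) / h n"
        using h_pos[OF n] by (simp add: powr_minus_half)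
    qed
  qed
  let ?D = "\<lambda>X n \<omega> z. \<bar>kernel_cdf K (h n) n (yw_residual p n (\<lambda>t. X t \<omega>)) z - kernel_cdf K (h n) n (\<lambda>t. Z t \<omega>) z\<bar>"
  show ?thesis
  proof (rule small_o_probI)
    fix n
    show "(\<lambda>\<omega>. SUP z. ?D X n \<omega> z) \<in> borel_measurable M"
    \<comment> \<open>Positivity of \<open>h 0\<close> is not assumed; at \<open>n = 0\<close> both
      estimators are empty sums and the supremum is constant.\<close>
    proof (cases "n = 0")
      case True
      then show ?thesis by (simp add: kernel_cdf_def)
    next
      case False
      then show ?thesis
        by (intro kernel_cdf_sup_measurable[OF kernel B(2)] h_pos yw_residual_measurable X_meas) auto
    qed
  next
    fix e \<tau> :: real assume e: "e > 0" and \<tau>: "\<tau> > 0"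
    show "whp \<tau> (\<lambda>n \<omega>. \<bar>SUP z. ?D X n \<omega> z\<bar> \<le> e * real n powr (- 1/2))"
    proof (rule whp_mono[OF whp_kernel_cdf_diff[OF kernel B(2) h_pos lim \<beta> \<open>\<beta> \<le> 1\<close> H \<open>C\<^sub>f > 0\<close> taylor e \<tau>]])
      show "\<forall>\<^sub>F n in sequentially. AE \<omega> in M.
        (\<forall>z. ?D Y n \<omega> z \<le> e / sqrt (real n)) \<longrightarrow>
        \<bar>SUP z. ?D X n \<omega> z\<bar> \<le> e * real n powr (- 1/2)"
      proof (rule eventually_sequentiallyI[of 1])
        fix n :: nat assume n: "n \<ge> 1"
        have pw: "e * real n powr (- 1/2) = e / sqrt (real n)" by (simp add: powr_minus_half)
        show "AE \<omega> in M.
        (\<forall>z. ?D Y n \<omega> z \<le> e / sqrt (real n)) \<longrightarrow>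
        \<bar>SUP z. ?D X n \<omega> z\<bar> \<le> e * real n powr (- 1/2)"
          using XY
        proof (eventually_elim, intro impI)
          fix \<omega>
          \<comment> \<open>The whole paths agree, hence so do the Yule-Walker estimates and the
            residuals.\<close>
          assume "\<forall>t. X t \<omega> = Y t \<omega>"
          then have XY': "(\<lambda>t. X t \<omega>) = (\<lambda>t. Y t \<omega>)" by auto
          assume "\<forall>z. ?D Y n \<omega> z \<le> e / sqrt (real n)"
          then have D: "?D X n \<omega> z \<le> e / sqrt (real n)" for z unfolding XY' by blast
          have "(SUP z. ?D X n \<omega> z) \<le> e / sqrt (real n)" by (rule cSUP_least) (auto intro: D)
          moreover have "0 \<le> (SUP z. ?D X n \<omega> z)"
            by (rule cSUP_upper2[where x="0::real"]) (auto intro!: bdd_aboveI2[of _ _ "e / sqrt (real n)"] D)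
          ultimately show "\<bar>SUP z. ?D X n \<omega> z\<bar> \<le> e * real n powr (- 1/2)" unfolding pw by linarith
        qed
      qed
    qed
  qed
qed

end
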